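(* Let $X$ and $Y$ be Banach spaces, let $p,q\in[1,+\infty)$, and let $f:\mathbb{R}\times X\to Y$ be a map. Put $\mathcal{N}_f(u)(t)=f(t,u(t))$ for $u:\mathbb{R}\to X$, $t\in\mathbb{R}$. For a compact set $K\subset X$ let $\tilde f_K:\mathbb{R}\to C(K,Y)$ be the map defined by $\tilde f_K(t)=f(t,\cdot)|_K$ for a.e. $t\in\mathbb{R}$. Suppose that there exist a constant $a>0$ and $b\in S^q_{aa}(\mathbb{R})$ such that for a.e. $t\in\mathbb{R}$ and all $x\in X$, $\|f(t,x)\|\le a\|x\|^{p/q}+b(t)$. Then: (i) If for every compact set $K\subset X$ one has $\tilde f_K\in S^q_{aa}(\mathbb{R},C(K,Y))$ (in particular $f(t,\cdot)|_K$ is continuous for a.e. $t$), then $\mathcal{N}_f$ maps $S^p_{aa}(\mathbb{R},X)$ into $S^q_{aa}(\mathbb{R},Y)$ and $\mathcal{N}_f:S^p_{aa}(\mathbb{R},X)\to S^q_{aa}(\mathbb{R},Y)$ is continuous. (ii) If for every compact set $K\subset X$ one has $\tilde f_K\in S^q_{ap}(\mathbb{R},C(K,Y))$ (in particular $f(t,\cdot)|_K$ is continuous for a.e. $t$), then $\mathcal{N}_f$ maps $S^p_{ap}(\mathbb{R},X)$ into $S^q_{ap}(\mathbb{R},Y)$ and $\mathcal{N}_f:S^p_{ap}(\mathbb{R},X)\to S^q_{ap}(\mathbb{R},Y)$ is continuous.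
   Context: For a compact set $K\subset X$, $C(K,Y)$ is the Banach space of continuous maps $K\to Y$ with the supremum norm. For a Banach space $E$ and $1\le p<\infty$: $L^p(a,b;E)$ is the space of Bochner $p$-integrable functions on $(a,b)$ (functions equal a.e. are identified), and $L^p_{loc}(\mathbb{R},E)$ is the space of functions $u:\mathbb{R}\to E$ whose restriction to every bounded interval is in $L^p$ of that interval. The Bochner transform of $u\in L^p_{loc}(\mathbb{R},E)$ is the (continuous) map $u^b:\mathbb{R}\to L^p(0,1;E)$, $u^b(t)(\theta)=u(t+\theta)$, $\theta\in(0,1)$. A continuous function $u:\mathbb{R}\to E$ is almost periodic (in the sense of Bohr) if for each $\varepsilon>0$ the set $\{\tau\in\mathbb{R}:\sup_{t\in\mathbb{R}}\|u(t+\tau)-u(t)\|\le\varepsilon\}$ is relatively dense in $\mathbb{R}$ (meets every interval of some fixed length); the space of such functions is $AP(\mathbb{R},E)$. A continuous function $u:\mathbb{R}\to E$ is almost automorphic if every sequence of real numbers has a subsequence $(t_k)$ for which there is a function $v:\mathbb{R}\to E$ with $\lim_k u(t+t_k)=v(t)$ and $\lim_k v(t-t_k)=u(t)$ for every $t\in\mathbb{R}$; the space of such functions is $AA(\mathbb{R},E)$. $S^p_{aa}(\mathbb{R},E)=\{u\in L^p_{loc}(\mathbb{R},E): u^b\in AA(\mathbb{R},L^p(0,1;E))\}$ and $S^p_{ap}(\mathbb{R},E)=\{u\in L^p_{loc}(\mathbb{R},E): u^b\in AP(\mathbb{R},L^p(0,1;E))\}$ are Banach spaces with the norm $\|u\|_{S^p}=\sup_{t\in\mathbb{R}}\left(\int_0^1\|u(t+\theta)\|^p\,d\theta\right)^{1/p}$.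 We write $S^q_{aa}(\mathbb{R})$ for $S^q_{aa}(\mathbb{R},\mathbb{R})$. *)

theory Defs
  imports "HOL-Analysis.Analysis"
begin

text \<open>
  The statement needs \<open>L\<^sup>p\<close> and Stepanov spaces both over Banach spaces given as types and over
  the spaces \<open>C(K,Y)\<close>, where \<open>K\<close> is a bound variable, so that \<open>C(K,Y)\<close> is not a type.
  Hence a Banach space \<open>E\<close> is represented here by a pair consisting of its norm metric
  \<open>m :: 'e metric\<close> and its zero vector \<open>z\<close>, the norm being \<open>mdist m z\<close>.  A type of
  class \<open>banach\<close> is the pair \<open>euclidean_metric\<close>, \<open>0\<close>.
\<close>

section \<open>Lebesgue-Bochner spaces\<close>

definition strongly_measurable :: "'x measure \<Rightarrow> 'e metric \<Rightarrow> ('x \<Rightarrow> 'e) \<Rightarrow> bool" where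
  "strongly_measurable M m f \<longleftrightarrow>
     (\<exists>s. (\<forall>n::nat. simple_function M (s n) \<and> s n \<in> space M \<rightarrow> mspace m) \<and>
          (AE x in M. limitin (mtopology_of m) (\<lambda>n. s n x) (f x) sequentially))"

definition Lp_fun :: "'x measure \<Rightarrow> real \<Rightarrow> 'e metric \<Rightarrow> 'e \<Rightarrow> ('x \<Rightarrow> 'e) set" where
  "Lp_fun M p m z =
     {f. strongly_measurable M m f \<and> integrable M (\<lambda>x. mdist m z (f x) powr p)}"

definition Lp_class ::
  "'x measure \<Rightarrow> real \<Rightarrow> 'e metric \<Rightarrow> 'e \<Rightarrow> ('x \<Rightarrow> 'e) \<Rightarrow> ('x \<Rightarrow> 'e) set" where
  "Lp_class M p m z f = {g \<in> Lp_fun M p m z. AE x in M. g x = f x}"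

definition Lp_dist :: "'x measure \<Rightarrow> real \<Rightarrow> 'e metric \<Rightarrow> ('x \<Rightarrow> 'e) \<Rightarrow> ('x \<Rightarrow> 'e) \<Rightarrow> real" where
  "Lp_dist M p m f g = (LINT x|M. mdist m (f x) (g x) powr p) powr (1 / p)"

text \<open>
  The space \<open>L\<^sup>p(M;E)\<close> of almost-everywhere classes.  \<open>M\<close> should be complete and \<open>p \<ge> 1\<close>;
  that this is then a metric space, with the expected carrier and distance, is proved in
  \<open>mspace_Lp\<close> and \<open>mdist_Lp\<close>.
\<close>

definition Lp :: "'x measure \<Rightarrow> real \<Rightarrow> 'e metric \<Rightarrow> 'e \<Rightarrow> ('x \<Rightarrow> 'e) set metric" where
  "Lp M p m z = metric (Lp_class M p m z ` Lp_fun M p m z,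
     \<lambda>A B. Lp_dist M p m (SOME f. f \<in> A) (SOME g. g \<in> B))"

lemma powr_convex_nonneg:
  fixes x y t p :: real
  assumes "p \<ge> 1" "x \<ge> 0" "y \<ge> 0" "0 < t" "t < 1"
  shows "(t * x + (1 - t) * y) powr p \<le> t * x powr p + (1 - t) * y powr p"
proof -
  have aux: "(s * w) powr p \<le> s * w powr p" if "0 < s" "s < 1" "w \<ge> 0" for s w :: real
  proof -
    have "s powr p \<le> s powr 1"
      using that assms by (intro powr_mono') auto
    then have "s powr p * w powr p \<le> s * w powr p"
      using that by (intro mult_right_mono) auto
    then show ?thesis
      using that by (simp add: powr_mult)
  qed
  consider "x = 0" | "y = 0" | "x > 0" "y > 0"
    using assms by linarith
  then show ?thesis
  proof cases
    case 1
    then show ?thesis using aux[of "1 - t" y] assms by simp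
  next
    case 2
    then show ?thesis using aux[of t x] assms by simp
  next
    case 3
    have "(t *\<^sub>R x + (1 - t) *\<^sub>R y) powr p \<le> t * x powr p + (1 - t) * y powr p"
      using convex_onD[OF powr_convex[OF assms(1)], of "1 - t" x y] 3 assms by simp
    then show ?thesis by simp
  qed
qed

lemma powr_add_le_scaled:
  fixes x y a b p :: real
  assumes "p \<ge> 1" "x \<ge> 0" "y \<ge> 0" "a > 0" "b > 0"
  shows "(x + y) powr p \<le>
    (a + b) powr p * (a / (a + b) * (x powr p / a powr p) + b / (a + b) * (y powr p / b powr p))"
proof -
  define t where "t = a / (a + b)"
  have t: "0 < t" "t < 1" "1 - t = b / (a + b)"
    using assms by (auto simp: t_def field_simps)
  have eq: "x + y = (a + b) * (t * (x / a) + (1 - t) * (y / b))"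
  proof -
    have "(a + b) * (t * (x / a)) = x" "(a + b) * ((1 - t) * (y / b)) = y"
      unfolding t(3) using assms by (simp_all add: t_def)
    then show ?thesis
      by (simp add: distrib_left)
  qed
  have "(x + y) powr p = (a + b) powr p * (t * (x / a) + (1 - t) * (y / b)) powr p"
    unfolding eq using assms t by (subst powr_mult) auto
  also have "\<dots> \<le> (a + b) powr p * (t * (x / a) powr p + (1 - t) * (y / b) powr p)"
    using assms t by (intro mult_left_mono powr_convex_nonneg) auto
  finally show ?thesis
    using assms unfolding t(3) by (simp add: t_def powr_divide)
qed

lemma Minkowski_aux:
  fixes f g h :: "'x \<Rightarrow> real"
  assumes p: "p \<ge> 1"
    and int: "integrable M (\<lambda>x. f x powr p)" "integrable M (\<lambda>x. g x powr p)"
      "integrable M (\<lambda>x. h x powr p)"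
    and nn: "\<And>x. 0 \<le> f x" "\<And>x. 0 \<le> g x" "\<And>x. 0 \<le> h x"
    and le: "AE x in M. h x \<le> f x + g x"
  shows "(LINT x|M. h x powr p) powr (1 / p)
           \<le> (LINT x|M. f x powr p) powr (1 / p) + (LINT x|M. g x powr p) powr (1 / p)"
proof (rule field_le_epsilon)
  fix e :: real assume e: "e > 0"
  define A where "A = (LINT x|M. f x powr p)"
  define B where "B = (LINT x|M. g x powr p)"
  define a where "a = A powr (1 / p) + e / 2"
  define b where "b = B powr (1 / p) + e / 2"
  have AB: "A \<ge> 0" "B \<ge> 0"
    by (simp_all add: A_def B_def)
  have ab: "a > 0" "b > 0"
    using e by (simp_all add: a_def b_def add_nonneg_pos)
  have Aa: "A \<le> a powr p"
  proof -
    have "A = (A powr (1 / p)) powr p"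
      using p AB by (simp add: powr_powr)
    also have "\<dots> \<le> a powr p"
      using e p by (intro powr_mono2) (auto simp: a_def)
    finally show ?thesis .
  qed
  have Bb: "B \<le> b powr p"
  proof -
    have "B = (B powr (1 / p)) powr p"
      using p AB by (simp add: powr_powr)
    also have "\<dots> \<le> b powr p"
      using e p by (intro powr_mono2) (auto simp: b_def)
    finally show ?thesis .
  qed
  define c where "c = (a + b) powr p * (a / (a + b) / a powr p)"
  define d where "d = (a + b) powr p * (b / (a + b) / b powr p)"
  have "(LINT x|M. h x powr p) \<le> (LINT x|M. c * f x powr p + d * g x powr p)"
  proof (rule integral_mono_AE)
    show "AE x in M. h x powr p \<le> c * f x powr p + d * g x powr p"
      using le
    proof eventually_elim
      case (elim x)
      have "h x powr p \<le> (f x + g x) powr p"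
        using elim nn p by (intro powr_mono2) auto
      also have "\<dots> \<le> (a + b) powr p *
          (a / (a + b) * (f x powr p / a powr p) + b / (a + b) * (g x powr p / b powr p))"
        by (rule powr_add_le_scaled[OF p nn(1) nn(2) ab])
      also have "\<dots> = c * f x powr p + d * g x powr p"
        by (simp add: c_def d_def distrib_left mult.assoc)
      finally show ?case .
    qed
    show "integrable M (\<lambda>x. c * f x powr p + d * g x powr p)"
      by (intro Bochner_Integration.integrable_add integrable_mult_right int)
  qed (rule int(3))
  also have "\<dots> = c * A + d * B"
    unfolding A_def B_def
    by (simp only: Bochner_Integration.integral_add integrable_mult_right int
        integral_mult_right_zero)
  also have "\<dots> = (a + b) powr p * (a / (a + b) * (A / a powr p) + b / (a + b) * (B / b powr p))"
    by (simp add: c_def d_def distrib_left mult.assoc)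
  also have "\<dots> \<le> (a + b) powr p * (a / (a + b) * 1 + b / (a + b) * 1)"
    using ab Aa Bb by (intro mult_left_mono add_mono) auto
  also have "\<dots> = (a + b) powr p"
  proof -
    have "a / (a + b) * 1 + b / (a + b) * 1 = 1"
      using ab by (simp flip: add_divide_distrib)
    then show ?thesis by simp
  qed
  finally have "(LINT x|M. h x powr p) powr (1 / p) \<le> ((a + b) powr p) powr (1 / p)"
    using p by (intro powr_mono2) auto
  also have "\<dots> = a + b"
    using ab p by (simp add: powr_powr)
  finally show "(LINT x|M. h x powr p) powr (1 / p) \<le>
    (LINT x|M. f x powr p) powr (1 / p) + (LINT x|M. g x powr p) powr (1 / p) + e"
    by (simp add: a_def b_def A_def B_def)
qed

lemma (in complete_measure) borel_measurable_AE_cong_complete: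
  fixes f g :: "'a \<Rightarrow> real"
  assumes "f \<in> borel_measurable M" "AE x in M. f x = g x"
  shows "g \<in> borel_measurable M"
proof (rule measurableI)
  fix S :: "real set" assume "S \<in> sets borel"
  then have S: "f -` S \<inter> space M \<in> sets M"
    using assms(1) by (rule measurable_sets[rotated])
  have "AE x in M. (x \<in> f -` S \<inter> space M) = (x \<in> g -` S \<inter> space M)"
    using assms(2) by eventually_elim auto
  from in_sets_AE[OF this S] show "g -` S \<inter> space M \<in> sets M"
    by auto
qed simp

lemma strongly_measurable_AE_mspace:
  assumes "strongly_measurable M m f"
  shows "AE x in M. f x \<in> mspace m"
proof -
  obtain s where "AE x in M. limitin (mtopology_of m) (\<lambda>n. s (n::nat) x) (f x) sequentially"
    using assms by (auto simp: strongly_measurable_def)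
  then show ?thesis
    by eventually_elim (auto dest: limitin_topspace)
qed

lemma limitin_mtopology_of_null:
  "limitin (mtopology_of m) f l F \<longleftrightarrow>
     l \<in> mspace m \<and> eventually (\<lambda>x. f x \<in> mspace m) F \<and> ((\<lambda>x. mdist m (f x) l) \<longlongrightarrow> 0) F"
  unfolding mtopology_of_def
  by (rule Metric_space.limitin_metric_dist_null[OF Metric_space_mspace_mdist])

lemma tendsto_mdist:
  assumes "limitin (mtopology_of m) a x sequentially" "limitin (mtopology_of m) b y sequentially"
    and mem: "\<And>n. a n \<in> mspace m" "\<And>n. b n \<in> mspace m"
  shows "(\<lambda>n. mdist m (a n) (b n)) \<longlonglongrightarrow> mdist m x y"
proof -
  have xy: "x \<in> mspace m" "y \<in> mspace m"
    and lim: "(\<lambda>n. mdist m (a n) x) \<longlonglongrightarrow> 0" "(\<lambda>n. mdist m (b n) y) \<longlonglongrightarrow> 0"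
    using assms by (auto simp: limitin_mtopology_of_null)
  have "(\<lambda>n. mdist m (a n) (b n) - mdist m x y) \<longlonglongrightarrow> 0"
  proof (rule Lim_null_comparison[OF always_eventually])
    show "(\<lambda>n. mdist m (a n) x + mdist m (b n) y) \<longlonglongrightarrow> 0"
      using tendsto_add[OF lim] by simp
    show "\<forall>n. norm (mdist m (a n) (b n) - mdist m x y) \<le> mdist m (a n) x + mdist m (b n) y"
    proof
      fix n
      have "mdist m (a n) (b n) \<le> mdist m (a n) x + mdist m x (b n)"
        "mdist m x (b n) \<le> mdist m x y + mdist m y (b n)"
        "mdist m x y \<le> mdist m x (a n) + mdist m (a n) y"
        "mdist m (a n) y \<le> mdist m (a n) (b n) + mdist m (b n) y"
        using mem xy by (auto intro!: mdist_triangle)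
      then show "norm (mdist m (a n) (b n) - mdist m x y) \<le> mdist m (a n) x + mdist m (b n) y"
        using mdist_commute[of m x "a n"] mdist_commute[of m y "b n"] by (auto simp: abs_le_iff)
    qed
  qed
  then show ?thesis
    by (simp add: LIM_zero_iff)
qed

lemma (in complete_measure) strongly_measurable_mdist:
  assumes "strongly_measurable M m f" "strongly_measurable M m g"
  shows "(\<lambda>x. mdist m (f x) (g x)) \<in> borel_measurable M"
proof -
  obtain s where s: "\<And>n::nat. simple_function M (s n)" "\<And>n. s n \<in> space M \<rightarrow> mspace m"
    "AE x in M. limitin (mtopology_of m) (\<lambda>n. s n x) (f x) sequentially"
    using assms(1) by (auto simp: strongly_measurable_def)
  obtain r where r: "\<And>n::nat. simple_function M (r n)" "\<And>n. r n \<in> space M \<rightarrow> mspace m"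
    "AE x in M. limitin (mtopology_of m) (\<lambda>n. r n x) (g x) sequentially"
    using assms(2) by (auto simp: strongly_measurable_def)
  have meas: "(\<lambda>x. lim (\<lambda>n. mdist m (s n x) (r n x))) \<in> borel_measurable M"
    by (rule borel_measurable_lim_metric, rule borel_measurable_simple_function,
        rule simple_function_compose2, rule s(1), rule r(1))
  have "AE x in M. lim (\<lambda>n. mdist m (s n x) (r n x)) = mdist m (f x) (g x)"
    using s(3) r(3) AE_space
  proof eventually_elim
    case (elim x)
    have "(\<lambda>n. mdist m (s n x) (r n x)) \<longlonglongrightarrow> mdist m (f x) (g x)"
      using elim s(2) r(2) by (intro tendsto_mdist) (auto simp: Pi_iff)
    then show ?case
      by (rule limI)
  qed
  with meas show ?thesis
    by (rule borel_measurable_AE_cong_complete)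
qed

lemma (in complete_measure) integrable_mdist_Lp_fun:
  assumes p: "p \<ge> 1" and z: "z \<in> mspace m"
    and f: "f \<in> Lp_fun M p m z" and g: "g \<in> Lp_fun M p m z"
  shows "integrable M (\<lambda>x. mdist m (f x) (g x) powr p)"
proof (rule Bochner_Integration.integrable_bound)
  show "integrable M (\<lambda>x. 2 powr p * (mdist m z (f x) powr p + mdist m z (g x) powr p))"
    using f g by (auto simp: Lp_fun_def)
  have [measurable]: "(\<lambda>x. mdist m (f x) (g x)) \<in> borel_measurable M"
    using f g by (auto simp: Lp_fun_def intro: strongly_measurable_mdist)
  show "(\<lambda>x. mdist m (f x) (g x) powr p) \<in> borel_measurable M"
    by measurable
  have "AE x in M. f x \<in> mspace m" "AE x in M. g x \<in> mspace m"
    using f g by (auto simp: Lp_fun_def intro: strongly_measurable_AE_mspace)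
  then show "AE x in M. norm (mdist m (f x) (g x) powr p)
      \<le> norm (2 powr p * (mdist m z (f x) powr p + mdist m z (g x) powr p))"
  proof eventually_elim
    case (elim x)
    define c where "c = mdist m z (f x)"
    define d where "d = mdist m z (g x)"
    have "mdist m (f x) (g x) \<le> c + d"
      using mdist_triangle[of "f x" m z "g x"] elim z mdist_commute[of m "f x" z]
      by (simp add: c_def d_def)
    also have "\<dots> \<le> 2 * max c d" by simp
    finally have "mdist m (f x) (g x) powr p \<le> (2 * max c d) powr p"
      using p by (intro powr_mono2) auto
    also have "\<dots> = 2 powr p * max c d powr p"
      by (subst powr_mult) (auto simp: c_def d_def max_def)
    also have "\<dots> \<le> 2 powr p * (c powr p + d powr p)"
      by (intro mult_left_mono) (auto simp: max_def)
    finally show ?case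
      by (simp add: c_def d_def)
  qed
qed

lemma mem_Lp_class_self: "f \<in> Lp_fun M p m z \<Longrightarrow> f \<in> Lp_class M p m z f"
  by (simp add: Lp_class_def)

lemma Lp_class_eq_iff:
  assumes "f \<in> Lp_fun M p m z" "g \<in> Lp_fun M p m z"
  shows "Lp_class M p m z f = Lp_class M p m z g \<longleftrightarrow> (AE x in M. f x = g x)"
proof
  assume "Lp_class M p m z f = Lp_class M p m z g"
  then have "f \<in> Lp_class M p m z g"
    using mem_Lp_class_self[OF assms(1)] by simp
  then show "AE x in M. f x = g x"
    by (simp add: Lp_class_def)
next
  assume ae: "AE x in M. f x = g x"
  have "(AE x in M. h x = f x) \<longleftrightarrow> (AE x in M. h x = g x)" for h
  proof
    assume "AE x in M. h x = f x"
    with ae show "AE x in M. h x = g x" by eventually_elim simp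
  next
    assume "AE x in M. h x = g x"
    with ae show "AE x in M. h x = f x" by eventually_elim simp
  qed
  then show "Lp_class M p m z f = Lp_class M p m z g"
    by (simp add: Lp_class_def)
qed

context complete_measure
begin

lemma Lp_dist_triangle:
  assumes p: "p \<ge> 1" and z: "z \<in> mspace m"
    and f: "f \<in> Lp_fun M p m z" and g: "g \<in> Lp_fun M p m z" and h: "h \<in> Lp_fun M p m z"
  shows "Lp_dist M p m f h \<le> Lp_dist M p m f g + Lp_dist M p m g h"
  unfolding Lp_dist_def
proof (rule Minkowski_aux[OF p])
  have "AE x in M. f x \<in> mspace m" "AE x in M. g x \<in> mspace m" "AE x in M. h x \<in> mspace m"
    using f g h by (auto simp: Lp_fun_def intro: strongly_measurable_AE_mspace)
  then show "AE x in M. mdist m (f x) (h x) \<le> mdist m (f x) (g x) + mdist m (g x) (h x)"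
    by eventually_elim (rule mdist_triangle)
qed (use assms in \<open>auto intro: integrable_mdist_Lp_fun\<close>)

lemma Lp_dist_eq_0_iff:
  assumes p: "p \<ge> 1" and z: "z \<in> mspace m"
    and f: "f \<in> Lp_fun M p m z" and g: "g \<in> Lp_fun M p m z"
  shows "Lp_dist M p m f g = 0 \<longleftrightarrow> (AE x in M. f x = g x)"
proof -
  have mem: "AE x in M. f x \<in> mspace m" "AE x in M. g x \<in> mspace m"
    using f g by (auto simp: Lp_fun_def intro: strongly_measurable_AE_mspace)
  have "Lp_dist M p m f g = 0 \<longleftrightarrow> (LINT x|M. mdist m (f x) (g x) powr p) = 0"
    using p by (simp add: Lp_dist_def)
  also have "\<dots> \<longleftrightarrow> (AE x in M. mdist m (f x) (g x) powr p = 0)"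
    by (rule integral_nonneg_eq_0_iff_AE) (use integrable_mdist_Lp_fun[OF assms] in auto)
  also have "\<dots> \<longleftrightarrow> (AE x in M. f x = g x)"
  proof
    assume "AE x in M. mdist m (f x) (g x) powr p = 0"
    with mem show "AE x in M. f x = g x" by eventually_elim simp
  next
    assume "AE x in M. f x = g x"
    with mem show "AE x in M. mdist m (f x) (g x) powr p = 0" by eventually_elim simp
  qed
  finally show ?thesis .
qed

lemma Lp_dist_class_rep:
  assumes p: "p \<ge> 1" and z: "z \<in> mspace m"
    and f: "f \<in> Lp_fun M p m z" and g: "g \<in> Lp_fun M p m z"
  shows "Lp_dist M p m (SOME f'. f' \<in> Lp_class M p m z f) (SOME g'. g' \<in> Lp_class M p m z g)
           = Lp_dist M p m f g"
proof -
  define f' where "f' = (SOME f'. f' \<in> Lp_class M p m z f)"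
  define g' where "g' = (SOME f'. f' \<in> Lp_class M p m z g)"
  have "f' \<in> Lp_class M p m z f" "g' \<in> Lp_class M p m z g"
    unfolding f'_def g'_def using mem_Lp_class_self[OF f] mem_Lp_class_self[OF g]
    by (metis someI)+
  then have f': "f' \<in> Lp_fun M p m z" "AE x in M. f' x = f x"
    and g': "g' \<in> Lp_fun M p m z" "AE x in M. g' x = g x"
    by (auto simp: Lp_class_def)
  have "AE x in M. mdist m (f' x) (g' x) powr p = mdist m (f x) (g x) powr p"
    using f'(2) g'(2) by eventually_elim simp
  then have "(LINT x|M. mdist m (f' x) (g' x) powr p) = (LINT x|M. mdist m (f x) (g x) powr p)"
    using integrable_mdist_Lp_fun[OF p z f'(1) g'(1)] integrable_mdist_Lp_fun[OF p z f g]
    by (intro integral_cong_AE) auto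
  then show ?thesis
    by (simp add: Lp_dist_def f'_def g'_def)
qed

lemma Metric_space_Lp:
  assumes p: "p \<ge> 1" and z: "z \<in> mspace m"
  shows "Metric_space (Lp_class M p m z ` Lp_fun M p m z)
    (\<lambda>A B. Lp_dist M p m (SOME f. f \<in> A) (SOME g. g \<in> B))"
proof
  show "0 \<le> Lp_dist M p m (SOME f. f \<in> A) (SOME g. g \<in> B)" for A B
    by (simp add: Lp_dist_def)
  show "Lp_dist M p m (SOME f. f \<in> A) (SOME g. g \<in> B)
      = Lp_dist M p m (SOME f. f \<in> B) (SOME g. g \<in> A)" for A B
    by (simp add: Lp_dist_def mdist_commute)
next
  fix A B
  assume "A \<in> Lp_class M p m z ` Lp_fun M p m z" "B \<in> Lp_class M p m z ` Lp_fun M p m z"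
  then obtain f g where "f \<in> Lp_fun M p m z" "g \<in> Lp_fun M p m z"
    "A = Lp_class M p m z f" "B = Lp_class M p m z g"
    by blast
  then show "Lp_dist M p m (SOME f. f \<in> A) (SOME g. g \<in> B) = 0 \<longleftrightarrow> A = B"
    by (simp add: Lp_dist_class_rep[OF p z] Lp_dist_eq_0_iff[OF p z] Lp_class_eq_iff)
qed (auto simp: Lp_dist_class_rep[OF p z] intro: Lp_dist_triangle[OF p z])

lemma mspace_Lp:
  assumes "p \<ge> 1" "z \<in> mspace m"
  shows "mspace (Lp M p m z) = Lp_class M p m z ` Lp_fun M p m z"
  unfolding Lp_def by (rule Metric_space.mspace_metric[OF Metric_space_Lp[OF assms]])

lemma mdist_Lp:
  assumes "p \<ge> 1" "z \<in> mspace m" "f \<in> Lp_fun M p m z" "g \<in> Lp_fun M p m z"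
  shows "mdist (Lp M p m z) (Lp_class M p m z f) (Lp_class M p m z g) = Lp_dist M p m f g"
  unfolding Lp_def
  by (simp add: Metric_space.mdist_metric[OF Metric_space_Lp[OF assms(1,2)]]
      Lp_dist_class_rep[OF assms])

end

lemma complete_measure_lebesgue_on:
  assumes "S \<in> sets lebesgue"
  shows "complete_measure (lebesgue_on S)"
proof
  fix A B :: "'a set" assume "A \<subseteq> B" "B \<in> null_sets (lebesgue_on S)"
  then have "B \<subseteq> S" "B \<in> null_sets lebesgue" "A \<subseteq> S"
    using null_sets_restrict_space[OF assms, of B] by auto
  then have "A \<in> null_sets (lebesgue_on S)"
    using completion.complete2[OF \<open>A \<subseteq> B\<close>] null_sets_restrict_space[OF assms, of A] by auto
  then show "A \<in> sets (lebesgue_on S)" by auto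
qed

definition Lp_loc :: "real \<Rightarrow> 'e metric \<Rightarrow> 'e \<Rightarrow> (real \<Rightarrow> 'e) set" where
  "Lp_loc p m z = {u. \<forall>a b. a < b \<longrightarrow> u \<in> Lp_fun (lebesgue_on {a<..<b}) p m z}"

section \<open>Almost periodic and almost automorphic functions\<close>

definition relatively_dense :: "real set \<Rightarrow> bool" where
  "relatively_dense T \<longleftrightarrow> (\<exists>l>0. \<forall>a. {a..a + l} \<inter> T \<noteq> {})"

definition almost_periodic :: "'e metric \<Rightarrow> (real \<Rightarrow> 'e) \<Rightarrow> bool" where
  "almost_periodic m u \<longleftrightarrow>
     continuous_map euclidean (mtopology_of m) u \<and>
     (\<forall>\<epsilon>>0. relatively_dense {\<tau>. \<forall>t. mdist m (u (t + \<tau>)) (u t) \<le> \<epsilon>})"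

definition almost_automorphic :: "'e metric \<Rightarrow> (real \<Rightarrow> 'e) \<Rightarrow> bool" where
  "almost_automorphic m u \<longleftrightarrow>
     continuous_map euclidean (mtopology_of m) u \<and>
     (\<forall>s :: nat \<Rightarrow> real. \<exists>r :: nat \<Rightarrow> nat. strict_mono r \<and>
        (\<exists>v. \<forall>t. limitin (mtopology_of m) (\<lambda>k. u (t + s (r k))) (v t) sequentially \<and>
                 limitin (mtopology_of m) (\<lambda>k. v (t - s (r k))) (u t) sequentially))"

section \<open>Stepanov spaces\<close>

definition bochner_transform ::
  "real \<Rightarrow> 'e metric \<Rightarrow> 'e \<Rightarrow> (real \<Rightarrow> 'e) \<Rightarrow> real \<Rightarrow> (real \<Rightarrow> 'e) set" where
  "bochner_transform p m z u t = Lp_class (lebesgue_on {0<..<1}) p m z (\<lambda>\<theta>. u (t + \<theta>))"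

definition Stepanov_aa :: "real \<Rightarrow> 'e metric \<Rightarrow> 'e \<Rightarrow> (real \<Rightarrow> 'e) set" where
  "Stepanov_aa p m z =
     {u \<in> Lp_loc p m z.
        almost_automorphic (Lp (lebesgue_on {0<..<1}) p m z) (bochner_transform p m z u)}"

definition Stepanov_ap :: "real \<Rightarrow> 'e metric \<Rightarrow> 'e \<Rightarrow> (real \<Rightarrow> 'e) set" where
  "Stepanov_ap p m z =
     {u \<in> Lp_loc p m z.
        almost_periodic (Lp (lebesgue_on {0<..<1}) p m z) (bochner_transform p m z u)}"

definition Stepanov_norm :: "real \<Rightarrow> (real \<Rightarrow> 'a::banach) \<Rightarrow> real" where
  "Stepanov_norm p u =
     (SUP t. (LINT \<theta>|lebesgue_on {0<..<1}. norm (u (t + \<theta>)) powr p) powr (1 / p))"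

text \<open>
  Continuity of a map from a set \<open>S\<close> of functions with the norm \<open>Stepanov_norm p\<close> into functions
  with \<open>Stepanov_norm q\<close>.  The supremum in \<open>Stepanov_norm\<close> is a real one, hence meaningful only
  for Stepanov bounded functions; \<open>S\<close> and its image are meant to consist of such functions.
\<close>

definition Stepanov_continuous_on ::
  "real \<Rightarrow> real \<Rightarrow> (real \<Rightarrow> 'a::banach) set \<Rightarrow> ((real \<Rightarrow> 'a) \<Rightarrow> real \<Rightarrow> 'b::banach) \<Rightarrow> bool" where
  "Stepanov_continuous_on p q S F \<longleftrightarrow>
     (\<forall>u\<in>S. \<forall>\<epsilon>>0. \<exists>\<delta>>0. \<forall>w\<in>S.
        Stepanov_norm p (\<lambda>t. w t - u t) < \<delta> \<longrightarrow> Stepanov_norm q (\<lambda>t. F w t - F u t) < \<epsilon>)"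

section \<open>Continuous functions on a compact set and superposition operators\<close>

text \<open>
  Elements of \<open>C(K,Y)\<close> are functions that are \<open>undefined\<close> outside \<open>K\<close>; the restriction of
  \<open>g\<close> to \<open>K\<close> is \<open>restrict g K\<close>.
\<close>

definition C_metric :: "'a::topological_space set \<Rightarrow> ('a \<Rightarrow> 'b::banach) metric" where
  "C_metric K = cfunspace (top_of_set K) euclidean_metric"

definition C_zero :: "'a set \<Rightarrow> 'a \<Rightarrow> 'b::banach" where
  "C_zero K = restrict (\<lambda>x. 0) K"

lemma mspace_C_metric:
  assumes "compact K"
  shows "mspace (C_metric K) = {g \<in> extensional K. continuous_on K g}"
  using assms by (auto simp: C_metric_def intro: compact_imp_bounded compact_continuous_image)

definition nemytskii :: "(real \<Rightarrow> 'a \<Rightarrow> 'b) \<Rightarrow> (real \<Rightarrow> 'a) \<Rightarrow> real \<Rightarrow> 'b" where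
  "nemytskii f u t = f t (u t)"

end

theory Submission
  imports Defs "HOL-Library.Diagonal_Subsequence"
begin

text \<open>
  Everything is expressed through the pseudometrics
  \<open>d\<^sub>u(t,t') = \<parallel>u(t + \<cdot>) - u(t' + \<cdot>)\<parallel>\<close> in \<open>L\<^sup>p(0,1)\<close>: almost periodicity and almost automorphy of
  \<open>u\<^sup>b\<close> depend only on \<open>d\<^sub>u\<close>, and both make the set of translates of \<open>u\<close> precompact in \<open>L\<^sup>p(0,1)\<close>.
  A precompact set in \<open>L\<^sup>p\<close> is tight and uniformly integrable, and a precompact set in
  \<open>L\<^sup>q(0,1;C(K,Y))\<close> is equicontinuous off small sets.  Hence for each \<open>\<epsilon>\<close> there is a compact \<open>K\<close>
  such that smallness of \<open>d\<^sub>u(t,t')\<close> and of the pseudometric of \<open>f(t,\<cdot>)|K\<close> forces the pseudometric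
  of \<open>f(t,u(t))\<close> below \<open>\<epsilon>\<close>.  Taking \<open>\<epsilon> = 1/n\<close> gives countably many \<open>K\<close>, so that a diagonal
  sequence (almost automorphic case) or common almost periods serve for all of them at once.
  For continuity at \<open>u\<close>, the same estimate is applied to the precompact set formed by the
  translates of \<open>u\<close> and a sequence of translates \<open>w\<^sub>n(t\<^sub>n + \<cdot>)\<close> of functions converging to \<open>u\<close>.
\<close>

section \<open>Pseudometrics on the real line\<close>

text \<open>The obstacle is that \<open>f(t,\<cdot>)\<close> is controlled on compact sets only,
  whereas the values of \<open>u\<close> need not lie in any single one: a compact set captures them
  merely up to a set of small measure, and it depends on how small that measure has to be. What
  happens on the exceptional set is paid for by the growth condition. Its exponent is chosen so that
  \<open>(norm x powr (p / q)) powr q = norm x powr p\<close>; hence the \<open>q\<close>-th power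
  of the image is dominated by the \<open>p\<close>-th power of \<open>u\<close> and the
  \<open>q\<close>-th power of \<open>b\<close>, whose integrals over small sets are uniformly
  small. Here \<open>b\<close> enters only through the precompactness of its translates, which is
  why an almost automorphic \<open>b\<close> also serves the almost periodic case. The limit
  function \<open>v\<close> of almost automorphy is kept out of the estimates, because its existence
  rests on completeness; that is invoked once, for the space of the images, when the pseudometric
  statement is turned back into membership in the Stepanov space.\<close>

definition pseudometric :: "('t \<Rightarrow> 't \<Rightarrow> real) \<Rightarrow> bool" where
  "pseudometric d \<longleftrightarrow> (\<forall>x. d x x = 0) \<and> (\<forall>x y. d x y = d y x) \<and>
     (\<forall>x y z. d x z \<le> d x y + d y z)"

lemma pseudometricD:
  assumes "pseudometric d"
  shows "d x x = 0" "d x y = d y x" "d x z \<le> d x y + d y z"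
  using assms by (auto simp: pseudometric_def)

text \<open>Total boundedness with the net chosen inside \<open>W\<close>, so that for
  \<open>W\<close> contained in \<open>Lp_fun\<close> the triangle inequality of
  \<open>Lp_dist\<close> is available for its members.\<close>

definition precompact_wrt :: "('t \<Rightarrow> 't \<Rightarrow> real) \<Rightarrow> 't set \<Rightarrow> bool" where
  "precompact_wrt d W \<longleftrightarrow>
     (\<forall>\<epsilon>>0. \<exists>F. finite F \<and> F \<subseteq> W \<and> (\<forall>w\<in>W. \<exists>v\<in>F. d w v < \<epsilon>))"

definition continuous_wrt :: "(real \<Rightarrow> real \<Rightarrow> real) \<Rightarrow> bool" where
  "continuous_wrt d \<longleftrightarrow> (\<forall>t. \<forall>\<epsilon>>0. \<exists>\<delta>>0. \<forall>s. \<bar>s - t\<bar> < \<delta> \<longrightarrow> d s t < \<epsilon>)"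

text \<open>
  For \<open>d t t' = \<parallel>u(t) - u(t')\<parallel>\<close> with values in a complete space, the second condition says that
  \<open>v(t - s\<^sub>k) \<rightarrow> u(t)\<close> for the limit \<open>v\<close> of the translates \<open>u(\<cdot> + s\<^sub>l)\<close>, without mentioning \<open>v\<close>.
\<close>

definition aa_sequence :: "(real \<Rightarrow> real \<Rightarrow> real) \<Rightarrow> (nat \<Rightarrow> real) \<Rightarrow> bool" where
  "aa_sequence d s \<longleftrightarrow>
     (\<forall>t. \<forall>\<epsilon>>0. \<exists>N. \<forall>k\<ge>N. \<forall>l\<ge>N. d (t + s k) (t + s l) < \<epsilon>) \<and>
     (\<forall>t. \<forall>\<epsilon>>0. \<exists>N. \<forall>k\<ge>N. \<exists>L. \<forall>l\<ge>L. d (t - s k + s l) t < \<epsilon>)"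

definition almost_automorphic_wrt :: "(real \<Rightarrow> real \<Rightarrow> real) \<Rightarrow> bool" where
  "almost_automorphic_wrt d \<longleftrightarrow> continuous_wrt d \<and>
     (\<forall>s. \<exists>r :: nat \<Rightarrow> nat. strict_mono r \<and> aa_sequence d (s \<circ> r))"

definition almost_periodic_wrt :: "(real \<Rightarrow> real \<Rightarrow> real) \<Rightarrow> bool" where
  "almost_periodic_wrt d \<longleftrightarrow> continuous_wrt d \<and>
     (\<forall>\<epsilon>>0. relatively_dense {\<tau>. \<forall>t. d (t + \<tau>) t \<le> \<epsilon>})"

section \<open>Almost automorphy of a pseudometric\<close>

lemma aa_sequence_eventually_subseq:
  fixes r :: "nat \<Rightarrow> nat"
  assumes "aa_sequence d s" and r: "filterlim r at_top sequentially"
  shows "aa_sequence d (s \<circ> r)"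
  unfolding aa_sequence_def
proof (intro conjI allI impI)
  have large: "\<exists>M. \<forall>k\<ge>M. N \<le> r k" for N
    using r by (simp add: filterlim_at_top eventually_sequentially)
  fix t \<epsilon> :: real assume "\<epsilon> > 0"
  then obtain N where "\<forall>k\<ge>N. \<forall>l\<ge>N. d (t + s k) (t + s l) < \<epsilon>"
    using assms unfolding aa_sequence_def by meson
  with large[of N] show "\<exists>N. \<forall>k\<ge>N. \<forall>l\<ge>N. d (t + (s \<circ> r) k) (t + (s \<circ> r) l) < \<epsilon>"
    unfolding o_def by meson
  obtain N where N: "\<forall>k\<ge>N. \<exists>L. \<forall>l\<ge>L. d (t - s k + s l) t < \<epsilon>"
    using assms \<open>\<epsilon> > 0\<close> unfolding aa_sequence_def by meson
  obtain M where M: "\<forall>k\<ge>M. N \<le> r k"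
    using large by blast
  have "\<exists>L. \<forall>l\<ge>L. d (t - s (r k) + s (r l)) t < \<epsilon>" if "k \<ge> M" for k
  proof -
    from N M that obtain L where "\<forall>l\<ge>L. d (t - s (r k) + s l) t < \<epsilon>"
      by blast
    with large[of L] show ?thesis by meson
  qed
  then show "\<exists>N. \<forall>k\<ge>N. \<exists>L. \<forall>l\<ge>L. d (t - (s \<circ> r) k + (s \<circ> r) l) t < \<epsilon>"
    unfolding o_def by blast
qed

lemma aa_sequence_subseq:
  fixes r :: "nat \<Rightarrow> nat"
  assumes "aa_sequence d s" "strict_mono r"
  shows "aa_sequence d (s \<circ> r)"
  using assms aa_sequence_eventually_subseq filterlim_subseq by blast

text \<open>Both conditions concern large indices only. The diagonal sequence needs this, being a
  subsequence of the \<open>n\<close>-th extracted one only from index \<open>Suc n\<close>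
  on.\<close>

lemma aa_sequence_shift:
  assumes "aa_sequence d (s \<circ> (+) m)"
  shows "aa_sequence d s"
  unfolding aa_sequence_def
proof (intro conjI allI impI)
  fix t \<epsilon> :: real assume e: "\<epsilon> > 0"
  obtain N where N: "\<forall>k\<ge>N. \<forall>l\<ge>N. d (t + s (m + k)) (t + s (m + l)) < \<epsilon>"
    using assms e unfolding aa_sequence_def o_def by meson
  have "d (t + s k) (t + s l) < \<epsilon>" if "k \<ge> N + m" "l \<ge> N + m" for k l
    using N[rule_format, of "k - m" "l - m"] that by simp
  then show "\<exists>N. \<forall>k\<ge>N. \<forall>l\<ge>N. d (t + s k) (t + s l) < \<epsilon>"
    by (intro exI[of _ "N + m"]) simp
  obtain N where N: "\<forall>k\<ge>N. \<exists>L. \<forall>l\<ge>L. d (t - s (m + k) + s (m + l)) t < \<epsilon>"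
    using assms e unfolding aa_sequence_def o_def by meson
  have "\<exists>L. \<forall>l\<ge>L. d (t - s k + s l) t < \<epsilon>" if k: "k \<ge> N + m" for k
  proof -
    obtain L where L: "\<forall>l\<ge>L. d (t - s (m + (k - m)) + s (m + l)) t < \<epsilon>"
      using N k by (metis add_le_imp_le_diff)
    have "d (t - s k + s l) t < \<epsilon>" if "l \<ge> L + m" for l
      using L[rule_format, of "l - m"] that k by simp
    then show ?thesis
      by (intro exI[of _ "L + m"]) simp
  qed
  then show "\<exists>N. \<forall>k\<ge>N. \<exists>L. \<forall>l\<ge>L. d (t - s k + s l) t < \<epsilon>"
    by (intro exI[of _ "N + m"]) simp
qed

text \<open>Cantor's diagonal argument: subsequences are extracted for one \<open>n\<close> after
  another, and the properties already gained survive because they pass to subsequences.\<close>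

lemma almost_automorphic_wrt_common_sequence:
  fixes D :: "nat \<Rightarrow> real \<Rightarrow> real \<Rightarrow> real"
  assumes "\<And>n. almost_automorphic_wrt (D n)"
  shows "\<exists>r :: nat \<Rightarrow> nat. strict_mono r \<and> (\<forall>n. aa_sequence (D n) (s \<circ> r))"
proof -
  interpret subseqs "\<lambda>n r. aa_sequence (D n) (s \<circ> r)"
  proof
    fix n :: nat and r :: "nat \<Rightarrow> nat"
    show "\<exists>r'. strict_mono r' \<and> aa_sequence (D n) (s \<circ> (r \<circ> r'))"
      using assms[of n] unfolding almost_automorphic_wrt_def o_assoc by blast
  qed
  have "aa_sequence (D n) (s \<circ> diagseq)" for n
  proof (rule aa_sequence_shift)
    show "aa_sequence (D n) ((s \<circ> diagseq) \<circ> (+) (Suc n))"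
      unfolding o_assoc[symmetric] by (rule diagseq_holds) (simp add: o_assoc aa_sequence_subseq)
  qed
  with subseq_diagseq show ?thesis by blast
qed

text \<open>In the application \<open>d\<^sub>0\<close> belongs to \<open>u\<close>,
  \<open>D n\<close> to the restriction of \<open>f\<close> to the \<open>n\<close>-th compact set,
  and \<open>d\<close> to \<open>f(t,u(t))\<close>. The index \<open>n\<close> may depend on
  \<epsilon>.\<close>

lemma continuous_wrt_modulus:
  assumes D: "\<And>n. continuous_wrt (D n)" "continuous_wrt d\<^sub>0"
    and mod: "\<And>\<epsilon>. \<epsilon> > 0 \<Longrightarrow> \<exists>n. \<exists>\<delta>>0. \<forall>t t'. d\<^sub>0 t t' < \<delta> \<longrightarrow> D n t t' < \<delta> \<longrightarrow> d t t' < \<epsilon>"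
  shows "continuous_wrt d"
  unfolding continuous_wrt_def
proof (intro allI impI)
  fix t \<epsilon> :: real assume "\<epsilon> > 0"
  then obtain n \<eta> where n: "\<eta> > 0" "\<And>t t'. d\<^sub>0 t t' < \<eta> \<Longrightarrow> D n t t' < \<eta> \<Longrightarrow> d t t' < \<epsilon>"
    using mod by meson
  obtain \<delta> where \<delta>: "\<delta> > 0" "\<forall>s. \<bar>s - t\<bar> < \<delta> \<longrightarrow> D n s t < \<eta>"
    using D(1)[of n] n(1) unfolding continuous_wrt_def by meson
  obtain \<delta>' where \<delta>': "\<delta>' > 0" "\<forall>s. \<bar>s - t\<bar> < \<delta>' \<longrightarrow> d\<^sub>0 s t < \<eta>"
    using D(2) n(1) unfolding continuous_wrt_def by meson
  show "\<exists>\<delta>>0. \<forall>s. \<bar>s - t\<bar> < \<delta> \<longrightarrow> d s t < \<epsilon>"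
    using \<delta> \<delta>' n by (intro exI[of _ "min \<delta> \<delta>'"]) auto
qed

lemma almost_automorphic_wrt_modulus:
  fixes D :: "nat \<Rightarrow> real \<Rightarrow> real \<Rightarrow> real"
  assumes D: "\<And>n. almost_automorphic_wrt (D n)" "almost_automorphic_wrt d\<^sub>0"
    and mod: "\<And>\<epsilon>. \<epsilon> > 0 \<Longrightarrow> \<exists>n. \<exists>\<delta>>0. \<forall>t t'. d\<^sub>0 t t' < \<delta> \<longrightarrow> D n t t' < \<delta> \<longrightarrow> d t t' < \<epsilon>"
  shows "almost_automorphic_wrt d"
  unfolding almost_automorphic_wrt_def
proof (intro conjI allI)
  show "continuous_wrt d"
    using D by (intro continuous_wrt_modulus[OF _ _ mod]) (auto simp: almost_automorphic_wrt_def)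
  fix s :: "nat \<Rightarrow> real"
  \<comment> \<open>Putting \<open>d\<^sub>0\<close> in front of the \<open>D n\<close> lets a
    single diagonal sequence serve all of them; it has to be fixed before \<epsilon> and hence
    before \<open>n\<close>.\<close>
  define D' where "D' n = (case n of 0 \<Rightarrow> d\<^sub>0 | Suc n \<Rightarrow> D n)" for n
  have "almost_automorphic_wrt (D' n)" for n
    using D by (auto simp: D'_def split: nat.split)
  then obtain r :: "nat \<Rightarrow> nat" where r: "strict_mono r" "\<And>n. aa_sequence (D' n) (s \<circ> r)"
    using almost_automorphic_wrt_common_sequence[of D'] by blast
  define s' where "s' = s \<circ> r"
  have s': "aa_sequence d\<^sub>0 s'" "aa_sequence (D n) s'" for n
    using r(2)[of 0] r(2)[of "Suc n"] by (auto simp: D'_def s'_def)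
  have "aa_sequence d s'"
    unfolding aa_sequence_def
  proof (intro conjI allI impI)
    fix t \<epsilon> :: real assume "\<epsilon> > 0"
    then obtain n \<eta> where n: "\<eta> > 0" "\<And>t t'. d\<^sub>0 t t' < \<eta> \<Longrightarrow> D n t t' < \<eta> \<Longrightarrow> d t t' < \<epsilon>"
      using mod by meson
    obtain N where N: "\<forall>k\<ge>N. \<forall>l\<ge>N. d\<^sub>0 (t + s' k) (t + s' l) < \<eta>"
      using s'(1) n(1) unfolding aa_sequence_def by meson
    obtain N' where N': "\<forall>k\<ge>N'. \<forall>l\<ge>N'. D n (t + s' k) (t + s' l) < \<eta>"
      using s'(2)[of n] n(1) unfolding aa_sequence_def by meson
    show "\<exists>N. \<forall>k\<ge>N. \<forall>l\<ge>N. d (t + s' k) (t + s' l) < \<epsilon>"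
      using N N' n by (intro exI[of _ "max N N'"]) auto
    obtain N where N: "\<forall>k\<ge>N. \<exists>L. \<forall>l\<ge>L. d\<^sub>0 (t - s' k + s' l) t < \<eta>"
      using s'(1) n(1) unfolding aa_sequence_def by meson
    obtain N' where N': "\<forall>k\<ge>N'. \<exists>L. \<forall>l\<ge>L. D n (t - s' k + s' l) t < \<eta>"
      using s'(2)[of n] n(1) unfolding aa_sequence_def by meson
    have "\<exists>L. \<forall>l\<ge>L. d (t - s' k + s' l) t < \<epsilon>" if "k \<ge> max N N'" for k
    proof -
      obtain L L' where "\<forall>l\<ge>L. d\<^sub>0 (t - s' k + s' l) t < \<eta>"
        "\<forall>l\<ge>L'. D n (t - s' k + s' l) t < \<eta>"
        using N N' \<open>k \<ge> max N N'\<close> by (meson max.bounded_iff)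
      then show ?thesis
        using n by (intro exI[of _ "max L L'"]) auto
    qed
    then show "\<exists>N. \<forall>k\<ge>N. \<exists>L. \<forall>l\<ge>L. d (t - s' k + s' l) t < \<epsilon>"
      by blast
  qed
  with r(1) show "\<exists>r. strict_mono r \<and> aa_sequence d (s \<circ> r)"
    unfolding s'_def by blast
qed

text \<open>Without a finite net a greedy choice produces an \<epsilon>-separated sequence, which
  contradicts the Cauchy condition at time \<open>0\<close> along the subsequence supplied by almost
  automorphy.\<close>

lemma almost_automorphic_wrt_precompact:
  assumes d: "pseudometric d" and aa: "almost_automorphic_wrt d"
  shows "precompact_wrt d UNIV"
  unfolding precompact_wrt_def
proof (intro allI impI, rule ccontr)
  fix \<epsilon> :: real assume e: "\<epsilon> > 0"
    and "\<nexists>F. finite F \<and> F \<subseteq> UNIV \<and> (\<forall>w\<in>UNIV. \<exists>v\<in>F. d w v < \<epsilon>)"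
  then have far: "\<exists>w. \<forall>v\<in>F. \<epsilon> \<le> d w v" if "finite F" for F
    using that by (auto simp: not_less)
  define pick where "pick F = (SOME w. \<forall>v\<in>F. \<epsilon> \<le> d w v)" for F
  have pick: "\<forall>v\<in>F. \<epsilon> \<le> d (pick F) v" if "finite F" for F
    unfolding pick_def by (rule someI_ex) (rule far[OF that])
  \<comment> \<open>\<open>G n\<close> holds the earlier picks, so that each new one keeps its
    distance from all of them.\<close>
  define G where "G = rec_nat {} (\<lambda>_ F. insert (pick F) F)"
  have G: "G 0 = {}" "G (Suc n) = insert (pick (G n)) (G n)" for n
    by (simp_all add: G_def)
  have fin: "finite (G n)" for n
    by (induction n) (simp_all add: G)
  define s where "s n = pick (G n)" for n
  have mem: "k < n \<Longrightarrow> s k \<in> G n" for k n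
    by (induction n) (auto simp: G s_def less_Suc_eq)
  have sep: "\<epsilon> \<le> d (s n) (s k)" if "k < n" for k n
    unfolding s_def[of n] using pick[OF fin] mem[OF that] by blast
  obtain r :: "nat \<Rightarrow> nat" where r: "strict_mono r" "aa_sequence d (s \<circ> r)"
    using aa unfolding almost_automorphic_wrt_def by blast
  then obtain N where "\<forall>k\<ge>N. \<forall>l\<ge>N. d (0 + (s \<circ> r) k) (0 + (s \<circ> r) l) < \<epsilon>"
    using e unfolding aa_sequence_def by meson
  then have "d (s (r (Suc N))) (s (r N)) < \<epsilon>"
    by simp
  moreover have "\<epsilon> \<le> d (s (r (Suc N))) (s (r N))"
    using r(1) by (intro sep) (simp add: strict_mono_def)
  ultimately show False by simp
qed

section \<open>Almost periodicity of a pseudometric: the classical arguments of Bohr and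
  Bochner\<close>

lemma almost_periodic_wrt_inclusion_length:
  assumes "almost_periodic_wrt d" "\<epsilon> > 0"
  obtains l where "l > 0" "\<And>a. {a..a + l} \<inter> {\<tau>. \<forall>t. d (t + \<tau>) t \<le> \<epsilon>} \<noteq> {}"
proof -
  have "relatively_dense {\<tau>. \<forall>t. d (t + \<tau>) t \<le> \<epsilon>}"
    using assms by (simp add: almost_periodic_wrt_def)
  then show thesis
    unfolding relatively_dense_def using that by force
qed

text \<open>An almost period moves \<open>x\<close> into the compact interval \<open>{0..l}\<close>
  and \<open>y\<close> along with it; there continuity is uniform. The two moves cost
  \<open>\<epsilon> / 4\<close> each.\<close>

lemma almost_periodic_wrt_uniformly_continuous:
  assumes d: "pseudometric d" and ap: "almost_periodic_wrt d" and e: "\<epsilon> > 0"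
  shows "\<exists>\<delta>>0. \<forall>x y. \<bar>x - y\<bar> < \<delta> \<longrightarrow> d x y < \<epsilon>"
proof -
  note d = pseudometricD[OF d]
  obtain l where l: "l > 0" "\<And>a. {a..a + l} \<inter> {\<tau>. \<forall>t. d (t + \<tau>) t \<le> \<epsilon> / 4} \<noteq> {}"
    using almost_periodic_wrt_inclusion_length[OF ap, of "\<epsilon> / 4"] e by auto
  \<comment> \<open>Open sets of small \<open>d\<close>-diameter. A Lebesgue number for them on
    \<open>{0..l}\<close> also handles a shifted \<open>y\<close> that falls slightly outside the
    interval, since they are open in the whole line.\<close>
  define \<G> where "\<G> = {B. open B \<and> (\<forall>x\<in>B. \<forall>y\<in>B. d x y < \<epsilon> / 2)}"
  have cover: "\<exists>B\<in>\<G>. x \<in> B" for x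
  proof -
    have "\<epsilon> / 4 > 0" using e by simp
    then obtain \<delta> where \<delta>: "\<delta> > 0" "\<And>s. \<bar>s - x\<bar> < \<delta> \<Longrightarrow> d s x < \<epsilon> / 4"
      using ap unfolding almost_periodic_wrt_def continuous_wrt_def by meson
    have "d y z < \<epsilon> / 2" if "y \<in> ball x \<delta>" "z \<in> ball x \<delta>" for y z
      using \<delta>(2)[of y] \<delta>(2)[of z] d(3)[of y z x] d(2)[of x z] that
      by (simp add: dist_real_def abs_minus_commute)
    then have "ball x \<delta> \<in> \<G>"
      unfolding \<G>_def by blast
    then show ?thesis
      using \<delta>(1) by (meson centre_in_ball)
  qed
  have "\<exists>\<delta>>0. \<forall>x\<in>{0..l}. \<exists>B\<in>\<G>. ball x \<delta> \<subseteq> B"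
    by (rule Heine_Borel_lemma[of "{0..l}" \<G>]) (use cover in \<open>auto simp: \<G>_def\<close>)
  then obtain \<delta> where \<delta>: "\<delta> > 0" "\<And>x. x \<in> {0..l} \<Longrightarrow> \<exists>B\<in>\<G>. ball x \<delta> \<subseteq> B"
    by blast
  have "d x y < \<epsilon>" if xy: "\<bar>x - y\<bar> < \<delta>" for x y
  proof -
    obtain \<tau> where "\<tau> \<in> {- x..- x + l}" and "\<tau> \<in> {\<tau>. \<forall>t. d (t + \<tau>) t \<le> \<epsilon> / 4}"
      using l(2)[of "- x"] by blast
    then have \<tau>: "- x \<le> \<tau>" "\<tau> \<le> - x + l" "d (t + \<tau>) t \<le> \<epsilon> / 4" for t
      by auto
    have x: "x + \<tau> \<in> {0..l}"
      using \<tau> by simp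
    have "y + \<tau> \<in> ball (x + \<tau>) \<delta>" "x + \<tau> \<in> ball (x + \<tau>) \<delta>"
      using xy \<delta>(1) by (auto simp: dist_real_def)
    then have "d (x + \<tau>) (y + \<tau>) < \<epsilon> / 2"
      using \<delta>(2)[OF x] unfolding \<G>_def by blast
    then show ?thesis
      using \<tau>(3)[of x] \<tau>(3)[of y] d(3)[of x y "x + \<tau>"] d(3)[of "x + \<tau>" y "y + \<tau>"]
        d(2)[of x "x + \<tau>"] by simp
  qed
  with \<delta>(1) show ?thesis by blast
qed

text \<open>One half of Bochner's criterion: the translates are totally bounded uniformly in
  \<open>t\<close>. An almost period \<rho> in \<open>{\<tau> - l..\<tau>}\<close> leaves a
  remainder \<open>\<tau> - \<rho>\<close> in \<open>{0..l}\<close>, and uniform continuity lets a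
  finite net of that interval replace the remainder.\<close>

lemma almost_periodic_wrt_translates:
  assumes d: "pseudometric d" and ap: "almost_periodic_wrt d" and e: "\<epsilon> > 0"
  shows "\<exists>T. finite T \<and> (\<forall>\<tau>. \<exists>\<sigma>\<in>T. \<forall>t. d (t + \<tau>) (t + \<sigma>) < \<epsilon>)"
proof -
  note d' = pseudometricD[OF d]
  have e2: "\<epsilon> / 2 > 0" using e by simp
  obtain \<delta> where \<delta>: "\<delta> > 0" "\<And>x y. \<bar>x - y\<bar> < \<delta> \<Longrightarrow> d x y < \<epsilon> / 2"
    using almost_periodic_wrt_uniformly_continuous[OF d ap e2] by blast
  obtain l where l: "l > 0" "\<And>a. {a..a + l} \<inter> {\<tau>. \<forall>t. d (t + \<tau>) t \<le> \<epsilon> / 2} \<noteq> {}"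
    using almost_periodic_wrt_inclusion_length[OF ap e2] by blast
  obtain T where T: "finite T" "{0..l} \<subseteq> (\<Union>x\<in>T. ball x \<delta>)"
    using \<delta>(1) compact_eq_totally_bounded[of "{0..l}"] by (metis compact_Icc)
  have "\<exists>\<sigma>\<in>T. \<forall>t. d (t + \<tau>) (t + \<sigma>) < \<epsilon>" for \<tau>
  proof -
    obtain \<rho> where "\<rho> \<in> {\<tau> - l..\<tau> - l + l}" and "\<rho> \<in> {\<tau>. \<forall>t. d (t + \<tau>) t \<le> \<epsilon> / 2}"
      using l(2)[of "\<tau> - l"] by blast
    then have \<rho>: "\<tau> - l \<le> \<rho>" "\<rho> \<le> \<tau>" "d (t + \<rho>) t \<le> \<epsilon> / 2" for t
      by auto
    then have "\<tau> - \<rho> \<in> {0..l}" by simp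
    then obtain \<sigma> where "\<sigma> \<in> T" "\<tau> - \<rho> \<in> ball \<sigma> \<delta>"
      using T(2) by blast
    then have \<sigma>: "\<sigma> \<in> T" "\<bar>\<sigma> - (\<tau> - \<rho>)\<bar> < \<delta>"
      by (simp_all add: dist_real_def)
    have "d (t + \<tau>) (t + \<sigma>) < \<epsilon>" for t
    proof -
      have "d (t + \<tau>) (t + (\<tau> - \<rho>)) \<le> \<epsilon> / 2"
        using \<rho>(3)[of "t + (\<tau> - \<rho>)"] by (simp add: algebra_simps)
      moreover have "d (t + (\<tau> - \<rho>)) (t + \<sigma>) < \<epsilon> / 2"
        using \<sigma>(2) by (intro \<delta>(2)) auto
      ultimately show ?thesis
        using d'(3)[of "t + \<tau>" "t + \<sigma>" "t + (\<tau> - \<rho>)"] by simp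
    qed
    with \<sigma>(1) show ?thesis by blast
  qed
  with T(1) show ?thesis by blast
qed

lemma almost_periodic_wrt_precompact:
  assumes d: "pseudometric d" and ap: "almost_periodic_wrt d"
  shows "precompact_wrt d UNIV"
  unfolding precompact_wrt_def
proof (intro allI impI)
  fix \<epsilon> :: real assume "\<epsilon> > 0"
  from almost_periodic_wrt_translates[OF d ap this]
  obtain T where T: "finite T" "\<And>\<tau>. \<exists>\<sigma>\<in>T. \<forall>t. d (t + \<tau>) (t + \<sigma>) < \<epsilon>"
    by blast
  then have "\<forall>w\<in>UNIV. \<exists>v\<in>T. d w v < \<epsilon>"
    by (metis add_0)
  with T(1) show "\<exists>F. finite F \<and> F \<subseteq> UNIV \<and> (\<forall>w\<in>UNIV. \<exists>v\<in>F. d w v < \<epsilon>)"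
    by blast
qed

text \<open>A pigeonhole argument: numbers are sorted into finitely many cells according to which
  translates approximate theirs for \<open>d\<close> and for \<open>d'\<close>. The difference of
  two members of a cell is a common almost period, and subtracting bounded representatives yields
  one in every interval of length \<open>2 * L\<close>.\<close>

lemma almost_periodic_wrt_common_periods:
  assumes d: "pseudometric d" "almost_periodic_wrt d"
    and d': "pseudometric d'" "almost_periodic_wrt d'" and e: "\<epsilon> > 0"
  shows "relatively_dense {\<tau>. \<forall>t. d (t + \<tau>) t < \<epsilon> \<and> d' (t + \<tau>) t < \<epsilon>}"
proof -
  have e2: "\<epsilon> / 2 > 0" using e by simp
  obtain T where T: "finite T" "\<And>\<tau>. \<exists>\<sigma>\<in>T. \<forall>t. d (t + \<tau>) (t + \<sigma>) < \<epsilon> / 2"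
    using almost_periodic_wrt_translates[OF d e2] by blast
  obtain T' where T': "finite T'" "\<And>\<tau>. \<exists>\<sigma>\<in>T'. \<forall>t. d' (t + \<tau>) (t + \<sigma>) < \<epsilon> / 2"
    using almost_periodic_wrt_translates[OF d' e2] by blast
  define cell where "cell c \<tau> \<longleftrightarrow> (\<forall>t. d (t + \<tau>) (t + fst c) < \<epsilon> / 2 \<and> d' (t + \<tau>) (t + snd c) < \<epsilon> / 2)"
    for c :: "real \<times> real" and \<tau>
  \<comment> \<open>For an empty cell this is an arbitrary number, whose only effect is to enlarge
    \<open>L\<close>.\<close>
  define rep where "rep c = (SOME \<tau>. cell c \<tau>)" for c
  define L where "L = 1 + (\<Sum>c\<in>T \<times> T'. \<bar>rep c\<bar>)"
  have L: "\<bar>rep c\<bar> \<le> L" if "c \<in> T \<times> T'" for c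
    using member_le_sum[of c "T \<times> T'" "\<lambda>c. \<bar>rep c\<bar>"] that T(1) T'(1) by (simp add: L_def)
  have L0: "L > 0"
    unfolding L_def by (intro add_pos_nonneg sum_nonneg) auto
  have "\<exists>\<tau>\<in>{a..a + 2 * L}. \<forall>t. d (t + \<tau>) t < \<epsilon> \<and> d' (t + \<tau>) t < \<epsilon>" for a
  proof -
    obtain \<sigma> \<sigma>' where \<sigma>: "\<sigma> \<in> T" "\<sigma>' \<in> T'" "cell (\<sigma>, \<sigma>') (a + L)"
      unfolding cell_def using T(2)[of "a + L"] T'(2)[of "a + L"] by auto
    define \<rho> where "\<rho> = rep (\<sigma>, \<sigma>')"
    have \<rho>: "cell (\<sigma>, \<sigma>') \<rho>"
      unfolding \<rho>_def rep_def using \<sigma>(3) by (rule someI)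
    have "\<bar>\<rho>\<bar> \<le> L"
      unfolding \<rho>_def using \<sigma> by (intro L) auto
    then have mem: "a + L - \<rho> \<in> {a..a + 2 * L}" by auto
    \<comment> \<open>The numbers \<open>a + L\<close> and \<rho> share a cell. Evaluating the cell
      conditions at \<open>t - \<rho>\<close> turns their difference into the shift.\<close>
    have "d (t + (a + L - \<rho>)) t < \<epsilon> \<and> d' (t + (a + L - \<rho>)) t < \<epsilon>" for t
    proof -
      have \<open>d (t - \<rho> + (a + L)) (t - \<rho> + \<sigma>) < \<epsilon> / 2\<close> "d (t - \<rho> + \<rho>) (t - \<rho> + \<sigma>) < \<epsilon> / 2"
        "d' (t - \<rho> + (a + L)) (t - \<rho> + \<sigma>') < \<epsilon> / 2" "d' (t - \<rho> + \<rho>) (t - \<rho> + \<sigma>') < \<epsilon> / 2"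
        using \<sigma>(3) \<rho> unfolding cell_def fst_conv snd_conv by blast+
      moreover have "t - \<rho> + (a + L) = t + (a + L - \<rho>)" "t - \<rho> + \<rho> = t" by auto
      ultimately show ?thesis
        using pseudometricD(2,3)[OF d(1)] pseudometricD(2,3)[OF d'(1)]
        by (smt (verit) field_sum_of_halves)
    qed
    with mem show ?thesis by blast
  qed
  then show ?thesis
    unfolding relatively_dense_def using L0 by (intro exI[of _ "2 * L"]) fastforce
qed

text \<open>For a given \<epsilon> periods common to just two pseudometrics are required,
  \<open>d\<^sub>0\<close> and one \<open>D n\<close>; the automorphic case, in contrast, wants one
  sequence for every \<open>n\<close>.\<close>

lemma almost_periodic_wrt_modulus:
  assumes D: "\<And>n. pseudometric (D n)" "\<And>n. almost_periodic_wrt (D n)"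
    and d\<^sub>0: "pseudometric d\<^sub>0" "almost_periodic_wrt d\<^sub>0"
    and mod: "\<And>\<epsilon>. \<epsilon> > 0 \<Longrightarrow> \<exists>n. \<exists>\<delta>>0. \<forall>t t'. d\<^sub>0 t t' < \<delta> \<longrightarrow> D n t t' < \<delta> \<longrightarrow> d t t' < \<epsilon>"
  shows "almost_periodic_wrt d"
  unfolding almost_periodic_wrt_def
proof (intro conjI allI impI)
  show "continuous_wrt d"
    using D(2) d\<^sub>0(2) by (intro continuous_wrt_modulus[OF _ _ mod]) (auto simp: almost_periodic_wrt_def)
  fix \<epsilon> :: real assume "\<epsilon> > 0"
  then obtain n \<eta> where n: "\<eta> > 0" "\<And>t t'. d\<^sub>0 t t' < \<eta> \<Longrightarrow> D n t t' < \<eta> \<Longrightarrow> d t t' < \<epsilon>"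
    using mod by meson
  have "{\<tau>. \<forall>t. d\<^sub>0 (t + \<tau>) t < \<eta> \<and> D n (t + \<tau>) t < \<eta>} \<subseteq> {\<tau>. \<forall>t. d (t + \<tau>) t \<le> \<epsilon>}"
    using n(2) by (auto intro: less_imp_le)
  with almost_periodic_wrt_common_periods[OF d\<^sub>0 D(1)[of n] D(2)[of n] n(1)]
  show "relatively_dense {\<tau>. \<forall>t. d (t + \<tau>) t \<le> \<epsilon>}"
    unfolding relatively_dense_def by blast
qed

section \<open>Strong measurability and convergence in measure\<close>

text \<open>The exceptional set may be larger than the set where \<open>P\<close> fails, so that
  \<open>P\<close> itself need not be measurable.\<close>

definition mostly :: "'x measure \<Rightarrow> real \<Rightarrow> ('x \<Rightarrow> bool) \<Rightarrow> bool" where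
  "mostly M \<eta> P \<longleftrightarrow> (\<exists>B\<in>sets M. measure M B \<le> \<eta> \<and> (\<forall>x\<in>space M - B. P x))"

lemma mostlyI: "B \<in> sets M \<Longrightarrow> measure M B \<le> \<eta> \<Longrightarrow> (\<And>x. x \<in> space M - B \<Longrightarrow> P x) \<Longrightarrow> mostly M \<eta> P"
  by (auto simp: mostly_def)

lemma mostly_mono:
  assumes "mostly M \<eta> P" "\<eta> \<le> \<eta>'" "\<And>x. x \<in> space M \<Longrightarrow> P x \<Longrightarrow> Q x"
  shows "mostly M \<eta>' Q"
proof -
  from assms(1) obtain B where "B \<in> sets M" "measure M B \<le> \<eta>" "\<And>x. x \<in> space M - B \<Longrightarrow> P x"
    unfolding mostly_def by blast
  with assms(2,3) show ?thesis
    by (intro mostlyI[of B]) auto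
qed

lemma mostly_AE:
  assumes "AE x in M. P x"
  shows "mostly M 0 P"
proof -
  from assms obtain N where "{x \<in> space M. \<not> P x} \<subseteq> N" "emeasure M N = 0" "N \<in> sets M"
    by (rule AE_E)
  then show ?thesis
    by (intro mostlyI[of N]) (auto simp: measure_def)
qed

lemma mostly_conj:
  assumes "mostly M \<eta> P" "mostly M \<eta>' Q"
  shows "mostly M (\<eta> + \<eta>') (\<lambda>x. P x \<and> Q x)"
proof -
  obtain B where B: "B \<in> sets M" "measure M B \<le> \<eta>" "\<forall>x\<in>space M - B. P x"
    using assms(1) unfolding mostly_def by blast
  obtain C where C: "C \<in> sets M" "measure M C \<le> \<eta>'" "\<forall>x\<in>space M - C. Q x"
    using assms(2) unfolding mostly_def by blast
  show ?thesis
    using B C measure_Un_le[of B M C] by (intro mostlyI[of "B \<union> C"]) auto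
qed

lemma mostly_conj_AE:
  assumes "mostly M \<eta> P" "AE x in M. Q x"
  shows "mostly M \<eta> (\<lambda>x. P x \<and> Q x)"
  using mostly_conj[OF assms(1) mostly_AE[OF assms(2)]] by simp

lemma simple_function_strongly_measurable:
  assumes "simple_function M s" "s \<in> space M \<rightarrow> mspace m"
  shows "strongly_measurable M m s"
  unfolding strongly_measurable_def
proof (intro exI[of _ "\<lambda>_. s"] conjI allI)
  show "AE x in M. limitin (mtopology_of m) (\<lambda>n. s x) (s x) sequentially"
    using assms(2) by (auto simp: limitin_mtopology_of_null Pi_iff)
qed (use assms in auto)

text \<open>To be used for Lebesgue measure on bounded intervals. Completeness makes
  \<open>mdist\<close> of almost everywhere limits measurable; finiteness gives Egorov's theorem and
  continuity of the measure from above.\<close>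

locale complete_finite_measure = complete_measure M + finite_measure M for M :: "'x measure"
begin

lemma mostly_countable_Ball:
  assumes "\<eta> \<ge> 0" "\<And>n :: nat. mostly M (\<eta> * (1/2) ^ Suc n) (P n)"
  shows "mostly M \<eta> (\<lambda>x. \<forall>n. P n x)"
proof -
  have "\<forall>n. \<exists>B\<in>sets M. measure M B \<le> \<eta> * (1/2) ^ Suc n \<and> (\<forall>x\<in>space M - B. P n x)"
    using assms(2) unfolding mostly_def by blast
  then obtain B where B: "\<And>n. B n \<in> sets M" "\<And>n. measure M (B n) \<le> \<eta> * (1/2) ^ Suc n"
    "\<And>n. \<forall>x\<in>space M - B n. P n x"
    by metis
  have sums: "(\<lambda>n. \<eta> * (1/2) ^ Suc n) sums \<eta>"
    using sums_mult[OF power_half_series, of \<eta>] by simp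
  have sm: "summable (\<lambda>n. measure M (B n))"
    by (rule summable_comparison_test'[OF sums_summable[OF sums], of 0]) (use B(2) in simp)
  have "measure M (\<Union>n. B n) \<le> (\<Sum>n. measure M (B n))"
    using B(1) sm by (intro finite_measure_subadditive_countably) auto
  also have "\<dots> \<le> \<eta>"
    using suminf_le[OF B(2) sm sums_summable[OF sums]] sums_unique[OF sums] by simp
  finally show ?thesis
    using B by (intro mostlyI[of "\<Union>n. B n"]) auto
qed

text \<open>Borel-Cantelli: convergence in measure at a summable rate becomes convergence almost
  everywhere.\<close>

lemma AE_eventually_mostly:
  assumes "\<And>n :: nat. mostly M ((1/2) ^ n) (P n)"
  shows "AE x in M. eventually (\<lambda>n. P n x) sequentially"
proof -
  have "\<forall>n. \<exists>B\<in>sets M. measure M B \<le> (1/2) ^ n \<and> (\<forall>x\<in>space M - B. P n x)"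
    using assms unfolding mostly_def by blast
  then obtain B where B: "\<And>n. B n \<in> sets M" "\<And>n. measure M (B n) \<le> (1/2) ^ n"
    "\<And>n. \<forall>x\<in>space M - B n. P n x"
    by metis
  have "AE x in M. eventually (\<lambda>n. x \<in> space M - B n) sequentially"
  proof (rule borel_cantelli_AE1)
    show "summable (\<lambda>n. measure M (B n))"
      by (rule summable_comparison_test'[of "\<lambda>n. (1/2) ^ n" 0]) (use B(2) in \<open>auto intro: summable_geometric\<close>)
  qed (use B in \<open>auto simp: less_top[symmetric]\<close>)
  then show ?thesis
    by eventually_elim (use B(3) in \<open>auto elim: eventually_mono\<close>)
qed

text \<open>Egorov's theorem for one tolerance \<sigma>: the sets where some term from index
  \<open>n\<close> on is off by \<sigma> decrease to a null set, so their measures tend to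
  \<open>0\<close>.\<close>

lemma Egorov_mostly:
  assumes f: "\<And>n :: nat. strongly_measurable M m (f n)" "strongly_measurable M m g"
    and lim: "AE x in M. limitin (mtopology_of m) (\<lambda>n. f n x) (g x) sequentially"
    and pos: "\<eta> > 0" "\<sigma> > 0"
  shows "\<exists>n. mostly M \<eta> (\<lambda>x. g x \<in> mspace m \<and> f n x \<in> mspace m \<and> mdist m (f n x) (g x) < \<sigma>)"
proof -
  define B where "B n = {x \<in> space M. \<exists>k\<ge>n. \<sigma> \<le> mdist m (f k x) (g x)}" for n
  have meas [measurable]: "(\<lambda>x. mdist m (f n x) (g x)) \<in> borel_measurable M" for n
    using f by (intro strongly_measurable_mdist)
  have B: "B n \<in> sets M" for n
    unfolding B_def by measurable
  have "(\<lambda>n. measure M (B n)) \<longlonglongrightarrow> measure M (\<Inter>n. B n)"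
  proof (rule finite_Lim_measure_decseq)
    show "decseq B"
      unfolding decseq_def B_def using order_trans by blast
  qed (use B in auto)
  moreover have "measure M (\<Inter>n. B n) = 0"
  proof -
    have "AE x in M. x \<notin> (\<Inter>n. B n)"
      using lim
    proof eventually_elim
      case (elim x)
      then have "(\<lambda>n. mdist m (f n x) (g x)) \<longlonglongrightarrow> 0"
        by (simp add: limitin_mtopology_of_null)
      from order_tendstoD(2)[OF this pos(2)]
      obtain N where "\<forall>n\<ge>N. mdist m (f n x) (g x) < \<sigma>"
        by (auto simp: eventually_sequentially)
      then have "x \<notin> B N"
        by (auto simp: B_def not_le)
      then show ?case by blast
    qed
    then have "(\<Inter>n. B n) \<in> null_sets M"
      using Measure_Space.AE_iff_null_sets[of "\<Inter>n. B n" M] B by blast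
    then show ?thesis
      by (rule measure_eq_0_null_sets)
  qed
  ultimately have "eventually (\<lambda>n. measure M (B n) < \<eta>) sequentially"
    using pos(1) by (intro order_tendstoD(2)[of _ 0]) auto
  then obtain n where "measure M (B n) < \<eta>"
    by (auto simp: eventually_sequentially)
  then have "mostly M \<eta> (\<lambda>x. mdist m (f n x) (g x) < \<sigma>)"
    using B by (intro mostlyI[of "B n"]) (auto simp: B_def not_le)
  then have "mostly M \<eta> (\<lambda>x. mdist m (f n x) (g x) < \<sigma> \<and> (g x \<in> mspace m \<and> f n x \<in> mspace m))"
    using strongly_measurable_AE_mspace[OF f(1)[of n]] strongly_measurable_AE_mspace[OF f(2)]
    by (intro mostly_conj_AE) (auto intro: AE_conjI)
  then show ?thesis
    by (intro exI[of _ n]) (auto elim: mostly_mono)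
qed

lemma strongly_measurable_mostly_simple:
  assumes f: "strongly_measurable M m f" and "\<eta> > 0" "\<sigma> > 0"
  obtains s where "simple_function M s" "s \<in> space M \<rightarrow> mspace m"
    "mostly M \<eta> (\<lambda>x. f x \<in> mspace m \<and> mdist m (s x) (f x) < \<sigma>)"
proof -
  obtain s where s: "\<And>n::nat. simple_function M (s n)" "\<And>n. s n \<in> space M \<rightarrow> mspace m"
    "AE x in M. limitin (mtopology_of m) (\<lambda>n. s n x) (f x) sequentially"
    using f by (auto simp: strongly_measurable_def)
  from Egorov_mostly[OF simple_function_strongly_measurable[OF s(1,2)] f s(3) assms(2,3)]
  obtain n where "mostly M \<eta> (\<lambda>x. f x \<in> mspace m \<and> s n x \<in> mspace m \<and> mdist m (s n x) (f x) < \<sigma>)"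
    by blast
  then show thesis
    by (intro that[OF s(1,2)[of n]]) (auto elim: mostly_mono)
qed

text \<open>Strong measurability is closed under convergence in measure. Simple functions with error
  and exceptional measure at most \<open>(1/2) ^ n\<close> converge almost everywhere by
  Borel-Cantelli.\<close>

lemma strongly_measurable_mostly_limit:
  assumes "\<And>\<eta> \<sigma> :: real. \<eta> > 0 \<Longrightarrow> \<sigma> > 0 \<Longrightarrow> \<exists>g. strongly_measurable M m g \<and>
      mostly M \<eta> (\<lambda>x. f x \<in> mspace m \<and> mdist m (g x) (f x) < \<sigma>)"
  shows "strongly_measurable M m f"
proof -
  have "\<exists>s. simple_function M s \<and> s \<in> space M \<rightarrow> mspace m \<and>
      mostly M ((1/2) ^ n) (\<lambda>x. f x \<in> mspace m \<and> mdist m (s x) (f x) < (1/2) ^ n)" for n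
  proof -
    \<comment> \<open>Half of the tolerance goes to the passage from \<open>f\<close> to
      \<open>g\<close>, half to that from \<open>g\<close> to a simple function.\<close>
    define c :: real where "c = (1/2) ^ Suc n"
    have c: "c > 0" "c + c = (1/2) ^ n"
      by (simp_all add: c_def)
    obtain g where g: "strongly_measurable M m g"
      "mostly M c (\<lambda>x. f x \<in> mspace m \<and> mdist m (g x) (f x) < c)"
      using assms[OF c(1) c(1)] by blast
    obtain s where s: "simple_function M s" "s \<in> space M \<rightarrow> mspace m"
      "mostly M c (\<lambda>x. g x \<in> mspace m \<and> mdist m (s x) (g x) < c)"
      using strongly_measurable_mostly_simple[OF g(1) c(1) c(1)] by blast
    have "mostly M (c + c) (\<lambda>x. f x \<in> mspace m \<and> mdist m (s x) (f x) < c + c)"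
    proof (rule mostly_mono[OF mostly_conj[OF g(2) s(3)]])
      fix x assume "x \<in> space M" and *: "(f x \<in> mspace m \<and> mdist m (g x) (f x) < c) \<and>
        g x \<in> mspace m \<and> mdist m (s x) (g x) < c"
      then have "s x \<in> mspace m"
        using s(2) by auto
      with * mdist_triangle[of "s x" m "g x" "f x"]
      show "f x \<in> mspace m \<and> mdist m (s x) (f x) < c + c"
        by auto
    qed simp
    with s(1,2) show ?thesis
      unfolding c(2) by blast
  qed
  then obtain s where s: "\<And>n. simple_function M (s n)" "\<And>n. s n \<in> space M \<rightarrow> mspace m"
    "\<And>n. mostly M ((1/2) ^ n) (\<lambda>x. f x \<in> mspace m \<and> mdist m (s n x) (f x) < (1/2) ^ n)"
    using choice[of "\<lambda>n s. simple_function M s \<and> s \<in> space M \<rightarrow> mspace m \<and>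
      mostly M ((1/2) ^ n) (\<lambda>x. f x \<in> mspace m \<and> mdist m (s x) (f x) < (1/2) ^ n)"]
    by blast
  have "AE x in M. limitin (mtopology_of m) (\<lambda>n. s n x) (f x) sequentially"
    using AE_eventually_mostly[OF s(3)] AE_space
  proof eventually_elim
    case (elim x)
    then obtain N where N: "\<And>n. n \<ge> N \<Longrightarrow> f x \<in> mspace m \<and> mdist m (s n x) (f x) < (1/2) ^ n"
      by (auto simp: eventually_sequentially)
    have "(\<lambda>n. mdist m (s n x) (f x)) \<longlonglongrightarrow> 0"
    proof (rule Lim_null_comparison)
      show "eventually (\<lambda>n. norm (mdist m (s n x) (f x)) \<le> (1/2) ^ n) sequentially"
        using N by (auto simp: eventually_sequentially intro!: exI[of _ N] less_imp_le)
    qed (auto intro: LIMSEQ_realpow_zero)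
    then show ?case
      using N[of N] s(2) elim(2) by (auto simp: limitin_mtopology_of_null Pi_iff)
  qed
  with s(1,2) show ?thesis
    unfolding strongly_measurable_def by blast
qed

section \<open>Precompact sets in Lebesgue-Bochner spaces\<close>

text \<open>Markov's inequality for the \<open>p\<close>-th power of the distance: the assumed bound
  makes its integral at most \<open>\<sigma> powr p * \<eta>\<close>.\<close>

lemma Chebyshev_Lp_dist:
  assumes p: "p \<ge> 1" and z: "z \<in> mspace m"
    and f: "f \<in> Lp_fun M p m z" and g: "g \<in> Lp_fun M p m z"
    and less: "Lp_dist M p m f g < \<sigma> * \<eta> powr (1 / p)" and pos: "\<sigma> > 0" "\<eta> > 0"
  shows "mostly M \<eta> (\<lambda>x. mdist m (f x) (g x) < \<sigma>)"
proof -
  define I where "I = (LINT x|M. mdist m (f x) (g x) powr p)"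
  have int: "integrable M (\<lambda>x. mdist m (f x) (g x) powr p)"
    by (rule integrable_mdist_Lp_fun[OF p z f g])
  have I0: "I \<ge> 0" by (simp add: I_def)
  have "I = (I powr (1 / p)) powr p"
    using p I0 by (simp add: powr_powr)
  also have "\<dots> \<le> (\<sigma> * \<eta> powr (1 / p)) powr p"
    using less p I0 by (intro powr_mono2) (auto simp: Lp_dist_def I_def)
  also have "\<dots> = \<sigma> powr p * \<eta>"
    using pos p by (simp add: powr_mult powr_powr)
  finally have I: "I \<le> \<sigma> powr p * \<eta>" .
  define B where "B = {x \<in> space M. \<sigma> powr p \<le> mdist m (f x) (g x) powr p}"
  have meas [measurable]: "(\<lambda>x. mdist m (f x) (g x)) \<in> borel_measurable M"
    using f g by (auto simp: Lp_fun_def intro: strongly_measurable_mdist)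
  have B: "B \<in> sets M"
    unfolding B_def by measurable
  have "measure M B \<le> I / \<sigma> powr p"
    unfolding B_def I_def using int pos
    by (intro integral_Markov_inequality_measure[where A = "{}"]) auto
  also have "\<dots> \<le> \<eta>"
    using I pos by (simp add: divide_le_eq mult.commute)
  finally have "measure M B \<le> \<eta>" .
  with B show ?thesis
  proof (rule mostlyI)
    fix x assume "x \<in> space M - B"
    then have "mdist m (f x) (g x) powr p < \<sigma> powr p"
      by (simp add: B_def not_le)
    then show "mdist m (f x) (g x) < \<sigma>"
      using p pos powr_less_mono2[of p "mdist m (f x) (g x)" \<sigma>]
      by (metis linorder_not_less order_less_le_trans powr_mono2 zero_less_one mdist_nonneg less_imp_le)
  qed
qed

text \<open>A finite net reduces \<open>W\<close> to finitely many functions, each close to a simple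
  function off a small set; \<open>V\<close> consists of all values of these simple
  functions.\<close>

lemma precompact_mostly_near_finite:
  assumes p: "p \<ge> 1" and z: "z \<in> mspace m" and W: "W \<subseteq> Lp_fun M p m z"
    and pc: "precompact_wrt (Lp_dist M p m) W" and pos: "\<eta> > 0" "\<sigma> > 0"
  obtains V where "finite V" "V \<subseteq> mspace m"
    "\<And>w. w \<in> W \<Longrightarrow> mostly M \<eta> (\<lambda>x. w x \<in> mspace m \<and> (\<exists>v\<in>V. mdist m v (w x) < \<sigma>))"
proof -
  \<comment> \<open>The Chebyshev threshold for tolerance \<open>\<sigma> / 2\<close> and
    exceptional measure \<open>\<eta> / 2\<close>.\<close>
  define \<rho> where "\<rho> = \<sigma> / 2 * (\<eta> / 2) powr (1 / p)"
  have "\<rho> > 0" using pos by (simp add: \<rho>_def)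
  then obtain F where F: "finite F" "F \<subseteq> W" "\<And>w. w \<in> W \<Longrightarrow> \<exists>v\<in>F. Lp_dist M p m w v < \<rho>"
    using pc unfolding precompact_wrt_def by meson
  have "\<exists>s. simple_function M s \<and> s \<in> space M \<rightarrow> mspace m \<and>
      mostly M (\<eta> / 2) (\<lambda>x. f x \<in> mspace m \<and> mdist m (s x) (f x) < \<sigma> / 2)" if "f \<in> F" for f
  proof -
    have "strongly_measurable M m f"
      using that F(2) W by (auto simp: Lp_fun_def)
    then show ?thesis
      using pos by (rule_tac strongly_measurable_mostly_simple[of m f "\<eta> / 2" "\<sigma> / 2"]) auto
  qed
  then have "\<forall>f\<in>F. \<exists>s. simple_function M s \<and> s \<in> space M \<rightarrow> mspace m \<and>
      mostly M (\<eta> / 2) (\<lambda>x. f x \<in> mspace m \<and> mdist m (s x) (f x) < \<sigma> / 2)"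
    by (rule ballI)
  from bchoice[OF this] obtain s where "\<forall>f\<in>F. simple_function M (s f) \<and>
      s f \<in> space M \<rightarrow> mspace m \<and>
      mostly M (\<eta> / 2) (\<lambda>x. f x \<in> mspace m \<and> mdist m (s f x) (f x) < \<sigma> / 2)" ..
  then have s: "simple_function M (s f)" "s f \<in> space M \<rightarrow> mspace m"
    "mostly M (\<eta> / 2) (\<lambda>x. f x \<in> mspace m \<and> mdist m (s f x) (f x) < \<sigma> / 2)" if "f \<in> F" for f
    using that by simp_all
  define V where "V = (\<Union>f\<in>F. s f ` space M)"
  show thesis
  proof (rule that)
    show "finite V"
      using F(1) s(1) by (auto simp: V_def simple_function_def)
    show "V \<subseteq> mspace m"
      using s(2) by (auto simp: V_def)
    fix w assume w: "w \<in> W"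
    then obtain f where f: "f \<in> F" "Lp_dist M p m w f < \<rho>"
      using F(3) by blast
    have wf: "w \<in> Lp_fun M p m z" "f \<in> Lp_fun M p m z"
      using w f F W by auto
    have "mostly M (\<eta> / 2) (\<lambda>x. mdist m (w x) (f x) < \<sigma> / 2 \<and> w x \<in> mspace m)"
      using f(2) pos wf strongly_measurable_AE_mspace[of M m w]
      by (intro mostly_conj_AE Chebyshev_Lp_dist[OF p z]) (auto simp: \<rho>_def Lp_fun_def)
    then have "mostly M (\<eta> / 2 + \<eta> / 2) (\<lambda>x. (mdist m (w x) (f x) < \<sigma> / 2 \<and> w x \<in> mspace m) \<and>
        (f x \<in> mspace m \<and> mdist m (s f x) (f x) < \<sigma> / 2))"
      by (rule mostly_conj) (rule s(3)[OF f(1)])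
    then show "mostly M \<eta> (\<lambda>x. w x \<in> mspace m \<and> (\<exists>v\<in>V. mdist m v (w x) < \<sigma>))"
    proof (rule mostly_mono)
      fix x assume x: "x \<in> space M" and *: "(mdist m (w x) (f x) < \<sigma> / 2 \<and> w x \<in> mspace m) \<and>
        (f x \<in> mspace m \<and> mdist m (s f x) (f x) < \<sigma> / 2)"
      have "s f x \<in> mspace m" "s f x \<in> V"
        using s(2)[OF f(1)] x f(1) by (auto simp: V_def)
      moreover have "mdist m (s f x) (w x) < \<sigma>"
        using mdist_triangle[of "s f x" m "f x" "w x"] mdist_commute[of m "f x" "w x"] * \<open>s f x \<in> mspace m\<close>
        by auto
      ultimately show "w x \<in> mspace m \<and> (\<exists>v\<in>V. mdist m v (w x) < \<sigma>)"
        using * by blast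
    qed simp
  qed
qed

text \<open>Tightness, as for measures on a complete space: at each scale \<open>1 / Suc n\<close>
  finitely many balls capture the values up to measure \<open>\<eta> * (1/2) ^ Suc n\<close>, and
  these losses add up to at most \<eta>.\<close>

lemma precompact_mostly_in_compact:
  fixes W :: "('x \<Rightarrow> 'a::banach) set"
  assumes p: "p \<ge> 1" and W: "W \<subseteq> Lp_fun M p euclidean_metric 0"
    and pc: "precompact_wrt (Lp_dist M p euclidean_metric) W" and \<eta>: "\<eta> > 0"
  obtains K where "compact K" "K \<noteq> {}" "\<And>w. w \<in> W \<Longrightarrow> mostly M \<eta> (\<lambda>x. w x \<in> K)"
proof -
  have "\<exists>V. finite V \<and> (\<forall>w\<in>W. mostly M (\<eta> * (1/2) ^ Suc n) (\<lambda>x. \<exists>v\<in>V. dist v (w x) < 1 / Suc n))" for n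
  proof -
    obtain V where "finite V" "\<And>w. w \<in> W \<Longrightarrow> mostly M (\<eta> * (1/2) ^ Suc n)
        (\<lambda>x. w x \<in> mspace euclidean_metric \<and> (\<exists>v\<in>V. mdist euclidean_metric v (w x) < 1 / Suc n))"
      using precompact_mostly_near_finite[OF p _ W pc, of "\<eta> * (1/2) ^ Suc n" "1 / Suc n"] \<eta>
      by auto
    then show ?thesis by (intro exI[of _ V]) auto
  qed
  then obtain V where V: "\<And>n. finite (V n)"
    "\<And>n w. w \<in> W \<Longrightarrow> mostly M (\<eta> * (1/2) ^ Suc n) (\<lambda>x. \<exists>v\<in>V n. dist v (w x) < 1 / Suc n)"
    using choice[of "\<lambda>n V. finite V \<and>
      (\<forall>w\<in>W. mostly M (\<eta> * (1/2) ^ Suc n) (\<lambda>x. \<exists>v\<in>V. dist v (w x) < 1 / Suc n))"]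
    by blast
  \<comment> \<open>Closed balls make \<open>K\<close> closed, hence complete; finitely many of them
    at each scale make it totally bounded.\<close>
  define K where "K = (\<Inter>n. \<Union>v\<in>V n. cball v (1 / Suc n))"
  have "compact K"
    unfolding compact_eq_totally_bounded
  proof (intro conjI allI impI)
    show "complete K"
      unfolding complete_eq_closed K_def using V(1) by (auto intro!: closed_INT closed_UN)
    fix e :: real assume "e > 0"
    then obtain n where n: "1 / Suc n < e"
      by (metis nat_approx_posE)
    have "K \<subseteq> (\<Union>v\<in>V n. cball v (1 / Suc n))"
      unfolding K_def by blast
    also have "\<dots> \<subseteq> (\<Union>v\<in>V n. ball v e)"
      using n by (intro UN_mono) auto
    finally have "K \<subseteq> (\<Union>v\<in>V n. ball v e)" .
    with V(1) show "\<exists>k. finite k \<and> K \<subseteq> (\<Union>x\<in>k. ball x e)"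
      by blast
  qed
  moreover have "mostly M \<eta> (\<lambda>x. w x \<in> K)" if "w \<in> W" for w
  proof -
    have "mostly M \<eta> (\<lambda>x. \<forall>n. \<exists>v\<in>V n. dist v (w x) < 1 / Suc n)"
      using \<eta> V(2)[OF that] by (intro mostly_countable_Ball) auto
    then show ?thesis
      by (rule mostly_mono) (auto simp: K_def intro: less_imp_le)
  qed
  \<comment> \<open>Adjoining \<open>0\<close> guarantees that the compact set is nonempty.\<close>
  ultimately show thesis
    by (intro that[of "insert 0 K"]) (auto intro: mostly_mono)
qed

end

section \<open>Equicontinuity on a compact set and uniform integrability\<close>

lemma C_zero_in_mspace: "compact K \<Longrightarrow> C_zero K \<in> mspace (C_metric K)"
  by (auto simp: mspace_C_metric C_zero_def)

lemma dist_le_mdist_C_metric: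
  assumes "compact K" "g \<in> mspace (C_metric K)" "h \<in> mspace (C_metric K)" "x \<in> K"
  shows "dist (g x) (h x) \<le> mdist (C_metric K) g h"
  using mdist_cfunspace_imp_mdist_le[of g "top_of_set K" euclidean_metric h "mdist (C_metric K) g h" x] assms
  by (simp add: C_metric_def)

lemma finite_equicontinuous:
  fixes V :: "('a::metric_space \<Rightarrow> 'b::metric_space) set"
  assumes "finite V" "\<And>v. v \<in> V \<Longrightarrow> uniformly_continuous_on K v" "\<sigma> > 0"
  shows "\<exists>\<delta>>0. \<forall>v\<in>V. \<forall>x\<in>K. \<forall>y\<in>K. dist x y < \<delta> \<longrightarrow> dist (v x) (v y) < \<sigma>"
  using assms(1,2)
proof (induction V)
  case empty
  show ?case by (intro exI[of _ 1]) simp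
next
  case (insert w V)
  then obtain \<delta> where \<delta>: "\<delta> > 0" "\<forall>v\<in>V. \<forall>x\<in>K. \<forall>y\<in>K. dist x y < \<delta> \<longrightarrow> dist (v x) (v y) < \<sigma>"
    by auto
  have "uniformly_continuous_on K w"
    using insert.prems by simp
  then obtain \<delta>' where \<delta>': "\<delta>' > 0" "\<forall>x\<in>K. \<forall>y\<in>K. dist x y < \<delta>' \<longrightarrow> dist (w x) (w y) < \<sigma>"
    unfolding uniformly_continuous_on_def using \<open>\<sigma> > 0\<close> by (metis dist_commute)
  show ?case
    using \<delta> \<delta>' by (intro exI[of _ "min \<delta> \<delta>'"]) auto
qed

text \<open>Four summands, because the difference of two superpositions is bounded by two growth
  terms of two summands each. Shorter sums are padded with zeros.\<close>

lemma powr_sum4_le: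
  fixes a b c d q :: real
  assumes "q \<ge> 0" "a \<ge> 0" "b \<ge> 0" "c \<ge> 0" "d \<ge> 0"
  shows "(a + b + c + d) powr q \<le> 4 powr q * (a powr q + b powr q + c powr q + d powr q)"
proof -
  define M where "M = max (max a b) (max c d)"
  have "(a + b + c + d) powr q \<le> (4 * M) powr q"
    using assms by (intro powr_mono2) (auto simp: M_def)
  also have "\<dots> = 4 powr q * M powr q"
    by (rule powr_mult)
  also have "\<dots> \<le> 4 powr q * (a powr q + b powr q + c powr q + d powr q)"
    by (intro mult_left_mono) (auto simp: M_def max_def)
  finally show ?thesis .
qed

text \<open>Absolute continuity of the integral by truncation: \<open>f\<close> is at most
  \<open>max 0 (f - n) + n\<close>, where the excess over \<open>n\<close> has small integral for
  large \<open>n\<close> and the constant contributes at most \<open>n * \<eta>\<close> on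
  \<open>B\<close>.\<close>

lemma integrable_uniformly_small:
  fixes f :: "'x \<Rightarrow> real"
  assumes f: "integrable M f" and nn: "\<And>x. 0 \<le> f x" and e: "\<epsilon> > 0"
    and fin: "finite_measure M"
  shows "\<exists>\<eta>>0. \<forall>B\<in>sets M. measure M B \<le> \<eta> \<longrightarrow> (LINT x|M. indicator B x * f x) \<le> \<epsilon>"
proof -
  interpret finite_measure M by (rule fin)
  have [measurable]: "f \<in> borel_measurable M"
    using f by simp
  have "(\<lambda>n. LINT x|M. max 0 (f x - real n)) \<longlonglongrightarrow> (LINT x|M. 0)"
  proof (rule integral_dominated_convergence[where w = f])
    show "AE x in M. (\<lambda>n. max 0 (f x - real n)) \<longlonglongrightarrow> 0"
    proof (rule AE_I2)
      fix x
      obtain N where "f x \<le> real N"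
        using real_arch_simple by blast
      then have "eventually (\<lambda>n. max 0 (f x - real n) = 0) sequentially"
        by (auto simp: eventually_sequentially intro!: exI[of _ N])
      then show "(\<lambda>n. max 0 (f x - real n)) \<longlonglongrightarrow> 0"
        by (rule tendsto_eventually)
    qed
  qed (use f nn in auto)
  then have "eventually (\<lambda>n. (LINT x|M. max 0 (f x - real n)) < \<epsilon> / 2) sequentially"
    using e by (intro order_tendstoD(2)[of _ 0]) auto
  then obtain n where n: "(LINT x|M. max 0 (f x - real n)) < \<epsilon> / 2"
    by (auto simp: eventually_sequentially)
  have int: "integrable M (\<lambda>x. max 0 (f x - real n))"
    by (rule Bochner_Integration.integrable_bound[OF f]) (use nn in auto)
  \<comment> \<open>Adding \<open>1\<close> keeps the denominator positive for
    \<open>n = 0\<close>.\<close>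
  define \<eta> where "\<eta> = \<epsilon> / (2 * (real n + 1))"
  have "(LINT x|M. indicator B x * f x) \<le> \<epsilon>" if B: "B \<in> sets M" "measure M B \<le> \<eta>" for B
  proof -
    have intB: "integrable M (indicator B :: 'x \<Rightarrow> real)"
      using B(1) by (intro integrable_real_indicator) (auto simp: less_top[symmetric])
    have "(LINT x|M. indicator B x * f x) \<le> (LINT x|M. max 0 (f x - real n) + real n * indicator B x)"
    proof (rule integral_mono')
      show "integrable M (\<lambda>x. max 0 (f x - real n) + real n * indicator B x)"
        using int intB by simp
    qed (use nn in \<open>auto simp: indicator_def\<close>)
    also have "\<dots> = (LINT x|M. max 0 (f x - real n)) + real n * measure M B"
      using B(1) int intB by (subst Bochner_Integration.integral_add) simp_all
    also have "\<dots> \<le> \<epsilon> / 2 + real n * \<eta>"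
      using n B(2) by (intro add_mono mult_left_mono) auto
    also have "\<dots> \<le> \<epsilon> / 2 + (real n + 1) * \<eta>"
      using e by (auto simp: \<eta>_def intro!: divide_right_mono mult_right_mono)
    also have "\<dots> = \<epsilon>"
      using e by (simp add: \<eta>_def field_simps)
    finally show ?thesis .
  qed
  moreover have "\<eta> > 0"
    using e by (simp add: \<eta>_def)
  ultimately show ?thesis by blast
qed

context complete_finite_measure
begin

text \<open>Off a small set each \<open>w \<theta>\<close> is within \<open>\<sigma> / 3\<close> of
  one of finitely many continuous functions, and these share a modulus of continuity on
  \<open>K\<close>.\<close>

lemma precompact_mostly_equicontinuous:
  fixes W :: "('x \<Rightarrow> 'a::banach \<Rightarrow> 'b::banach) set"
  assumes p: "p \<ge> 1" and K: "compact K" and W: "W \<subseteq> Lp_fun M p (C_metric K) (C_zero K)"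
    and pc: "precompact_wrt (Lp_dist M p (C_metric K)) W" and pos: "\<eta> > 0" "\<sigma> > 0"
  obtains \<delta> where "\<delta> > 0" "\<And>w. w \<in> W \<Longrightarrow>
    mostly M \<eta> (\<lambda>\<theta>. \<forall>x\<in>K. \<forall>y\<in>K. dist x y < \<delta> \<longrightarrow> dist (w \<theta> x) (w \<theta> y) < \<sigma>)"
proof -
  have s3: "\<sigma> / 3 > 0" using pos by simp
  obtain V where V: "finite V" "V \<subseteq> mspace (C_metric K)"
    "\<And>w. w \<in> W \<Longrightarrow> mostly M \<eta> (\<lambda>x. w x \<in> mspace (C_metric K) \<and>
        (\<exists>v\<in>V. mdist (C_metric K) v (w x) < \<sigma> / 3))"
    using precompact_mostly_near_finite[OF p C_zero_in_mspace[OF K] W pc pos(1) s3] by blast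
  have "\<exists>\<delta>>0. \<forall>v\<in>V. \<forall>x\<in>K. \<forall>y\<in>K. dist x y < \<delta> \<longrightarrow> dist (v x) (v y) < \<sigma> / 3"
    using V(2) K s3
    by (intro finite_equicontinuous[OF V(1)] compact_uniformly_continuous) (auto simp: mspace_C_metric)
  then obtain \<delta> where \<delta>: "\<delta> > 0"
    "\<And>v x y. v \<in> V \<Longrightarrow> x \<in> K \<Longrightarrow> y \<in> K \<Longrightarrow> dist x y < \<delta> \<Longrightarrow> dist (v x) (v y) < \<sigma> / 3"
    by blast
  show thesis
  proof (rule that[OF \<delta>(1)])
    fix w assume "w \<in> W"
    from V(3)[OF this]
    show "mostly M \<eta> (\<lambda>\<theta>. \<forall>x\<in>K. \<forall>y\<in>K. dist x y < \<delta> \<longrightarrow> dist (w \<theta> x) (w \<theta> y) < \<sigma>)"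
    proof (rule mostly_mono)
      fix \<theta> assume "w \<theta> \<in> mspace (C_metric K) \<and> (\<exists>v\<in>V. mdist (C_metric K) v (w \<theta>) < \<sigma> / 3)"
      then obtain v where v: "v \<in> V" "mdist (C_metric K) v (w \<theta>) < \<sigma> / 3" "w \<theta> \<in> mspace (C_metric K)"
        by blast
      have near: "dist (v x) (w \<theta> x) < \<sigma> / 3" if "x \<in> K" for x
        using dist_le_mdist_C_metric[OF K _ v(3) that, of v] V(2) v(1,2) by auto
      show "\<forall>x\<in>K. \<forall>y\<in>K. dist x y < \<delta> \<longrightarrow> dist (w \<theta> x) (w \<theta> y) < \<sigma>"
      proof (intro ballI impI)
        fix x y assume xy: "x \<in> K" "y \<in> K" "dist x y < \<delta>"
        show "dist (w \<theta> x) (w \<theta> y) < \<sigma>"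
          using near[OF xy(1)] near[OF xy(2)] \<delta>(2)[OF v(1) xy]
            dist_triangle[of "w \<theta> x" "w \<theta> y" "v x"] dist_triangle[of "v x" "w \<theta> y" "v y"]
            dist_commute[of "v x" "w \<theta> x"]
          by linarith
      qed
    qed simp
  qed
qed

text \<open>Absolute continuity handles the members of a finite net; any other \<open>w\<close>
  differs from one of them by a function whose \<open>p\<close>-th power has small integral over the
  whole space.\<close>

lemma precompact_uniformly_integrable:
  assumes p: "p \<ge> 1" and z: "z \<in> mspace m" and W: "W \<subseteq> Lp_fun M p m z"
    and pc: "precompact_wrt (Lp_dist M p m) W" and e: "\<epsilon> > 0"
  obtains \<eta> where "\<eta> > 0" "\<And>w B. w \<in> W \<Longrightarrow> B \<in> sets M \<Longrightarrow> measure M B \<le> \<eta> \<Longrightarrow>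
    (LINT x|M. indicator B x * mdist m z (w x) powr p) \<le> \<epsilon>"
proof -
  \<comment> \<open>The factor \<open>4 powr p\<close> is the one of \<open>powr_sum4_le\<close>;
    the \<open>2\<close> counts the net member and the distance to it.\<close>
  define \<epsilon>' where "\<epsilon>' = \<epsilon> / (2 * 4 powr p)"
  have e': "\<epsilon>' > 0" "4 powr p * (\<epsilon>' + \<epsilon>') = \<epsilon>"
    using e by (simp_all add: \<epsilon>'_def field_simps)
  define \<rho> where "\<rho> = \<epsilon>' powr (1 / p)"
  have "\<rho> > 0" using e' by (simp add: \<rho>_def)
  then obtain F where F: "finite F" "F \<subseteq> W" "\<And>w. w \<in> W \<Longrightarrow> \<exists>v\<in>F. Lp_dist M p m w v < \<rho>"
    using pc unfolding precompact_wrt_def by meson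
  have int: "integrable M (\<lambda>x. mdist m z (f x) powr p)" if "f \<in> W" for f
    using that W by (auto simp: Lp_fun_def)
  have "\<exists>\<eta>>0. \<forall>f\<in>F. \<forall>B\<in>sets M. measure M B \<le> \<eta> \<longrightarrow>
      (LINT x|M. indicator B x * mdist m z (f x) powr p) \<le> \<epsilon>'"
    using F(1,2)
  proof (induction F)
    case empty
    show ?case by (intro exI[of _ 1]) simp
  next
    case (insert g F)
    then obtain \<eta> where \<eta>: "\<eta> > 0" "\<forall>f\<in>F. \<forall>B\<in>sets M. measure M B \<le> \<eta> \<longrightarrow>
        (LINT x|M. indicator B x * mdist m z (f x) powr p) \<le> \<epsilon>'"
      by auto
    have "g \<in> W" using insert.prems by simp
    from integrable_uniformly_small[OF int[OF this] _ e'(1) finite_measure_axioms]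
    obtain \<eta>' where \<eta>': "\<eta>' > 0" "\<forall>B\<in>sets M. measure M B \<le> \<eta>' \<longrightarrow>
        (LINT x|M. indicator B x * mdist m z (g x) powr p) \<le> \<epsilon>'"
      by auto
    show ?case
      using \<eta> \<eta>' by (intro exI[of _ "min \<eta> \<eta>'"]) auto
  qed
  then obtain \<eta> where \<eta>: "\<eta> > 0" "\<And>f B. f \<in> F \<Longrightarrow> B \<in> sets M \<Longrightarrow> measure M B \<le> \<eta> \<Longrightarrow>
      (LINT x|M. indicator B x * mdist m z (f x) powr p) \<le> \<epsilon>'"
    by blast
  show thesis
  proof (rule that[OF \<eta>(1)])
    fix w B assume w: "w \<in> W" and B: "B \<in> sets M" "measure M B \<le> \<eta>"
    obtain f where f: "f \<in> F" "Lp_dist M p m w f < \<rho>"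
      using F(3)[OF w] by blast
    have mem: "w \<in> Lp_fun M p m z" "f \<in> Lp_fun M p m z" "f \<in> W"
      using w f F W by auto
    define I where "I = (LINT x|M. mdist m (w x) (f x) powr p)"
    have intI: "integrable M (\<lambda>x. mdist m (w x) (f x) powr p)"
      by (rule integrable_mdist_Lp_fun[OF p z mem(1,2)])
    have I0: "I \<ge> 0" by (simp add: I_def)
    have "I = (I powr (1 / p)) powr p"
      using p I0 by (simp add: powr_powr)
    also have "\<dots> \<le> \<rho> powr p"
      using f(2) p I0 by (intro powr_mono2) (auto simp: Lp_dist_def I_def)
    also have "\<dots> = \<epsilon>'"
      using p e' by (simp add: \<rho>_def powr_powr)
    finally have I: "I \<le> \<epsilon>'" .
    have intB: "integrable M (\<lambda>x. indicator B x * mdist m z (f x) powr p)"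
      using integrable_mult_indicator[OF B(1) int[OF mem(3)]] by simp
    have "(LINT x|M. indicator B x * mdist m z (w x) powr p) \<le>
        (LINT x|M. 4 powr p * (indicator B x * mdist m z (f x) powr p + mdist m (w x) (f x) powr p))"
    proof (rule integral_mono_AE')
      have "AE x in M. w x \<in> mspace m" "AE x in M. f x \<in> mspace m"
        using mem by (auto simp: Lp_fun_def intro: strongly_measurable_AE_mspace)
      then show "AE x in M. indicator B x * mdist m z (w x) powr p \<le>
          4 powr p * (indicator B x * mdist m z (f x) powr p + mdist m (w x) (f x) powr p)"
      proof eventually_elim
        case (elim x)
        have "mdist m z (w x) \<le> mdist m z (f x) + mdist m (w x) (f x)"
          using mdist_triangle[OF z elim(2) elim(1)] mdist_commute[of m "f x" "w x"] by simp
        then have "mdist m z (w x) powr p \<le> (mdist m z (f x) + mdist m (w x) (f x) + 0 + 0) powr p"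
          using p by (intro powr_mono2) auto
        also have "\<dots> \<le> 4 powr p * (mdist m z (f x) powr p + mdist m (w x) (f x) powr p + 0 powr p + 0 powr p)"
          using p by (intro powr_sum4_le) auto
        finally show ?case
          by (auto simp: indicator_def)
      qed
      show "integrable M (\<lambda>x. 4 powr p * (indicator B x * mdist m z (f x) powr p + mdist m (w x) (f x) powr p))"
        using intB intI by simp
    qed simp
    also have "\<dots> = 4 powr p * ((LINT x|M. indicator B x * mdist m z (f x) powr p) + I)"
      using intB intI by (simp add: I_def)
    also have "\<dots> \<le> 4 powr p * (\<epsilon>' + \<epsilon>')"
      using \<eta>(2)[OF f(1) B] I by (intro mult_left_mono add_mono) auto
    finally show "(LINT x|M. indicator B x * mdist m z (w x) powr p) \<le> \<epsilon>"
      using e'(2) by simp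
  qed
qed

section \<open>Superposition operators on Lebesgue-Bochner spaces\<close>

text \<open>All that is known of the measurability of \<open>g\<close> is contained in the maps into
  \<open>C(K,Y)\<close>. Off a small set \<phi> stays in a compact \<open>K\<close>; there
  \<open>x \<mapsto> g x\<close> is replaced by a simple function \<open>S\<close> with values in
  \<open>C(K,Y)\<close> and \<phi> by a simple function \<open>s\<close>, and \<open>S x\<close> is
  evaluated near \<open>s x\<close>.\<close>

lemma strongly_measurable_superposition:
  fixes g :: "'x \<Rightarrow> 'a::banach \<Rightarrow> 'b::banach"
  assumes g: "\<And>K. compact K \<Longrightarrow> strongly_measurable M (C_metric K) (\<lambda>x. restrict (g x) K)"
    and p: "p \<ge> 1" and \<phi>: "\<phi> \<in> Lp_fun M p euclidean_metric 0"
  shows "strongly_measurable M euclidean_metric (\<lambda>x. g x (\<phi> x))"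
proof (rule strongly_measurable_mostly_limit)
  fix \<eta> \<sigma> :: real assume pos: "\<eta> > 0" "\<sigma> > 0"
  have pos': "\<eta> / 3 > 0" "\<sigma> / 2 > 0" using pos by auto
  have "Lp_dist M p euclidean_metric \<phi> \<phi> = 0"
    using p by (simp add: Lp_dist_def)
  then have "precompact_wrt (Lp_dist M p euclidean_metric) {\<phi>}"
    unfolding precompact_wrt_def by (intro allI impI exI[of _ "{\<phi>}"]) simp
  from precompact_mostly_in_compact[OF p _ this pos'(1)] \<phi>
  obtain K where K: "compact K" "K \<noteq> {}" "mostly M (\<eta> / 3) (\<lambda>x. \<phi> x \<in> K)"
    by auto
  obtain S where S: "simple_function M S" "S \<in> space M \<rightarrow> mspace (C_metric K)"
    "mostly M (\<eta> / 3) (\<lambda>x. restrict (g x) K \<in> mspace (C_metric K) \<and>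
        mdist (C_metric K) (S x) (restrict (g x) K) < \<sigma> / 2)"
    using strongly_measurable_mostly_simple[OF g[OF K(1)] pos'] by blast
  have "\<exists>\<delta>>0. \<forall>v\<in>S ` space M. \<forall>x\<in>K. \<forall>y\<in>K. dist x y < \<delta> \<longrightarrow> dist (v x) (v y) < \<sigma> / 2"
  proof (rule finite_equicontinuous)
    show "finite (S ` space M)"
      using S(1) by (simp add: simple_function_def)
    show "uniformly_continuous_on K v" if "v \<in> S ` space M" for v
      using that S(2) K(1) by (intro compact_uniformly_continuous) (auto simp: mspace_C_metric)
  qed (use pos in auto)
  then obtain \<delta> where \<delta>: "\<delta> > 0"
    "\<And>t x y. t \<in> space M \<Longrightarrow> x \<in> K \<Longrightarrow> y \<in> K \<Longrightarrow> dist x y < \<delta> \<Longrightarrow> dist (S t x) (S t y) < \<sigma> / 2"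
    by blast
  have d2: "\<delta> / 2 > 0" using \<delta> by simp
  have "strongly_measurable M euclidean_metric \<phi>"
    using \<phi> by (simp add: Lp_fun_def)
  from strongly_measurable_mostly_simple[OF this pos'(1) d2]
  obtain s where s: "simple_function M s" "mostly M (\<eta> / 3) (\<lambda>x. dist (s x) (\<phi> x) < \<delta> / 2)"
    by auto
  \<comment> \<open>The point \<open>s x\<close> may lie outside \<open>K\<close>, where
    \<open>S x\<close> carries no information on \<open>g x\<close>; \<pi> moves it to a nearby
    point of \<open>K\<close>. The default branch is met on the exceptional set only.\<close>
  define \<pi> where "\<pi> y = (if \<exists>k\<in>K. dist k y < \<delta> / 2 then SOME k. k \<in> K \<and> dist k y < \<delta> / 2
      else SOME k. k \<in> K)" for y
  have \<pi>: "\<pi> y \<in> K \<and> dist (\<pi> y) y < \<delta> / 2" if "k \<in> K" "dist k y < \<delta> / 2" for k y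
  proof -
    have "\<exists>k. k \<in> K \<and> dist k y < \<delta> / 2" using that by blast
    from someI_ex[OF this] show ?thesis
      using that unfolding \<pi>_def by auto
  qed
  \<comment> \<open>A function of the two simple functions \<open>S\<close> and \<open>s\<close>,
    hence simple whatever \<pi> looks like.\<close>
  define h where "h x = S x (\<pi> (s x))" for x
  have "simple_function M h"
    unfolding h_def by (rule simple_function_compose2[OF S(1) s(1), where h = "\<lambda>v y. v (\<pi> y)"])
  then have "strongly_measurable M euclidean_metric h"
    by (intro simple_function_strongly_measurable) auto
  moreover have "mostly M (\<eta> / 3 + \<eta> / 3 + \<eta> / 3) (\<lambda>x. g x (\<phi> x) \<in> mspace euclidean_metric \<and>
      mdist euclidean_metric (h x) (g x (\<phi> x)) < \<sigma>)"
  proof (rule mostly_mono[OF mostly_conj[OF mostly_conj[OF K(3) S(3)] s(2)]])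
    fix x assume x: "x \<in> space M" and *: "(\<phi> x \<in> K \<and> restrict (g x) K \<in> mspace (C_metric K) \<and>
        mdist (C_metric K) (S x) (restrict (g x) K) < \<sigma> / 2) \<and> dist (s x) (\<phi> x) < \<delta> / 2"
    have \<pi>x: "\<pi> (s x) \<in> K" "dist (\<pi> (s x)) (s x) < \<delta> / 2"
      using \<pi>[of "\<phi> x" "s x"] * by (auto simp: dist_commute)
    have "dist (\<pi> (s x)) (\<phi> x) < \<delta>"
      using \<pi>x(2) * dist_triangle[of "\<pi> (s x)" "\<phi> x" "s x"] by simp
    then have "dist (h x) (S x (\<phi> x)) < \<sigma> / 2"
      unfolding h_def using * by (intro \<delta>(2)[OF x \<pi>x(1)]) auto
    moreover have "S x \<in> mspace (C_metric K)"
      using S(2) x by blast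
    then have "dist (S x (\<phi> x)) (g x (\<phi> x)) < \<sigma> / 2"
      using dist_le_mdist_C_metric[OF K(1), of "S x" "restrict (g x) K" "\<phi> x"] * by auto
    ultimately show "g x (\<phi> x) \<in> mspace euclidean_metric \<and>
        mdist euclidean_metric (h x) (g x (\<phi> x)) < \<sigma>"
      using dist_triangle[of "h x" "g x (\<phi> x)" "S x (\<phi> x)"] by simp
  qed simp
  ultimately show "\<exists>h. strongly_measurable M euclidean_metric h \<and>
      mostly M \<eta> (\<lambda>x. g x (\<phi> x) \<in> mspace euclidean_metric \<and>
        mdist euclidean_metric (h x) (g x (\<phi> x)) < \<sigma>)"
    by (intro exI[of _ h]) simp
qed

lemma superposition_Lp_fun:
  fixes g :: "'x \<Rightarrow> 'a::banach \<Rightarrow> 'b::banach"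
  assumes g: "\<And>K. compact K \<Longrightarrow> strongly_measurable M (C_metric K) (\<lambda>x. restrict (g x) K)"
    and pq: "p \<ge> 1" "q \<ge> 1" "a \<ge> 0"
    and \<phi>: "\<phi> \<in> Lp_fun M p euclidean_metric 0" and \<beta>: "\<beta> \<in> Lp_fun M q euclidean_metric (0::real)"
    and growth: "AE x in M. \<forall>y. norm (g x y) \<le> a * norm y powr (p / q) + \<beta> x"
  shows "(\<lambda>x. g x (\<phi> x)) \<in> Lp_fun M q euclidean_metric 0"
proof -
  have sm: "strongly_measurable M euclidean_metric (\<lambda>x. g x (\<phi> x))"
    by (rule strongly_measurable_superposition[OF g pq(1) \<phi>])
  have [measurable]: "(\<lambda>x. norm (g x (\<phi> x))) \<in> borel_measurable M"
    using strongly_measurable_mdist[OF sm simple_function_strongly_measurable[OF simple_function_const[of _ 0]]]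
    by simp
  have "integrable M (\<lambda>x. norm (g x (\<phi> x)) powr q)"
  proof (rule Bochner_Integration.integrable_bound)
    show "integrable M (\<lambda>x. 4 powr q * (a powr q * norm (\<phi> x) powr p + \<bar>\<beta> x\<bar> powr q))"
      using \<phi> \<beta> by (auto simp: Lp_fun_def)
    show "AE x in M. norm (norm (g x (\<phi> x)) powr q) \<le>
        norm (4 powr q * (a powr q * norm (\<phi> x) powr p + \<bar>\<beta> x\<bar> powr q))"
      using growth
    proof eventually_elim
      case (elim x)
      \<comment> \<open>The absolute value of \<open>\<beta> x\<close> provides the nonnegative
        summand that \<open>powr_sum4_le\<close> asks for.\<close>
      have "norm (g x (\<phi> x)) \<le> a * norm (\<phi> x) powr (p / q) + \<bar>\<beta> x\<bar> + 0 + 0"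
        using elim[rule_format, of "\<phi> x"] by simp
      then have "norm (g x (\<phi> x)) powr q \<le> (a * norm (\<phi> x) powr (p / q) + \<bar>\<beta> x\<bar> + 0 + 0) powr q"
        using pq by (intro powr_mono2) auto
      also have "\<dots> \<le> 4 powr q * ((a * norm (\<phi> x) powr (p / q)) powr q + \<bar>\<beta> x\<bar> powr q + 0 powr q + 0 powr q)"
        using pq by (intro powr_sum4_le) auto
      \<comment> \<open>Here the exponent \<open>p / q\<close> of the growth condition meets the
        power \<open>q\<close>.\<close>
      also have "(a * norm (\<phi> x) powr (p / q)) powr q = a powr q * norm (\<phi> x) powr p"
        using pq by (simp add: powr_mult powr_powr)
      finally show ?case by simp
    qed
  qed measurable
  with sm show ?thesis
    by (simp add: Lp_fun_def)
qed

text \<open>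
  The operator is uniformly continuous on precompact sets, jointly in the argument and in the
  parameter \<open>i\<close>: off a set of small measure both arguments lie in one compact set, where the
  functions \<open>g i \<theta>\<close> are equicontinuous, and on the exceptional set the growth condition and
  uniform integrability make the contribution small.
\<close>

lemma superposition_modulus:
  fixes g :: "'i \<Rightarrow> 'x \<Rightarrow> 'a::banach \<Rightarrow> 'b::banach"
  assumes pq: "p \<ge> 1" "q \<ge> 1" "a \<ge> 0"
    and W: "W \<subseteq> Lp_fun M p euclidean_metric 0" "precompact_wrt (Lp_dist M p euclidean_metric) W"
    and \<beta>: "\<And>i. \<beta> i \<in> Lp_fun M q euclidean_metric (0::real)"
      "precompact_wrt (Lp_dist M q euclidean_metric) (range \<beta>)"
    and growth: "\<And>i. AE x in M. \<forall>y. norm (g i x y) \<le> a * norm y powr (p / q) + \<beta> i x"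
    and g: "\<And>K i. compact K \<Longrightarrow> (\<lambda>x. restrict (g i x) K) \<in> Lp_fun M q (C_metric K) (C_zero K)"
      "\<And>K. compact K \<Longrightarrow>
        precompact_wrt (Lp_dist M q (C_metric K)) (range (\<lambda>i x. restrict (g i x) K))"
    and e: "\<epsilon> > 0"
  shows "\<exists>K \<delta>. compact K \<and> \<delta> > 0 \<and> (\<forall>i j. \<forall>\<phi>\<in>W. \<forall>\<psi>\<in>W.
      Lp_dist M p euclidean_metric \<phi> \<psi> < \<delta> \<longrightarrow>
      Lp_dist M q (C_metric K) (\<lambda>x. restrict (g i x) K) (\<lambda>x. restrict (g j x) K) < \<delta> \<longrightarrow>
      Lp_dist M q euclidean_metric (\<lambda>x. g i x (\<phi> x)) (\<lambda>x. g j x (\<psi> x)) < \<epsilon>)"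
proof -
  \<comment> \<open>The target for the integral of the \<open>q\<close>-th power. Using
    \<open>\<epsilon> / 2\<close> leaves room for the final strict inequality.\<close>
  define E where "E = (\<epsilon> / 2) powr q"
  have E: "E > 0" "E powr (1 / q) < \<epsilon>"
    using e pq by (simp_all add: E_def powr_powr)
  define T where "T = measure M (space M)"
  \<comment> \<open>Chosen so that a pointwise difference below \<sigma> contributes at most
    \<open>E / 2\<close>; \<open>T + 1\<close> avoids a division by zero.\<close>
  define \<sigma> where "\<sigma> = (E / (2 * (T + 1))) powr (1 / q)"
  have T: "T \<ge> 0" by (simp add: T_def)
  have \<sigma>: "\<sigma> > 0" "\<sigma> powr q = E / (2 * (T + 1))"
    using E(1) T pq by (simp_all add: \<sigma>_def powr_powr)
  have \<sigma>T: "\<sigma> powr q * T \<le> E / 2"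
    unfolding \<sigma>(2) using E(1) T by (simp add: field_simps)
  define P where "P = 4 powr q * (a powr q + 1)"
  have P: "P > 0"
    unfolding P_def by (intro mult_pos_pos add_nonneg_pos) auto
  \<comment> \<open>On the exceptional set there are two terms for each of \<open>\<phi>\<close>,
    \<open>\<psi>\<close> and two for \<beta>, all with integral at most \<open>c\<close> before
    weighting; together they stay below \<open>E / 2\<close>.\<close>
  define c where "c = E / (8 * P)"
  have c: "c > 0" "4 powr q * (a powr q * c + c + a powr q * c + c) \<le> E / 2"
  proof -
    show "c > 0" using E(1) P by (simp add: c_def)
    have "4 powr q * (a powr q * c + c + a powr q * c + c) = 2 * (P * c)"
      by (simp add: P_def algebra_simps)
    also have "P * c = E / 8"
      using P by (simp add: c_def)
    finally show "4 powr q * (a powr q * c + c + a powr q * c + c) \<le> E / 2"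
      using E(1) by simp
  qed
  obtain \<eta>1 where \<eta>1: "\<eta>1 > 0" "\<And>w B. w \<in> W \<Longrightarrow> B \<in> sets M \<Longrightarrow> measure M B \<le> \<eta>1 \<Longrightarrow>
      (LINT x|M. indicator B x * norm (w x) powr p) \<le> c"
    using precompact_uniformly_integrable[OF pq(1) _ W c(1)] by auto
  have \<beta>': "range \<beta> \<subseteq> Lp_fun M q euclidean_metric 0"
    using \<beta>(1) by blast
  obtain \<eta>2 where \<eta>2: "\<eta>2 > 0" "\<And>w B. w \<in> range \<beta> \<Longrightarrow> B \<in> sets M \<Longrightarrow> measure M B \<le> \<eta>2 \<Longrightarrow>
      (LINT x|M. indicator B x * \<bar>w x\<bar> powr q) \<le> c"
    using precompact_uniformly_integrable[OF pq(2) _ \<beta>' \<beta>(2) c(1)] by auto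
  define \<eta> where "\<eta> = min \<eta>1 \<eta>2"
  \<comment> \<open>Five conditions have to hold at once: \<phi> in \<open>K\<close>, \<psi> in
    \<open>K\<close>, closeness of \<phi> and \<psi>, equicontinuity of \<open>g i\<close>,
    closeness of \<open>g i\<close> and \<open>g j\<close> on \<open>K\<close>.\<close>
  define \<eta>' where "\<eta>' = \<eta> / 5"
  have \<eta>: "\<eta> \<le> \<eta>1" "\<eta> \<le> \<eta>2" "\<eta>' > 0" "\<eta>' + \<eta>' + \<eta>' + (\<eta>' + \<eta>') = \<eta>"
    using \<eta>1(1) \<eta>2(1) by (auto simp: \<eta>_def \<eta>'_def)
  have \<sigma>2: "\<sigma> / 2 > 0" using \<sigma> by simp
  \<comment> \<open>The order of choices matters: \<open>K\<close> depends on the admissible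
    exceptional measure, the modulus \<open>\<delta>1\<close> on \<open>K\<close>, and \<delta> on
    both.\<close>
  obtain K where K: "compact K" "\<And>w. w \<in> W \<Longrightarrow> mostly M \<eta>' (\<lambda>x. w x \<in> K)"
    using precompact_mostly_in_compact[OF pq(1) W \<eta>(3)] by blast
  have gK: "range (\<lambda>i x. restrict (g i x) K) \<subseteq> Lp_fun M q (C_metric K) (C_zero K)"
    using g(1)[OF K(1)] by blast
  obtain \<delta>1 where \<delta>1: "\<delta>1 > 0" "\<And>w. w \<in> range (\<lambda>i x. restrict (g i x) K) \<Longrightarrow>
      mostly M \<eta>' (\<lambda>\<theta>. \<forall>x\<in>K. \<forall>y\<in>K. dist x y < \<delta>1 \<longrightarrow> dist (w \<theta> x) (w \<theta> y) < \<sigma> / 2)"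
    by (rule precompact_mostly_equicontinuous[OF pq(2) K(1) gK g(2)[OF K(1)] \<eta>(3) \<sigma>2]) (rule that)
  \<comment> \<open>The minimum of the two Chebyshev thresholds, for \<phi>, \<psi> at tolerance
    \<open>\<delta>1\<close> and for \<open>g i\<close>, \<open>g j\<close> at tolerance
    \<open>\<sigma> / 2\<close>.\<close>
  define \<delta> where "\<delta> = min (\<delta>1 * \<eta>' powr (1 / p)) (\<sigma> / 2 * \<eta>' powr (1 / q))"
  have "\<delta> > 0"
    using \<delta>1(1) \<sigma>(1) \<eta>(3) by (simp add: \<delta>_def)
  moreover have "Lp_dist M q euclidean_metric (\<lambda>x. g i x (\<phi> x)) (\<lambda>x. g j x (\<psi> x)) < \<epsilon>"
    if mem: "\<phi> \<in> W" "\<psi> \<in> W" and d: "Lp_dist M p euclidean_metric \<phi> \<psi> < \<delta>"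
      "Lp_dist M q (C_metric K) (\<lambda>x. restrict (g i x) K) (\<lambda>x. restrict (g j x) K) < \<delta>"
    for i j \<phi> \<psi>
  proof -
    have \<phi>\<psi>: "\<phi> \<in> Lp_fun M p euclidean_metric 0" "\<psi> \<in> Lp_fun M p euclidean_metric 0"
      using mem W(1) by auto
    have near: "mostly M \<eta>' (\<lambda>x. dist (\<phi> x) (\<psi> x) < \<delta>1)"
      using Chebyshev_Lp_dist[OF pq(1) _ \<phi>\<psi>, of \<delta>1 \<eta>'] d(1) \<delta>1(1) \<eta>(3) by (simp add: \<delta>_def)
    have near_g: "mostly M \<eta>' (\<lambda>x. mdist (C_metric K) (restrict (g i x) K) (restrict (g j x) K) < \<sigma> / 2)"
      using Chebyshev_Lp_dist[OF pq(2) C_zero_in_mspace[OF K(1)] g(1)[OF K(1)] g(1)[OF K(1)],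
          of i j "\<sigma> / 2" \<eta>'] d(2) \<sigma>2 \<eta>(3) by (simp add: \<delta>_def)
    have AE_C: "AE x in M. restrict (g i x) K \<in> mspace (C_metric K)" for i
      using g(1)[OF K(1), of i] by (auto simp: Lp_fun_def dest: strongly_measurable_AE_mspace)
    have "AE x in M. restrict (g i x) K \<in> mspace (C_metric K) \<and> restrict (g j x) K \<in> mspace (C_metric K)"
      using AE_C[of i] AE_C[of j] by eventually_elim simp
    note near_g' = mostly_conj_AE[OF near_g this]
    define h where "h x = dist (g i x (\<phi> x)) (g j x (\<psi> x))" for x
    \<comment> \<open>The intermediate value is \<open>g i x (\<psi> x)\<close>: equicontinuity
      carries \<phi> to \<psi>, the distance in \<open>C(K,Y)\<close> carries \<open>g i\<close> to
      \<open>g j\<close>.\<close>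
    have "mostly M \<eta> (\<lambda>x. h x < \<sigma>)"
    proof (rule mostly_mono[OF mostly_conj[OF mostly_conj[OF mostly_conj[OF K(2)[OF mem(1)] K(2)[OF mem(2)]] near]
          mostly_conj[OF \<delta>1(2)[OF rangeI[of _ i]] near_g']]])
      fix x
      assume *: "((\<phi> x \<in> K \<and> \<psi> x \<in> K) \<and> dist (\<phi> x) (\<psi> x) < \<delta>1) \<and>
        (\<forall>y\<in>K. \<forall>y'\<in>K. dist y y' < \<delta>1 \<longrightarrow>
          dist (restrict (g i x) K y) (restrict (g i x) K y') < \<sigma> / 2) \<and>
        mdist (C_metric K) (restrict (g i x) K) (restrict (g j x) K) < \<sigma> / 2 \<and>
        restrict (g i x) K \<in> mspace (C_metric K) \<and> restrict (g j x) K \<in> mspace (C_metric K)"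
      then have "dist (restrict (g i x) K (\<phi> x)) (restrict (g i x) K (\<psi> x)) < \<sigma> / 2"
        by blast
      then have "dist (g i x (\<phi> x)) (g i x (\<psi> x)) < \<sigma> / 2"
        using * by simp
      moreover have "dist (g i x (\<psi> x)) (g j x (\<psi> x)) < \<sigma> / 2"
        using dist_le_mdist_C_metric[OF K(1), of "restrict (g i x) K" "restrict (g j x) K" "\<psi> x"] *
        by simp
      ultimately show "h x < \<sigma>"
        unfolding h_def using dist_triangle[of "g i x (\<phi> x)" "g j x (\<psi> x)" "g i x (\<psi> x)"] by simp
    qed (use \<eta>(4) in simp)
    then obtain B where B: "B \<in> sets M" "measure M B \<le> \<eta>" "\<And>x. x \<in> space M \<Longrightarrow> x \<notin> B \<Longrightarrow> h x < \<sigma>"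
      unfolding mostly_def by blast
    have B': "measure M B \<le> \<eta>1" "measure M B \<le> \<eta>2"
      using B(2) \<eta>(1,2) by auto
    \<comment> \<open>The growth bounds raised to the power \<open>q\<close>. The indicator makes
      \<open>R\<close> vanish off \<open>B\<close>, so that one inequality covers both
      regions.\<close>
    define R where "R x = a powr q * (indicator B x * norm (\<phi> x) powr p) + indicator B x * \<bar>\<beta> i x\<bar> powr q +
      a powr q * (indicator B x * norm (\<psi> x) powr p) + indicator B x * \<bar>\<beta> j x\<bar> powr q" for x
    have intW: "integrable M (\<lambda>x. indicator B x * norm (w x) powr p)" if "w \<in> W" for w
    proof -
      have "integrable M (\<lambda>x. norm (w x) powr p)"
        using that W(1) by (auto simp: Lp_fun_def)
      from integrable_mult_indicator[OF B(1) this] show ?thesis by simp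
    qed
    have int\<beta>: "integrable M (\<lambda>x. indicator B x * \<bar>\<beta> i x\<bar> powr q)" for i
    proof -
      have "integrable M (\<lambda>x. \<bar>\<beta> i x\<bar> powr q)"
        using \<beta>(1)[of i] by (auto simp: Lp_fun_def)
      from integrable_mult_indicator[OF B(1) this] show ?thesis by simp
    qed
    have intR: "integrable M R"
      unfolding R_def using intW[OF mem(1)] intW[OF mem(2)] int\<beta>[of i] int\<beta>[of j] by simp
    have R_bound: "(LINT x|M. R x) \<le> a powr q * c + c + a powr q * c + c"
    proof -
      have "(LINT x|M. R x) = a powr q * (LINT x|M. indicator B x * norm (\<phi> x) powr p) +
          (LINT x|M. indicator B x * \<bar>\<beta> i x\<bar> powr q) +
          a powr q * (LINT x|M. indicator B x * norm (\<psi> x) powr p) +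
          (LINT x|M. indicator B x * \<bar>\<beta> j x\<bar> powr q)"
        unfolding R_def using intW[OF mem(1)] intW[OF mem(2)] int\<beta>[of i] int\<beta>[of j] by simp
      also have "\<dots> \<le> a powr q * c + c + a powr q * c + c"
        using \<eta>1(2)[OF mem(1) B(1) B'(1)] \<eta>1(2)[OF mem(2) B(1) B'(1)] \<eta>2(2)[OF rangeI B(1) B'(2)]
        by (intro add_mono mult_left_mono) auto
      finally show ?thesis .
    qed
    have "(LINT x|M. h x powr q) \<le> (LINT x|M. \<sigma> powr q + 4 powr q * R x)"
    proof (rule integral_mono_AE')
      show "integrable M (\<lambda>x. \<sigma> powr q + 4 powr q * R x)"
        using intR by simp
      show "AE x in M. h x powr q \<le> \<sigma> powr q + 4 powr q * R x"
        using growth[of i] growth[of j] AE_space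
      proof eventually_elim
        case (elim x)
        show ?case
        proof (cases "x \<in> B")
          case False
          then have "h x powr q \<le> \<sigma> powr q"
            using B(3)[OF elim(3)] pq by (intro powr_mono2) (auto simp: h_def)
          moreover have "R x = 0"
            using False by (simp add: R_def)
          ultimately show ?thesis by simp
        next
          case True
          have "h x \<le> norm (g i x (\<phi> x)) + norm (g j x (\<psi> x))"
            by (simp add: h_def dist_norm norm_triangle_ineq4)
          also have "\<dots> \<le> a * norm (\<phi> x) powr (p / q) + \<bar>\<beta> i x\<bar> + a * norm (\<psi> x) powr (p / q) + \<bar>\<beta> j x\<bar>"
            using elim(1)[rule_format, of "\<phi> x"] elim(2)[rule_format, of "\<psi> x"] by simp
          finally have "h x powr q \<le>
              (a * norm (\<phi> x) powr (p / q) + \<bar>\<beta> i x\<bar> + a * norm (\<psi> x) powr (p / q) + \<bar>\<beta> j x\<bar>) powr q"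
            using pq by (intro powr_mono2) (auto simp: h_def)
          also have "\<dots> \<le> 4 powr q * ((a * norm (\<phi> x) powr (p / q)) powr q + \<bar>\<beta> i x\<bar> powr q +
              (a * norm (\<psi> x) powr (p / q)) powr q + \<bar>\<beta> j x\<bar> powr q)"
            using pq by (intro powr_sum4_le) auto
          also have "\<dots> = 4 powr q * R x"
            using True pq by (simp add: R_def powr_mult powr_powr)
          finally show ?thesis
            by (simp add: add_increasing)
        qed
      qed
      show "AE x in M. 0 \<le> \<sigma> powr q + 4 powr q * R x"
        by (auto simp: R_def)
    qed
    also have "\<dots> = \<sigma> powr q * T + 4 powr q * (LINT x|M. R x)"
      using intR by (simp add: T_def mult.commute)
    also have "\<dots> \<le> E / 2 + 4 powr q * (a powr q * c + c + a powr q * c + c)"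
      using \<sigma>T R_bound by (intro add_mono mult_left_mono) auto
    also have "\<dots> \<le> E"
      using c(2) by simp
    finally have "(LINT x|M. h x powr q) powr (1 / q) \<le> E powr (1 / q)"
      using pq by (intro powr_mono2) auto
    then show ?thesis
      using E(2) by (simp add: Lp_dist_def h_def)
  qed
  ultimately show ?thesis
    using K(1) by blast
qed

section \<open>Completeness\<close>

text \<open>The Riesz-Fischer argument: a fast subsequence converges almost everywhere by
  Borel-Cantelli, and Fatou's lemma along it bounds the distance of the whole sequence to the
  limit.\<close>

lemma Lp_complete:
  fixes f :: "nat \<Rightarrow> 'x \<Rightarrow> 'b::banach"
  assumes q: "q \<ge> 1" and f: "\<And>n. f n \<in> Lp_fun M q euclidean_metric 0"
    and cauchy: "\<And>\<epsilon>. \<epsilon> > 0 \<Longrightarrow> \<exists>N. \<forall>k\<ge>N. \<forall>l\<ge>N. Lp_dist M q euclidean_metric (f k) (f l) < \<epsilon>"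
  obtains v where "v \<in> Lp_fun M q euclidean_metric 0"
    "(\<lambda>n. Lp_dist M q euclidean_metric (f n) v) \<longlonglongrightarrow> 0"
proof -
  \<comment> \<open>The Chebyshev threshold when tolerance and exceptional measure are both
    \<open>(1/2) ^ n\<close>.\<close>
  define c where "c n = (1/2) ^ n * ((1/2) ^ n) powr (1 / q)" for n :: nat
  have "\<forall>n. \<exists>N. \<forall>k\<ge>N. \<forall>l\<ge>N. Lp_dist M q euclidean_metric (f k) (f l) < c n"
    using cauchy by (simp add: c_def)
  from choice[OF this]
  obtain N where N: "\<forall>n. \<forall>k\<ge>N n. \<forall>l\<ge>N n. Lp_dist M q euclidean_metric (f k) (f l) < c n" ..
  \<comment> \<open>The partial sums make \<open>r\<close> nondecreasing and at least
    \<open>N n\<close>; the summand \<open>n\<close> makes it tend to infinity.\<close>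
  define r where "r n = n + (\<Sum>i\<le>n. N i)" for n
  have r: "N n \<le> r n" "n \<le> r n" "r n \<le> r (Suc n)" for n
    using member_le_sum[of n "{..n}" N] by (auto simp: r_def)
  have step: "mostly M ((1/2) ^ n) (\<lambda>x. dist (f (r n) x) (f (r (Suc n)) x) < (1/2) ^ n)" for n
  proof -
    have "Lp_dist M q euclidean_metric (f (r n)) (f (r (Suc n))) < c n"
      using N r(1)[of n] r(3)[of n] by (meson order_trans)
    then show ?thesis
      using Chebyshev_Lp_dist[OF q _ f f, of "r n" "r (Suc n)" "(1/2) ^ n" "(1/2) ^ n"]
      by (simp add: c_def)
  qed
  \<comment> \<open>The subtracted term is what lets the induction close; afterwards only the bound
    \<open>2 * (1/2) ^ n\<close> is used.\<close>
  have telescope: "dist (F n) (F (n + k)) \<le> 2 * (1/2) ^ n - 2 * (1/2) ^ (n + k)"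
    if "\<And>j. j \<ge> n \<Longrightarrow> dist (F j) (F (Suc j)) < (1/2) ^ j" for F :: "nat \<Rightarrow> 'b" and n k
  proof (induction k)
    case (Suc k)
    show ?case
      using Suc that[of "n + k"] dist_triangle[of "F n" "F (n + Suc k)" "F (n + k)"] by simp
  qed simp
  define v where "v x = lim (\<lambda>n. f (r n) x)" for x
  have conv: "AE x in M. (\<lambda>n. f (r n) x) \<longlonglongrightarrow> v x"
    using AE_eventually_mostly[OF step]
  proof eventually_elim
    case (elim x)
    then obtain n0 where n0: "\<And>j. j \<ge> n0 \<Longrightarrow> dist (f (r j) x) (f (r (Suc j)) x) < (1/2) ^ j"
      by (auto simp: eventually_sequentially)
    have "Cauchy (\<lambda>n. f (r n) x)"
    proof (rule CauchyI')
      fix e :: real assume "e > 0"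
      then obtain m where m: "(1/2) ^ m < e / 2"
        using real_arch_pow_inv[of "e / 2" "1/2"] by auto
      have "dist (f (r k) x) (f (r l) x) < e" if "k \<ge> max m n0" "k < l" for k l
      proof -
        have "dist (f (r k) x) (f (r (k + (l - k))) x) \<le> 2 * (1/2) ^ k - 2 * (1/2) ^ (k + (l - k))"
          using telescope[of k "\<lambda>n. f (r n) x" "l - k"] n0 that by simp
        also have "\<dots> \<le> 2 * (1/2) ^ k" by simp
        also have "\<dots> \<le> 2 * (1/2) ^ m"
          using that power_decreasing[of m k "1/2 :: real"] by simp
        finally show ?thesis
          using m that by simp
      qed
      then show "\<exists>M. \<forall>m\<ge>M. \<forall>n>m. dist (f (r m) x) (f (r n) x) < e"
        by blast
    qed
    then show ?case
      unfolding v_def using Cauchy_convergent_iff convergent_LIMSEQ_iff by blast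
  qed
  have sm: "strongly_measurable M euclidean_metric v"
  proof (rule strongly_measurable_mostly_limit)
    fix \<eta> \<sigma> :: real assume pos: "\<eta> > 0" "\<sigma> > 0"
    obtain n where n: "(1/2) ^ n < min \<eta> \<sigma> / 4"
      using real_arch_pow_inv[of "min \<eta> \<sigma> / 4" "1/2"] pos by auto
    \<comment> \<open>The exceptional measures \<open>(1/2) ^ (n + k)\<close> sum over
      \<open>k\<close> to \<open>2 * (1/2) ^ n\<close>.\<close>
    have "mostly M (2 * (1/2) ^ n) (\<lambda>x. \<forall>k. dist (f (r (n + k)) x) (f (r (Suc (n + k))) x) < (1/2) ^ (n + k))"
      using step[of "n + _"] by (intro mostly_countable_Ball) (auto simp: power_add)
    then have "mostly M (2 * (1/2) ^ n) (\<lambda>x. (\<forall>k. dist (f (r (n + k)) x) (f (r (Suc (n + k))) x) < (1/2) ^ (n + k)) \<and>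
        (\<lambda>n. f (r n) x) \<longlonglongrightarrow> v x)"
      by (rule mostly_conj_AE) (rule conv)
    then have "mostly M \<eta> (\<lambda>x. v x \<in> mspace euclidean_metric \<and> mdist euclidean_metric (f (r n) x) (v x) < \<sigma>)"
    proof (rule mostly_mono)
      show "2 * (1/2) ^ n \<le> \<eta>"
        using n pos by auto
      fix x assume *: "(\<forall>k. dist (f (r (n + k)) x) (f (r (Suc (n + k))) x) < (1/2) ^ (n + k)) \<and>
        (\<lambda>n. f (r n) x) \<longlonglongrightarrow> v x"
      have "dist (f (r n) x) (v x) \<le> 2 * (1/2) ^ n"
      proof (rule LIMSEQ_le_const2)
        show "(\<lambda>k. dist (f (r n) x) (f (r (n + k)) x)) \<longlonglongrightarrow> dist (f (r n) x) (v x)"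
          using * by (intro tendsto_intros LIMSEQ_ignore_initial_segment[where f = "\<lambda>n. f (r n) x", of _ n,
                unfolded add.commute[of _ n]]) simp
        have "dist (f (r n) x) (f (r (n + k)) x) \<le> 2 * (1/2) ^ n" for k
        proof -
          have "dist (f (r n) x) (f (r (n + k)) x) \<le> 2 * (1/2) ^ n - 2 * (1/2) ^ (n + k)"
          proof (rule telescope)
            fix j assume "n \<le> j"
            then show "dist (f (r j) x) (f (r (Suc j)) x) < (1/2) ^ j"
              using conjunct1[OF *, rule_format, of "j - n"] by simp
          qed
          then show ?thesis
            by (smt (verit) zero_le_power zero_le_divide_1_iff)
        qed
        then show "\<exists>N. \<forall>k\<ge>N. dist (f (r n) x) (f (r (n + k)) x) \<le> 2 * (1/2) ^ n"
          by blast
      qed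
      also have "\<dots> < \<sigma>"
        using n pos by auto
      finally show "v x \<in> mspace euclidean_metric \<and> mdist euclidean_metric (f (r n) x) (v x) < \<sigma>"
        by simp
    qed
    then show "\<exists>g. strongly_measurable M euclidean_metric g \<and>
        mostly M \<eta> (\<lambda>x. v x \<in> mspace euclidean_metric \<and> mdist euclidean_metric (g x) (v x) < \<sigma>)"
      using f[of "r n"] by (auto simp: Lp_fun_def)
  qed
  \<comment> \<open>A bound valid for all late \<open>f k\<close> is inherited by \<open>v\<close>.
    It is derived for the nonnegative extended integral, since integrability is itself part of the
    claim.\<close>
  have Fatou: "integrable M (\<lambda>x. dist (f n x) (v x) powr q) \<and> (LINT x|M. dist (f n x) (v x) powr q) \<le> e"
    if e: "e \<ge> 0" and ev: "\<And>k. k \<ge> k0 \<Longrightarrow> (LINT x|M. dist (f n x) (f k x) powr q) \<le> e" for n e k0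
  proof -
    have int: "integrable M (\<lambda>x. dist (f n x) (f k x) powr q)" for k
      using integrable_mdist_Lp_fun[OF q _ f[of n] f[of k]] by simp
    have [measurable]: "(\<lambda>x. dist (f n x) (v x)) \<in> borel_measurable M"
      using strongly_measurable_mdist[OF _ sm, of "f n"] f[of n] by (simp add: Lp_fun_def)
    have "AE x in M. liminf (\<lambda>k. ennreal (dist (f n x) (f (r k) x) powr q)) = ennreal (dist (f n x) (v x) powr q)"
      using conv
    proof eventually_elim
      case (elim x)
      have "(\<lambda>k. dist (f n x) (f (r k) x) powr q) \<longlonglongrightarrow> dist (f n x) (v x) powr q"
        using elim q by (intro tendsto_powr' tendsto_intros) auto
      then show ?case
        by (intro lim_imp_Liminf tendsto_ennrealI) auto
    qed
    then have "(\<integral>\<^sup>+x. ennreal (dist (f n x) (v x) powr q) \<partial>M) =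
        (\<integral>\<^sup>+x. liminf (\<lambda>k. ennreal (dist (f n x) (f (r k) x) powr q)) \<partial>M)"
      by (intro nn_integral_cong_AE) auto
    also have "\<dots> \<le> liminf (\<lambda>k. \<integral>\<^sup>+x. ennreal (dist (f n x) (f (r k) x) powr q) \<partial>M)"
      using int by (intro nn_integral_liminf) auto
    also have "\<dots> \<le> ennreal e"
    proof (rule Liminf_le)
      show "eventually (\<lambda>k. (\<integral>\<^sup>+x. ennreal (dist (f n x) (f (r k) x) powr q) \<partial>M) \<le> ennreal e) sequentially"
      proof (intro eventually_sequentiallyI[of k0])
        fix k assume "k \<ge> k0"
        then have "r k \<ge> k0" using r(2)[of k] by simp
        from ev[OF this] show "(\<integral>\<^sup>+x. ennreal (dist (f n x) (f (r k) x) powr q) \<partial>M) \<le> ennreal e"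
          using int by (subst nn_integral_eq_integral) (auto intro: ennreal_leI)
      qed
    qed simp
    finally have le: "(\<integral>\<^sup>+x. ennreal (dist (f n x) (v x) powr q) \<partial>M) \<le> ennreal e" .
    have i: "integrable M (\<lambda>x. dist (f n x) (v x) powr q)"
    proof (rule integrableI_nonneg)
      show "(\<integral>\<^sup>+x. ennreal (dist (f n x) (v x) powr q) \<partial>M) < \<infinity>"
        using le by (rule order_le_less_trans) simp
    qed auto
    moreover have "(LINT x|M. dist (f n x) (v x) powr q) \<le> e"
      using le nn_integral_eq_integral[OF i] e by simp
    ultimately show ?thesis by blast
  qed
  have small: "\<exists>N. \<forall>n\<ge>N. integrable M (\<lambda>x. dist (f n x) (v x) powr q) \<and>
      Lp_dist M q euclidean_metric (f n) v \<le> e" if e: "e > 0" for e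
  proof -
    obtain N where N: "\<And>k l. k \<ge> N \<Longrightarrow> l \<ge> N \<Longrightarrow> Lp_dist M q euclidean_metric (f k) (f l) < e"
      using cauchy[OF e] by blast
    have "integrable M (\<lambda>x. dist (f n x) (v x) powr q) \<and> Lp_dist M q euclidean_metric (f n) v \<le> e" if n: "n \<ge> N" for n
    proof -
      have "(LINT x|M. dist (f n x) (f k x) powr q) \<le> e powr q" if "k \<ge> N" for k
      proof -
        have "(LINT x|M. dist (f n x) (f k x) powr q) = (Lp_dist M q euclidean_metric (f n) (f k)) powr q"
          using q by (simp add: Lp_dist_def powr_powr)
        also have "\<dots> \<le> e powr q"
          using N[OF n that] q by (intro powr_mono2) (auto simp: Lp_dist_def)
        finally show ?thesis .
      qed
      from Fatou[OF _ this, of N] have *: "integrable M (\<lambda>x. dist (f n x) (v x) powr q)"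
        "(LINT x|M. dist (f n x) (v x) powr q) \<le> e powr q" by auto
      have "(LINT x|M. dist (f n x) (v x) powr q) powr (1 / q) \<le> (e powr q) powr (1 / q)"
        using *(2) q by (intro powr_mono2) auto
      then have "Lp_dist M q euclidean_metric (f n) v \<le> e"
        using e q by (simp add: Lp_dist_def powr_powr)
      with *(1) show ?thesis by blast
    qed
    then show ?thesis by blast
  qed
  obtain n where n: "integrable M (\<lambda>x. dist (f n x) (v x) powr q)"
    using small[of 1] by auto
  have "integrable M (\<lambda>x. norm (v x) powr q)"
  proof (rule Bochner_Integration.integrable_bound)
    show "integrable M (\<lambda>x. 4 powr q * (norm (f n x) powr q + dist (f n x) (v x) powr q))"
      using n f[of n] by (simp add: Lp_fun_def)
    have "(\<lambda>x. norm (v x)) \<in> borel_measurable M"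
      using strongly_measurable_mdist[OF sm simple_function_strongly_measurable[OF simple_function_const[of _ 0]]]
      by simp
    then show "(\<lambda>x. norm (v x) powr q) \<in> borel_measurable M"
      by measurable
    show "AE x in M. norm (norm (v x) powr q) \<le> norm (4 powr q * (norm (f n x) powr q + dist (f n x) (v x) powr q))"
    proof (rule AE_I2)
      fix x
      have "norm (v x) \<le> norm (f n x) + dist (f n x) (v x) + 0 + 0"
        using norm_triangle_ineq2[of "v x" "f n x"] by (simp add: dist_norm norm_minus_commute)
      then have "norm (v x) powr q \<le> (norm (f n x) + dist (f n x) (v x) + 0 + 0) powr q"
        using q by (intro powr_mono2) auto
      also have "\<dots> \<le> 4 powr q * (norm (f n x) powr q + dist (f n x) (v x) powr q + 0 powr q + 0 powr q)"
        using q by (intro powr_sum4_le) auto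
      finally show "norm (norm (v x) powr q) \<le> norm (4 powr q * (norm (f n x) powr q + dist (f n x) (v x) powr q))"
        by simp
    qed
  qed
  then have "v \<in> Lp_fun M q euclidean_metric 0"
    using sm by (simp add: Lp_fun_def)
  moreover have "(\<lambda>n. Lp_dist M q euclidean_metric (f n) v) \<longlonglongrightarrow> 0"
  proof (rule LIMSEQ_I)
    fix e :: real assume "e > 0"
    with small[of "e / 2"] obtain N where N: "\<forall>n\<ge>N. Lp_dist M q euclidean_metric (f n) v \<le> e / 2"
      by auto
    have "norm (Lp_dist M q euclidean_metric (f n) v - 0) < e" if "n \<ge> N" for n
    proof -
      have "0 \<le> Lp_dist M q euclidean_metric (f n) v"
        by (simp add: Lp_dist_def)
      with N that \<open>e > 0\<close> show ?thesis by (auto simp: abs_of_nonneg)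
    qed
    then show "\<exists>N. \<forall>n\<ge>N. norm (Lp_dist M q euclidean_metric (f n) v - 0) < e"
      by blast
  qed
  ultimately show thesis by (rule that)
qed

end

section \<open>Translations\<close>

lemma complete_finite_measure_lebesgue_on_interval:
  "complete_finite_measure (lebesgue_on {a<..<b::real})"
proof -
  interpret complete_measure "lebesgue_on {a<..<b}"
    by (rule complete_measure_lebesgue_on) simp
  interpret finite_measure "lebesgue_on {a<..<b}"
    by (rule finite_measure_lebesgue_on) simp
  show ?thesis ..
qed

interpretation unit_interval: complete_finite_measure "lebesgue_on {0<..<1::real}"
  by (rule complete_finite_measure_lebesgue_on_interval)

lemma measurable_translation_unit_interval:
  "(\<lambda>\<theta>. t + \<theta>) \<in> lebesgue_on {0<..<1} \<rightarrow>\<^sub>M lebesgue_on {t<..<t + 1::real}"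
proof (rule measurable_restrict_space3)
  show "(\<lambda>\<theta>. t + \<theta>) \<in> lebesgue \<rightarrow>\<^sub>M lebesgue"
    using lebesgue_affine_measurable[of "\<lambda>_. 1 :: real" t] by simp
qed auto

text \<open>Translation invariance of Lebesgue measure on intervals. Through this identity null sets
  and integrability over \<open>{t<..<t + 1}\<close> are pulled back to the unit interval.\<close>

lemma distr_translation_unit_interval:
  "distr (lebesgue_on {0<..<1}) (lebesgue_on {t<..<t + 1}) (\<lambda>\<theta>. t + \<theta>) = lebesgue_on {t<..<t + 1::real}"
proof (rule measure_eqI)
  fix A assume "A \<in> sets (distr (lebesgue_on {0<..<1}) (lebesgue_on {t<..<t + 1}) (\<lambda>\<theta>. t + \<theta>))"
  then have A: "A \<in> sets (lebesgue_on {t<..<t + 1})" by simp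
  then have A': "A \<in> sets lebesgue" "A \<subseteq> {t<..<t + 1}"
    by (auto simp: sets_restrict_space_iff)
  have meas: "(\<lambda>\<theta>. t + \<theta>) \<in> lebesgue \<rightarrow>\<^sub>M (lebesgue :: real measure)"
    using lebesgue_affine_measurable[of "\<lambda>_. 1 :: real" t] by simp
  have "distr lebesgue lebesgue (\<lambda>\<theta>. t + \<theta>) = (lebesgue :: real measure)"
    using lebesgue_real_affine[of 1 t] by (simp add: density_1)
  then have "emeasure lebesgue A = emeasure (distr lebesgue lebesgue (\<lambda>\<theta>. t + \<theta>)) A"
    by simp
  also have "\<dots> = emeasure lebesgue ((\<lambda>\<theta>. t + \<theta>) -` A)"
    using A'(1) meas by (simp add: emeasure_distr)
  finally have eq: "emeasure lebesgue A = emeasure lebesgue ((\<lambda>\<theta>. t + \<theta>) -` A)" .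
  have sub: "(\<lambda>\<theta>. t + \<theta>) -` A \<subseteq> {0<..<1}"
    using A'(2) by auto
  have "emeasure (distr (lebesgue_on {0<..<1}) (lebesgue_on {t<..<t + 1}) (\<lambda>\<theta>. t + \<theta>)) A =
      emeasure (lebesgue_on {0<..<1}) ((\<lambda>\<theta>. t + \<theta>) -` A \<inter> {0<..<1})"
    using A measurable_translation_unit_interval[of t] by (simp add: emeasure_distr)
  also have "\<dots> = emeasure (lebesgue_on {0<..<1}) ((\<lambda>\<theta>. t + \<theta>) -` A)"
    using sub by (simp add: Int_absorb2)
  also have "\<dots> = emeasure lebesgue ((\<lambda>\<theta>. t + \<theta>) -` A)"
    using sub by (intro emeasure_restrict_space) auto
  also have "\<dots> = emeasure (lebesgue_on {t<..<t + 1}) A"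
    using A'(2) by (subst emeasure_restrict_space) (auto simp: eq)
  finally show "emeasure (distr (lebesgue_on {0<..<1}) (lebesgue_on {t<..<t + 1}) (\<lambda>\<theta>. t + \<theta>)) A =
      emeasure (lebesgue_on {t<..<t + 1}) A" .
qed simp

lemma AE_translation_unit_interval:
  fixes t :: real
  assumes "AE x in lebesgue_on {t<..<t + 1}. P x"
  shows "AE \<theta> in lebesgue_on {0<..<1}. P (t + \<theta>)"
proof (rule AE_distrD[OF measurable_translation_unit_interval])
  show "AE x in distr (lebesgue_on {0<..<1}) (lebesgue_on {t<..<t + 1}) (\<lambda>\<theta>. t + \<theta>). P x"
    unfolding distr_translation_unit_interval by (rule assms)
qed

lemma AE_lebesgue_translation_unit_interval:
  fixes t :: real
  assumes "AE x in lebesgue. P x"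
  shows "AE \<theta> in lebesgue_on {0<..<1}. P (t + \<theta>)"
proof (rule AE_translation_unit_interval)
  show "AE x in lebesgue_on {t<..<t + 1}. P x"
    using assms by (subst AE_restrict_space_iff) auto
qed

lemma strongly_measurable_translation_unit_interval:
  fixes t :: real
  assumes "strongly_measurable (lebesgue_on {t<..<t + 1}) m u"
  shows "strongly_measurable (lebesgue_on {0<..<1}) m (\<lambda>\<theta>. u (t + \<theta>))"
proof -
  obtain s where s: "\<And>n::nat. simple_function (lebesgue_on {t<..<t + 1}) (s n)"
    "\<And>n. s n \<in> {t<..<t + 1} \<rightarrow> mspace m"
    "AE x in lebesgue_on {t<..<t + 1}. limitin (mtopology_of m) (\<lambda>n. s n x) (u x) sequentially"
    using assms by (auto simp: strongly_measurable_def)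
  have "simple_function (lebesgue_on {0<..<1}) (\<lambda>\<theta>. s n (t + \<theta>))" for n
    unfolding simple_function_def
  proof (intro conjI ballI)
    have sub: "(\<lambda>\<theta>. s n (t + \<theta>)) ` {0<..<1} \<subseteq> s n ` {t<..<t + 1}"
      by auto
    show "finite ((\<lambda>\<theta>. s n (t + \<theta>)) ` space (lebesgue_on {0<..<1}))"
      using s(1)[of n] finite_subset[OF sub] by (simp add: simple_function_def)
    fix y assume "y \<in> (\<lambda>\<theta>. s n (t + \<theta>)) ` space (lebesgue_on {0<..<1})"
    have "s n -` {y} \<inter> {t<..<t + 1} \<in> sets (lebesgue_on {t<..<t + 1})"
      using simple_functionD(2)[OF s(1)[of n], of "{y}"] by simp
    from measurable_sets[OF measurable_translation_unit_interval this]
    have "(\<lambda>\<theta>. t + \<theta>) -` (s n -` {y} \<inter> {t<..<t + 1}) \<inter> {0<..<1} \<in> sets (lebesgue_on {0<..<1})"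
      by simp
    also have "(\<lambda>\<theta>. t + \<theta>) -` (s n -` {y} \<inter> {t<..<t + 1}) \<inter> {0<..<1} =
        (\<lambda>\<theta>. s n (t + \<theta>)) -` {y} \<inter> space (lebesgue_on {0<..<1})"
      by auto
    finally show "(\<lambda>\<theta>. s n (t + \<theta>)) -` {y} \<inter> space (lebesgue_on {0<..<1}) \<in> sets (lebesgue_on {0<..<1})" .
  qed
  moreover have "(\<lambda>\<theta>. s n (t + \<theta>)) \<in> space (lebesgue_on {0<..<1}) \<rightarrow> mspace m" for n
    using s(2)[of n] by auto
  ultimately show ?thesis
    unfolding strongly_measurable_def using AE_translation_unit_interval[OF s(3)]
    by (intro exI[of _ "\<lambda>n \<theta>. s n (t + \<theta>)"]) simp
qed

lemma Lp_loc_translation: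
  assumes "u \<in> Lp_loc p m z"
  shows "(\<lambda>\<theta>. u (t + \<theta>)) \<in> Lp_fun (lebesgue_on {0<..<1}) p m z"
proof -
  have u: "u \<in> Lp_fun (lebesgue_on {t<..<t + 1}) p m z"
    using assms by (simp add: Lp_loc_def)
  have "integrable (distr (lebesgue_on {0<..<1}) (lebesgue_on {t<..<t + 1}) (\<lambda>\<theta>. t + \<theta>))
      (\<lambda>x. mdist m z (u x) powr p)"
    unfolding distr_translation_unit_interval using u by (simp add: Lp_fun_def)
  from integrable_distr[OF measurable_translation_unit_interval this] u show ?thesis
    by (simp add: Lp_fun_def strongly_measurable_translation_unit_interval)
qed

section \<open>Stepanov spaces by means of pseudometrics\<close>

text \<open>The distance of two values of the Bochner transform, taken on representatives; classes
  then occur only where the definitions of the Stepanov spaces are unfolded.\<close>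

definition stepanov_dist :: "real \<Rightarrow> 'e metric \<Rightarrow> (real \<Rightarrow> 'e) \<Rightarrow> real \<Rightarrow> real \<Rightarrow> real" where
  "stepanov_dist p m u t t' =
     Lp_dist (lebesgue_on {0<..<1}) p m (\<lambda>\<theta>. u (t + \<theta>)) (\<lambda>\<theta>. u (t' + \<theta>))"

lemma Lp_dist_commute: "Lp_dist M p m f g = Lp_dist M p m g f"
  by (simp add: Lp_dist_def mdist_commute)

lemma pseudometric_stepanov_dist:
  assumes "p \<ge> 1" "z \<in> mspace m" "u \<in> Lp_loc p m z"
  shows "pseudometric (stepanov_dist p m u)"
  unfolding pseudometric_def stepanov_dist_def
  using unit_interval.Lp_dist_triangle[OF assms(1,2)] unit_interval.Lp_dist_eq_0_iff[OF assms(1,2)]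
    Lp_loc_translation[OF assms(3)] Lp_dist_commute
  by (intro conjI allI) auto

lemma bochner_transform_in_mspace:
  assumes "p \<ge> 1" "z \<in> mspace m" "u \<in> Lp_loc p m z"
  shows "bochner_transform p m z u t \<in> mspace (Lp (lebesgue_on {0<..<1}) p m z)"
  using assms by (simp add: bochner_transform_def unit_interval.mspace_Lp Lp_loc_translation)

lemma mdist_bochner_transform:
  assumes "p \<ge> 1" "z \<in> mspace m" "u \<in> Lp_loc p m z"
  shows "mdist (Lp (lebesgue_on {0<..<1}) p m z) (bochner_transform p m z u t) (bochner_transform p m z u t')
    = stepanov_dist p m u t t'"
  using assms
  by (simp add: bochner_transform_def unit_interval.mdist_Lp Lp_loc_translation stepanov_dist_def)

section \<open>From functions with values in a metric space to pseudometrics and back\<close>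

lemma continuous_map_iff_continuous_wrt:
  assumes "\<And>t. U t \<in> mspace L"
  shows "continuous_map euclidean (mtopology_of L) U \<longleftrightarrow> continuous_wrt (\<lambda>t t'. mdist L (U t) (U t'))"
proof -
  interpret Metric_space "mspace L" "mdist L" by (rule Metric_space_mspace_mdist)
  have "continuous_map euclidean (mtopology_of L) U \<longleftrightarrow>
      (\<forall>t. \<forall>\<epsilon>>0. \<exists>V. open V \<and> t \<in> V \<and> (\<forall>s\<in>V. mdist L (U s) (U t) < \<epsilon>))"
    unfolding mtopology_of_def continuous_map_to_metric using assms
    by (simp add: mdist_commute)
  also have "\<dots> \<longleftrightarrow> continuous_wrt (\<lambda>t t'. mdist L (U t) (U t'))"
    unfolding continuous_wrt_def
  proof (intro all_cong1 imp_cong refl iffI)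
    fix t \<epsilon> :: real
    assume "\<exists>V. open V \<and> t \<in> V \<and> (\<forall>s\<in>V. mdist L (U s) (U t) < \<epsilon>)"
    then obtain V where V: "open V" "t \<in> V" "\<forall>s\<in>V. mdist L (U s) (U t) < \<epsilon>" by blast
    obtain \<delta> where \<delta>: "\<delta> > 0" "ball t \<delta> \<subseteq> V"
      using V(1,2) open_contains_ball by blast
    have "mdist L (U s) (U t) < \<epsilon>" if "\<bar>s - t\<bar> < \<delta>" for s
      using V(3) \<delta>(2) that by (auto simp: dist_real_def abs_minus_commute subset_iff)
    then show "\<exists>\<delta>>0. \<forall>s. \<bar>s - t\<bar> < \<delta> \<longrightarrow> mdist L (U s) (U t) < \<epsilon>"
      using \<delta>(1) by blast
  next
    fix t \<epsilon> :: real
    assume "\<exists>\<delta>>0. \<forall>s. \<bar>s - t\<bar> < \<delta> \<longrightarrow> mdist L (U s) (U t) < \<epsilon>"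
    then obtain \<delta> where "\<delta> > 0" "\<forall>s. \<bar>s - t\<bar> < \<delta> \<longrightarrow> mdist L (U s) (U t) < \<epsilon>" by blast
    then show "\<exists>V. open V \<and> t \<in> V \<and> (\<forall>s\<in>V. mdist L (U s) (U t) < \<epsilon>)"
      by (intro exI[of _ "ball t \<delta>"]) (auto simp: dist_real_def abs_minus_commute)
  qed
  finally show ?thesis .
qed

lemma almost_periodic_iff_almost_periodic_wrt:
  assumes "\<And>t. U t \<in> mspace L"
  shows "almost_periodic L U \<longleftrightarrow> almost_periodic_wrt (\<lambda>t t'. mdist L (U t) (U t'))"
  by (simp add: almost_periodic_def almost_periodic_wrt_def continuous_map_iff_continuous_wrt[OF assms])

lemma limitin_mtopology_of_iff:
  assumes "\<And>k. x k \<in> mspace L"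
  shows "limitin (mtopology_of L) x l sequentially \<longleftrightarrow>
    l \<in> mspace L \<and> (\<forall>\<epsilon>>0. \<exists>N. \<forall>k\<ge>N. mdist L (x k) l < \<epsilon>)"
  using assms by (auto simp: limitin_mtopology_of_null LIMSEQ_iff)

text \<open>Both conditions follow by the triangle inequality through a value of \<open>v\<close>:
  through \<open>v t\<close> for the Cauchy condition, through \<open>v (t - s (r k))\<close> for
  the return to \<open>U t\<close>.\<close>

lemma almost_automorphic_imp_almost_automorphic_wrt:
  assumes U: "\<And>t. U t \<in> mspace L" and aa: "almost_automorphic L U"
  shows "almost_automorphic_wrt (\<lambda>t t'. mdist L (U t) (U t'))"
  unfolding almost_automorphic_wrt_def
proof (intro conjI allI)
  show "continuous_wrt (\<lambda>t t'. mdist L (U t) (U t'))"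
    using aa U by (simp add: almost_automorphic_def continuous_map_iff_continuous_wrt)
  fix s :: "nat \<Rightarrow> real"
  obtain r :: "nat \<Rightarrow> nat" and v where r: "strict_mono r"
    and "\<forall>t. limitin (mtopology_of L) (\<lambda>k. U (t + s (r k))) (v t) sequentially \<and>
      limitin (mtopology_of L) (\<lambda>k. v (t - s (r k))) (U t) sequentially"
    using aa unfolding almost_automorphic_def by blast
  then have lim: "limitin (mtopology_of L) (\<lambda>k. U (t + s (r k))) (v t) sequentially"
    "limitin (mtopology_of L) (\<lambda>k. v (t - s (r k))) (U t) sequentially" for t
    by auto
  have v: "v t \<in> mspace L" for t
    using lim(1)[of t] U by (simp add: limitin_mtopology_of_iff)
  have lim1: "\<exists>N. \<forall>k\<ge>N. mdist L (U (t + s (r k))) (v t) < \<epsilon>" if "\<epsilon> > 0" for t \<epsilon>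
    using lim(1)[of t] U that by (simp add: limitin_mtopology_of_iff)
  have lim2: "\<exists>N. \<forall>k\<ge>N. mdist L (v (t - s (r k))) (U t) < \<epsilon>" if "\<epsilon> > 0" for t \<epsilon>
    using lim(2)[of t] v that by (simp add: limitin_mtopology_of_iff)
  have "aa_sequence (\<lambda>t t'. mdist L (U t) (U t')) (s \<circ> r)"
    unfolding aa_sequence_def
  proof (intro conjI allI impI)
    fix t \<epsilon> :: real assume "\<epsilon> > 0"
    then have e2: "\<epsilon> / 2 > 0" by simp
    from lim1[OF e2] obtain N where N: "\<forall>k\<ge>N. mdist L (U (t + s (r k))) (v t) < \<epsilon> / 2" by blast
    have "mdist L (U (t + s (r k))) (U (t + s (r l))) < \<epsilon>" if "k \<ge> N" "l \<ge> N" for k l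
    proof -
      have "mdist L (U (t + s (r k))) (v t) < \<epsilon> / 2" "mdist L (U (t + s (r l))) (v t) < \<epsilon> / 2"
        using N that by auto
      then show ?thesis
        using mdist_triangle[of "U (t + s (r k))" L "v t" "U (t + s (r l))"] U v
          mdist_commute[of L "v t" "U (t + s (r l))"] by simp
    qed
    then show "\<exists>N. \<forall>k\<ge>N. \<forall>l\<ge>N. mdist L (U (t + (s \<circ> r) k)) (U (t + (s \<circ> r) l)) < \<epsilon>"
      by auto
    from lim2[OF e2] obtain N where N: "\<forall>k\<ge>N. mdist L (v (t - s (r k))) (U t) < \<epsilon> / 2" by blast
    have "\<exists>M. \<forall>l\<ge>M. mdist L (U (t - s (r k) + s (r l))) (U t) < \<epsilon>" if k: "k \<ge> N" for k
    proof -
      obtain M where M: "\<forall>l\<ge>M. mdist L (U (t - s (r k) + s (r l))) (v (t - s (r k))) < \<epsilon> / 2"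
        using lim1[OF e2] by blast
      have "mdist L (U (t - s (r k) + s (r l))) (U t) < \<epsilon>" if "l \<ge> M" for l
      proof -
        have "mdist L (U (t - s (r k) + s (r l))) (v (t - s (r k))) < \<epsilon> / 2"
          "mdist L (v (t - s (r k))) (U t) < \<epsilon> / 2"
          using M N k that by auto
        then show ?thesis
          using mdist_triangle[of "U (t - s (r k) + s (r l))" L "v (t - s (r k))" "U t"] U v by simp
      qed
      then show ?thesis by blast
    qed
    then show "\<exists>N. \<forall>k\<ge>N. \<exists>M. \<forall>l\<ge>M. mdist L (U (t - (s \<circ> r) k + (s \<circ> r) l)) (U t) < \<epsilon>"
      by auto
  qed
  with r show "\<exists>r. strict_mono r \<and> aa_sequence (\<lambda>t t'. mdist L (U t) (U t')) (s \<circ> r)"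
    by blast
qed

text \<open>The function \<open>v\<close> is the pointwise limit of the translates. Completeness is
  therefore demanded only of Cauchy sequences of values of \<open>U\<close>.\<close>

lemma almost_automorphic_wrt_imp_almost_automorphic:
  assumes U: "\<And>t. U t \<in> mspace L" and aa: "almost_automorphic_wrt (\<lambda>t t'. mdist L (U t) (U t'))"
    and complete: "\<And>\<sigma> :: nat \<Rightarrow> real. (\<And>\<epsilon>. \<epsilon> > 0 \<Longrightarrow> \<exists>N. \<forall>k\<ge>N. \<forall>l\<ge>N. mdist L (U (\<sigma> k)) (U (\<sigma> l)) < \<epsilon>) \<Longrightarrow>
      \<exists>v. limitin (mtopology_of L) (\<lambda>k. U (\<sigma> k)) v sequentially"
  shows "almost_automorphic L U"
  unfolding almost_automorphic_def
proof (intro conjI allI)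
  show "continuous_map euclidean (mtopology_of L) U"
    using aa U by (simp add: almost_automorphic_wrt_def continuous_map_iff_continuous_wrt)
  fix s :: "nat \<Rightarrow> real"
  obtain r :: "nat \<Rightarrow> nat" where r: "strict_mono r"
    and aas: "aa_sequence (\<lambda>t t'. mdist L (U t) (U t')) (s \<circ> r)"
    using aa unfolding almost_automorphic_wrt_def by blast
  have cauchy: "\<exists>N. \<forall>k\<ge>N. \<forall>l\<ge>N. mdist L (U (t + s (r k))) (U (t + s (r l))) < \<epsilon>" if "\<epsilon> > 0" for t \<epsilon>
    using aas that unfolding aa_sequence_def by simp
  have return: "\<exists>N. \<forall>k\<ge>N. \<exists>M. \<forall>l\<ge>M. mdist L (U (t - s (r k) + s (r l))) (U t) < \<epsilon>" if "\<epsilon> > 0" for t \<epsilon>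
    using aas that unfolding aa_sequence_def by simp
  have "\<forall>t. \<exists>v. limitin (mtopology_of L) (\<lambda>k. U (t + s (r k))) v sequentially"
    using cauchy by (intro allI complete)
  from choice[OF this] obtain v where
    lim: "\<forall>t. limitin (mtopology_of L) (\<lambda>k. U (t + s (r k))) (v t) sequentially" ..
  have v: "v t \<in> mspace L" for t
    using lim[rule_format, of t] U by (simp add: limitin_mtopology_of_iff)
  have lim1: "\<exists>N. \<forall>k\<ge>N. mdist L (U (t + s (r k))) (v t) < \<epsilon>" if "\<epsilon> > 0" for t \<epsilon>
    using lim[rule_format, of t] U that by (simp add: limitin_mtopology_of_iff)
  have "limitin (mtopology_of L) (\<lambda>k. v (t - s (r k))) (U t) sequentially" for t
    unfolding limitin_mtopology_of_iff[OF v]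
  proof (intro conjI U allI impI)
    fix \<epsilon> :: real assume "\<epsilon> > 0"
    then have e2: "\<epsilon> / 2 > 0" by simp
    from return[OF e2] obtain N where
      N: "\<forall>k\<ge>N. \<exists>M. \<forall>l\<ge>M. mdist L (U (t - s (r k) + s (r l))) (U t) < \<epsilon> / 2" by blast
    have "mdist L (v (t - s (r k))) (U t) < \<epsilon>" if k: "k \<ge> N" for k
    proof -
      obtain M where M: "\<forall>l\<ge>M. mdist L (U (t - s (r k) + s (r l))) (U t) < \<epsilon> / 2"
        using N k by blast
      obtain M' where M': "\<forall>l\<ge>M'. mdist L (U (t - s (r k) + s (r l))) (v (t - s (r k))) < \<epsilon> / 2"
        using lim1[OF e2] by blast
      \<comment> \<open>A translate beyond both thresholds, close to \<open>U t\<close> and to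
        \<open>v (t - s (r k))\<close> at the same time.\<close>
      define w where "w = U (t - s (r k) + s (r (max M M')))"
      have "mdist L w (U t) < \<epsilon> / 2" "mdist L w (v (t - s (r k))) < \<epsilon> / 2"
        using M M' by (simp_all add: w_def)
      moreover have "w \<in> mspace L"
        using U by (simp add: w_def)
      ultimately show ?thesis
        using mdist_triangle[of "v (t - s (r k))" L w "U t"] U v mdist_commute[of L w "v (t - s (r k))"]
        by simp
    qed
    then show "\<exists>N. \<forall>k\<ge>N. mdist L (v (t - s (r k))) (U t) < \<epsilon>" by blast
  qed
  with r lim show "\<exists>r. strict_mono r \<and>
      (\<exists>v. \<forall>t. limitin (mtopology_of L) (\<lambda>k. U (t + s (r k))) (v t) sequentially \<and>
        limitin (mtopology_of L) (\<lambda>k. v (t - s (r k))) (U t) sequentially)"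
    by blast
qed

lemma Stepanov_apI:
  assumes "p \<ge> 1" "z \<in> mspace m" "u \<in> Lp_loc p m z" "almost_periodic_wrt (stepanov_dist p m u)"
  shows "u \<in> Stepanov_ap p m z"
  using assms(3,4) unfolding Stepanov_ap_def
  by (simp add: almost_periodic_iff_almost_periodic_wrt[OF bochner_transform_in_mspace[OF assms(1-3)]]
      mdist_bochner_transform[OF assms(1-3)])

lemma Stepanov_apD:
  assumes "p \<ge> 1" "z \<in> mspace m" "u \<in> Stepanov_ap p m z"
  shows "u \<in> Lp_loc p m z" "almost_periodic_wrt (stepanov_dist p m u)"
proof -
  show u: "u \<in> Lp_loc p m z"
    using assms(3) by (simp add: Stepanov_ap_def)
  show "almost_periodic_wrt (stepanov_dist p m u)"
    using assms(3) unfolding Stepanov_ap_def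
    by (simp add: almost_periodic_iff_almost_periodic_wrt[OF bochner_transform_in_mspace[OF assms(1,2) u]]
        mdist_bochner_transform[OF assms(1,2) u])
qed

lemma Stepanov_aaD:
  assumes "p \<ge> 1" "z \<in> mspace m" "u \<in> Stepanov_aa p m z"
  shows "u \<in> Lp_loc p m z" "almost_automorphic_wrt (stepanov_dist p m u)"
proof -
  show u: "u \<in> Lp_loc p m z"
    using assms(3) by (simp add: Stepanov_aa_def)
  have "almost_automorphic (Lp (lebesgue_on {0<..<1}) p m z) (bochner_transform p m z u)"
    using assms(3) by (simp add: Stepanov_aa_def)
  from almost_automorphic_imp_almost_automorphic_wrt[OF bochner_transform_in_mspace[OF assms(1,2) u] this]
  show "almost_automorphic_wrt (stepanov_dist p m u)"
    by (simp add: mdist_bochner_transform[OF assms(1,2) u])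
qed

text \<open>Recovering \<open>v\<close> uses the completeness of the Lebesgue space, so the values
  lie in a type of class \<open>banach\<close>. The opposite direction is available for every metric
  and thus for \<open>C(K,Y)\<close>.\<close>

lemma Stepanov_aaI:
  fixes u :: "real \<Rightarrow> 'b::banach"
  assumes p: "p \<ge> 1" and u: "u \<in> Lp_loc p euclidean_metric 0"
    and aa: "almost_automorphic_wrt (stepanov_dist p euclidean_metric u)"
  shows "u \<in> Stepanov_aa p euclidean_metric 0"
proof -
  let ?L = "Lp (lebesgue_on {0<..<1}) p euclidean_metric (0 :: 'b)"
  let ?U = "bochner_transform p euclidean_metric 0 u"
  have z: "(0 :: 'b) \<in> mspace euclidean_metric" by simp
  have "almost_automorphic ?L ?U"
  proof (rule almost_automorphic_wrt_imp_almost_automorphic)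
    show "?U t \<in> mspace ?L" for t
      by (rule bochner_transform_in_mspace[OF p z u])
    show "almost_automorphic_wrt (\<lambda>t t'. mdist ?L (?U t) (?U t'))"
      using aa by (simp add: mdist_bochner_transform[OF p z u])
    fix \<sigma> :: "nat \<Rightarrow> real"
    assume cauchy: "\<exists>N. \<forall>k\<ge>N. \<forall>l\<ge>N. mdist ?L (?U (\<sigma> k)) (?U (\<sigma> l)) < \<epsilon>" if "\<epsilon> > 0" for \<epsilon>
    have "\<exists>N. \<forall>k\<ge>N. \<forall>l\<ge>N. Lp_dist (lebesgue_on {0<..<1}) p euclidean_metric
        (\<lambda>\<theta>. u (\<sigma> k + \<theta>)) (\<lambda>\<theta>. u (\<sigma> l + \<theta>)) < \<epsilon>" if "\<epsilon> > 0" for \<epsilon>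
      using cauchy[OF that] by (simp add: mdist_bochner_transform[OF p z u] stepanov_dist_def)
    from unit_interval.Lp_complete[OF p Lp_loc_translation[OF u] this]
    obtain v where v: "v \<in> Lp_fun (lebesgue_on {0<..<1}) p euclidean_metric 0"
      "(\<lambda>k. Lp_dist (lebesgue_on {0<..<1}) p euclidean_metric (\<lambda>\<theta>. u (\<sigma> k + \<theta>)) v) \<longlonglongrightarrow> 0"
      by blast
    have "limitin (mtopology_of ?L) (\<lambda>k. ?U (\<sigma> k))
        (Lp_class (lebesgue_on {0<..<1}) p euclidean_metric 0 v) sequentially"
      unfolding limitin_mtopology_of_null
    proof (intro conjI)
      show "Lp_class (lebesgue_on {0<..<1}) p euclidean_metric 0 v \<in> mspace ?L"
        using v(1) by (simp add: unit_interval.mspace_Lp[OF p z])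
      show "eventually (\<lambda>k. ?U (\<sigma> k) \<in> mspace ?L) sequentially"
        by (simp add: bochner_transform_in_mspace[OF p z u])
      show "(\<lambda>k. mdist ?L (?U (\<sigma> k)) (Lp_class (lebesgue_on {0<..<1}) p euclidean_metric 0 v)) \<longlonglongrightarrow> 0"
        using v(2)
        by (simp add: bochner_transform_def unit_interval.mdist_Lp[OF p z Lp_loc_translation[OF u] v(1)])
    qed
    then show "\<exists>v. limitin (mtopology_of ?L) (\<lambda>k. ?U (\<sigma> k)) v sequentially" by blast
  qed
  with u show ?thesis
    by (simp add: Stepanov_aa_def)
qed

section \<open>The superposition operator on Stepanov spaces\<close>

lemma precompact_wrt_image:
  assumes "precompact_wrt (\<lambda>s t. D (F s) (F t)) UNIV"
  shows "precompact_wrt D (range F)"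
  unfolding precompact_wrt_def
proof (intro allI impI)
  fix \<epsilon> :: real assume "\<epsilon> > 0"
  with assms have "\<exists>T. finite T \<and> T \<subseteq> UNIV \<and> (\<forall>w\<in>UNIV. \<exists>v\<in>T. D (F w) (F v) < \<epsilon>)"
    unfolding precompact_wrt_def by simp
  then obtain T where T: "finite T" "\<forall>w. \<exists>v\<in>T. D (F w) (F v) < \<epsilon>"
    by auto
  then show "\<exists>G. finite G \<and> G \<subseteq> range F \<and> (\<forall>w\<in>range F. \<exists>v\<in>G. D w v < \<epsilon>)"
    by (intro exI[of _ "F ` T"]) auto
qed

text \<open>Used to show that the real supremum in \<open>Stepanov_norm\<close> is taken over a
  bounded set.\<close>

lemma precompact_wrt_bounded:
  assumes d: "pseudometric d" and pc: "precompact_wrt d UNIV"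
  shows "\<exists>B. \<forall>t. d t t\<^sub>0 \<le> B"
proof -
  obtain T where T: "finite T" "\<forall>w. \<exists>v\<in>T. d w v < 1"
    using pc unfolding precompact_wrt_def by (meson UNIV_I zero_less_one)
  have "d t t\<^sub>0 \<le> 1 + (\<Sum>v\<in>T. \<bar>d v t\<^sub>0\<bar>)" for t
  proof -
    obtain v where v: "v \<in> T" "d t v < 1" using T(2) by blast
    have "\<bar>d v t\<^sub>0\<bar> \<le> (\<Sum>v\<in>T. \<bar>d v t\<^sub>0\<bar>)"
      using v(1) T(1) by (intro member_le_sum) auto
    then show ?thesis
      using v(2) pseudometricD(3)[OF d, of t t\<^sub>0 v] by simp
  qed
  then show ?thesis by blast
qed

text \<open>A common superset of the almost automorphic and the almost periodic Stepanov spaces, on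
  which modulus and continuity are treated for both cases together.\<close>

definition Stepanov_precompact :: "real \<Rightarrow> 'e metric \<Rightarrow> 'e \<Rightarrow> (real \<Rightarrow> 'e) set" where
  "Stepanov_precompact p m z = {u \<in> Lp_loc p m z. precompact_wrt (stepanov_dist p m u) UNIV}"

lemma Stepanov_aa_precompact:
  assumes "p \<ge> 1" "z \<in> mspace m"
  shows "Stepanov_aa p m z \<subseteq> Stepanov_precompact p m z"
  using Stepanov_aaD[OF assms] pseudometric_stepanov_dist[OF assms] almost_automorphic_wrt_precompact
  by (auto simp: Stepanov_precompact_def)

lemma Stepanov_ap_precompact:
  assumes "p \<ge> 1" "z \<in> mspace m"
  shows "Stepanov_ap p m z \<subseteq> Stepanov_precompact p m z"
  using Stepanov_apD[OF assms] pseudometric_stepanov_dist[OF assms] almost_periodic_wrt_precompact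
  by (auto simp: Stepanov_precompact_def)

lemma precompact_wrt_translates:
  assumes "u \<in> Stepanov_precompact p m z"
  shows "precompact_wrt (Lp_dist (lebesgue_on {0<..<1}) p m) (range (\<lambda>t \<theta>. u (t + \<theta>)))"
  using assms by (intro precompact_wrt_image) (simp add: Stepanov_precompact_def stepanov_dist_def[abs_def])

text \<open>The Stepanov norm being a supremum over \<open>t\<close>, a failure of continuity at
  \<open>u\<close> supplies functions \<open>w n\<close> together with times \<open>t n\<close> at
  which the images stay apart. What remains concerns one sequence of translates, to which
  precompactness applies.\<close>

lemma Stepanov_continuous_onI:
  fixes F :: "(real \<Rightarrow> 'a::banach) \<Rightarrow> real \<Rightarrow> 'b::banach"
  assumes p: "p \<ge> 1" and S: "S \<subseteq> Stepanov_precompact p euclidean_metric 0"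
    and seq: "\<And>u \<epsilon> w t. u \<in> S \<Longrightarrow> \<epsilon> > 0 \<Longrightarrow> (\<And>n :: nat. w n \<in> S) \<Longrightarrow>
      (\<And>n. Lp_dist (lebesgue_on {0<..<1}) p euclidean_metric
        (\<lambda>\<theta>. w n (t n + \<theta>)) (\<lambda>\<theta>. u (t n + \<theta>)) < 1 / Suc n) \<Longrightarrow>
      \<exists>n. Lp_dist (lebesgue_on {0<..<1}) q euclidean_metric
        (\<lambda>\<theta>. F (w n) (t n + \<theta>)) (\<lambda>\<theta>. F u (t n + \<theta>)) < \<epsilon>"
  shows "Stepanov_continuous_on p q S F"
  unfolding Stepanov_continuous_on_def
proof (intro ballI allI impI, rule ccontr)
  fix u and \<epsilon> :: real assume u: "u \<in> S" and e: "\<epsilon> > 0"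
    and neg: "\<not> (\<exists>\<delta>>0. \<forall>w\<in>S. Stepanov_norm p (\<lambda>t. w t - u t) < \<delta> \<longrightarrow>
      Stepanov_norm q (\<lambda>t. F w t - F u t) < \<epsilon>)"
  let ?I = "lebesgue_on {0<..<1::real}"
  have "\<exists>w t. w \<in> S \<and>
      Lp_dist ?I p euclidean_metric (\<lambda>\<theta>. w (t + \<theta>)) (\<lambda>\<theta>. u (t + \<theta>)) < 1 / Suc n \<and>
      \<epsilon> / 2 < Lp_dist ?I q euclidean_metric (\<lambda>\<theta>. F w (t + \<theta>)) (\<lambda>\<theta>. F u (t + \<theta>))" for n
  proof -
    have "1 / real (Suc n) > 0" by simp
    with neg obtain w where w: "w \<in> S" "Stepanov_norm p (\<lambda>t. w t - u t) < 1 / Suc n"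
      "\<not> Stepanov_norm q (\<lambda>t. F w t - F u t) < \<epsilon>"
      by blast
    define d where "d t = Lp_dist ?I p euclidean_metric (\<lambda>\<theta>. w (t + \<theta>)) (\<lambda>\<theta>. u (t + \<theta>))" for t
    define d' where "d' t = Lp_dist ?I q euclidean_metric (\<lambda>\<theta>. F w (t + \<theta>)) (\<lambda>\<theta>. F u (t + \<theta>))" for t
    have norm_p: "Stepanov_norm p (\<lambda>t. w t - u t) = (SUP t. d t)"
      by (simp add: Stepanov_norm_def d_def Lp_dist_def dist_norm)
    have norm_q: "Stepanov_norm q (\<lambda>t. F w t - F u t) = (SUP t. d' t)"
      by (simp add: Stepanov_norm_def d'_def Lp_dist_def dist_norm)
    have "bdd_above (range d)"
    proof -
      have *: "w \<in> Lp_loc p euclidean_metric 0" "u \<in> Lp_loc p euclidean_metric 0"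
        "precompact_wrt (stepanov_dist p euclidean_metric w) UNIV"
        "precompact_wrt (stepanov_dist p euclidean_metric u) UNIV"
        using w(1) u S by (auto simp: Stepanov_precompact_def)
      obtain B where B: "\<And>t. stepanov_dist p euclidean_metric w t 0 \<le> B"
        using precompact_wrt_bounded[OF pseudometric_stepanov_dist[OF p _ *(1)] *(3)] by auto
      obtain B' where B': "\<And>t. stepanov_dist p euclidean_metric u t 0 \<le> B'"
        using precompact_wrt_bounded[OF pseudometric_stepanov_dist[OF p _ *(2)] *(4)] by auto
      \<comment> \<open>Both functions are compared with their own translates at time
        \<open>0\<close>.\<close>
      have "d t \<le> B + (d 0 + B')" for t
      proof -
        have "d t \<le> stepanov_dist p euclidean_metric w t 0 +
            Lp_dist ?I p euclidean_metric (\<lambda>\<theta>. w (0 + \<theta>)) (\<lambda>\<theta>. u (t + \<theta>))"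
          unfolding d_def stepanov_dist_def
          by (rule unit_interval.Lp_dist_triangle[OF p _ Lp_loc_translation[OF *(1)]
                Lp_loc_translation[OF *(1)] Lp_loc_translation[OF *(2)]]) simp
        moreover have "Lp_dist ?I p euclidean_metric (\<lambda>\<theta>. w (0 + \<theta>)) (\<lambda>\<theta>. u (t + \<theta>)) \<le>
            d 0 + stepanov_dist p euclidean_metric u 0 t"
          unfolding d_def stepanov_dist_def
          by (rule unit_interval.Lp_dist_triangle[OF p _ Lp_loc_translation[OF *(1)]
                Lp_loc_translation[OF *(2)] Lp_loc_translation[OF *(2)]]) simp
        moreover have "stepanov_dist p euclidean_metric u 0 t = stepanov_dist p euclidean_metric u t 0"
          unfolding stepanov_dist_def by (rule Lp_dist_commute)
        ultimately show ?thesis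
          using B[of t] B'[of t] by simp
      qed
      then show ?thesis by (intro bdd_aboveI[of _ "B + (d 0 + B')"]) auto
    qed
    then have small: "d t < 1 / Suc n" for t
      using w(2) cSUP_upper[of t UNIV d] unfolding norm_p by simp
    \<comment> \<open>The supremum need not be attained, hence the loss of a factor
      \<open>2\<close>.\<close>
    have "\<exists>t. \<epsilon> / 2 < d' t"
    proof (rule ccontr)
      assume "\<nexists>t. \<epsilon> / 2 < d' t"
      then have "(SUP t. d' t) \<le> \<epsilon> / 2"
        by (intro cSUP_least) (auto simp: not_less)
      then show False
        using w(3) e unfolding norm_q by simp
    qed
    then show ?thesis
      using w(1) small unfolding d_def d'_def by blast
  qed
  then have "\<forall>n. \<exists>wt. fst wt \<in> S \<and>
      Lp_dist ?I p euclidean_metric (\<lambda>\<theta>. fst wt (snd wt + \<theta>)) (\<lambda>\<theta>. u (snd wt + \<theta>)) < 1 / Suc n \<and>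
      \<epsilon> / 2 < Lp_dist ?I q euclidean_metric (\<lambda>\<theta>. F (fst wt) (snd wt + \<theta>)) (\<lambda>\<theta>. F u (snd wt + \<theta>))"
    by simp
  from choice[OF this] obtain wt where wt: "\<forall>n. fst (wt n) \<in> S \<and>
      Lp_dist ?I p euclidean_metric (\<lambda>\<theta>. fst (wt n) (snd (wt n) + \<theta>)) (\<lambda>\<theta>. u (snd (wt n) + \<theta>)) < 1 / Suc n \<and>
      \<epsilon> / 2 < Lp_dist ?I q euclidean_metric (\<lambda>\<theta>. F (fst (wt n)) (snd (wt n) + \<theta>))
        (\<lambda>\<theta>. F u (snd (wt n) + \<theta>))" ..
  have "\<exists>n. Lp_dist ?I q euclidean_metric (\<lambda>\<theta>. F (fst (wt n)) (snd (wt n) + \<theta>))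
        (\<lambda>\<theta>. F u (snd (wt n) + \<theta>)) < \<epsilon> / 2"
  proof (rule seq[OF u, where w = "\<lambda>n. fst (wt n)" and t = "\<lambda>n. snd (wt n)"])
    show "\<epsilon> / 2 > 0" using e by simp
  qed (use wt in blast)+
  then obtain n where "Lp_dist ?I q euclidean_metric (\<lambda>\<theta>. F (fst (wt n)) (snd (wt n) + \<theta>))
        (\<lambda>\<theta>. F u (snd (wt n) + \<theta>)) < \<epsilon> / 2" ..
  with wt[rule_format, of n] show False
    by simp
qed

text \<open>A net for the translates of \<open>u\<close> absorbs every \<open>w n\<close> with
  \<open>n \<ge> N\<close> by the triangle inequality; the finitely many earlier ones are added to
  the net.\<close>

lemma precompact_wrt_convergent_sequence:
  fixes w :: "nat \<Rightarrow> real \<Rightarrow> 'a::banach"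
  assumes p: "p \<ge> 1" and u: "u \<in> Stepanov_precompact p euclidean_metric 0"
    and w: "\<And>n. w n \<in> Lp_loc p euclidean_metric 0"
    and near: "\<And>n. Lp_dist (lebesgue_on {0<..<1}) p euclidean_metric
        (\<lambda>\<theta>. w n (t n + \<theta>)) (\<lambda>\<theta>. u (t n + \<theta>)) < 1 / Suc n"
  shows "precompact_wrt (Lp_dist (lebesgue_on {0<..<1}) p euclidean_metric)
    (range (\<lambda>t \<theta>. u (t + \<theta>)) \<union> range (\<lambda>n \<theta>. w n (t n + \<theta>)))"
  unfolding precompact_wrt_def
proof (intro allI impI)
  let ?d = "Lp_dist (lebesgue_on {0<..<1}) p (euclidean_metric :: 'a metric)"
  let ?u = "\<lambda>t \<theta>. u (t + \<theta>)" and ?w = "\<lambda>n \<theta>. w n (t n + \<theta>)"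
  fix \<epsilon> :: real assume e: "\<epsilon> > 0"
  then have "\<epsilon> / 2 > 0" by simp
  from precompact_wrt_translates[OF u, unfolded precompact_wrt_def, rule_format, OF this]
  obtain G where "finite G \<and> G \<subseteq> range ?u \<and> (\<forall>x\<in>range ?u. \<exists>v\<in>G. ?d x v < \<epsilon> / 2)" ..
  then have G: "finite G" "G \<subseteq> range ?u" "\<forall>x\<in>range ?u. \<exists>v\<in>G. ?d x v < \<epsilon> / 2"
    by simp_all
  obtain N where N: "1 / Suc N < \<epsilon> / 2"
    using nat_approx_posE[of "\<epsilon> / 2"] e by auto
  have u_loc: "u \<in> Lp_loc p euclidean_metric 0"
    using u by (simp add: Stepanov_precompact_def)
  have "\<exists>v\<in>G \<union> ?w ` {..<N}. ?d (?w n) v < \<epsilon>" for n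
  proof (cases "n < N")
    case True
    have "?d (?w n) (?w n) = 0"
      using p by (simp add: Lp_dist_def)
    then show ?thesis
      using True e by (intro bexI[of _ "?w n"]) auto
  next
    case False
    obtain v where v: "v \<in> G" "?d (?u (t n)) v < \<epsilon> / 2"
      using G(3) by blast
    have "v \<in> Lp_fun (lebesgue_on {0<..<1}) p euclidean_metric 0"
      using v(1) G(2) Lp_loc_translation[OF u_loc] by blast
    then have "?d (?w n) v \<le> ?d (?w n) (?u (t n)) + ?d (?u (t n)) v"
      by (intro unit_interval.Lp_dist_triangle[OF p _ Lp_loc_translation[OF w] Lp_loc_translation[OF u_loc]]) auto
    moreover have "1 / real (Suc n) \<le> 1 / Suc N"
      using False by (intro divide_left_mono) auto
    ultimately show ?thesis
      using v near[of n] N by (intro bexI[of _ v]) auto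
  qed
  moreover have "\<exists>v\<in>G \<union> ?w ` {..<N}. ?d (?u s) v < \<epsilon>" for s
  proof -
    obtain v where v: "v \<in> G" "?d (?u s) v < \<epsilon> / 2"
      using G(3) by blast
    then show ?thesis using e by (intro bexI[of _ v]) auto
  qed
  ultimately show "\<exists>G. finite G \<and> G \<subseteq> range ?u \<union> range ?w \<and> (\<forall>x\<in>range ?u \<union> range ?w. \<exists>v\<in>G. ?d x v < \<epsilon>)"
    using G(1,2) by (intro exI[of _ "G \<union> ?w ` {..<N}"]) auto
qed

locale superposition =
  fixes f :: "real \<Rightarrow> 'a::banach \<Rightarrow> 'b::banach" and p q a :: real and b :: "real \<Rightarrow> real"
  assumes pq: "1 \<le> p" "1 \<le> q" and a: "0 \<le> a"
    and b: "b \<in> Stepanov_precompact q euclidean_metric 0"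
    and growth: "AE t in lebesgue. \<forall>x. norm (f t x) \<le> a * norm x powr (p / q) + b t"
    and f: "\<And>K. compact K \<Longrightarrow> (\<lambda>t. restrict (f t) K) \<in> Stepanov_precompact q (C_metric K) (C_zero K)"
begin

lemma nemytskii_Lp_loc:
  assumes u: "u \<in> Lp_loc p euclidean_metric 0"
  shows "nemytskii f u \<in> Lp_loc q euclidean_metric 0"
  unfolding Lp_loc_def
proof (intro CollectI allI impI)
  fix c d :: real assume cd: "c < d"
  interpret complete_finite_measure "lebesgue_on {c<..<d}"
    by (rule complete_finite_measure_lebesgue_on_interval)
  have "(\<lambda>t. f t (u t)) \<in> Lp_fun (lebesgue_on {c<..<d}) q euclidean_metric 0"
  proof (rule superposition_Lp_fun[where g = f and \<phi> = u and \<beta> = b, OF _ pq a])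
    show "strongly_measurable (lebesgue_on {c<..<d}) (C_metric K) (\<lambda>t. restrict (f t) K)"
      if "compact K" for K
      using f[OF that] cd by (simp add: Stepanov_precompact_def Lp_loc_def Lp_fun_def)
    show "u \<in> Lp_fun (lebesgue_on {c<..<d}) p euclidean_metric 0"
      using u cd by (simp add: Lp_loc_def)
    show "b \<in> Lp_fun (lebesgue_on {c<..<d}) q euclidean_metric 0"
      using b cd by (simp add: Stepanov_precompact_def Lp_loc_def)
    show "AE t in lebesgue_on {c<..<d}. \<forall>x. norm (f t x) \<le> a * norm x powr (p / q) + b t"
      using growth by (subst AE_restrict_space_iff) auto
  qed
  then show "nemytskii f u \<in> Lp_fun (lebesgue_on {c<..<d}) q euclidean_metric 0"
    by (simp add: nemytskii_def[abs_def])
qed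

text \<open>The time \<open>t\<close> is the parameter of the general modulus, with
  \<open>f (t + \<theta>)\<close> and \<open>b (t + \<theta>)\<close> in place of \<open>g\<close>
  and \<beta>. \<open>W\<close> is left open: it will be the translates of \<open>u\<close>, or
  these together with a sequence approaching them.\<close>

lemma translates_modulus:
  assumes W: "W \<subseteq> Lp_fun (lebesgue_on {0<..<1}) p euclidean_metric 0"
    "precompact_wrt (Lp_dist (lebesgue_on {0<..<1}) p euclidean_metric) W" and e: "\<epsilon> > 0"
  obtains K \<delta> where "compact K" "\<delta> > 0"
    "\<And>t t' \<phi> \<psi>. \<phi> \<in> W \<Longrightarrow> \<psi> \<in> W \<Longrightarrow> Lp_dist (lebesgue_on {0<..<1}) p euclidean_metric \<phi> \<psi> < \<delta> \<Longrightarrow>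
      stepanov_dist q (C_metric K) (\<lambda>t. restrict (f t) K) t t' < \<delta> \<Longrightarrow>
      Lp_dist (lebesgue_on {0<..<1}) q euclidean_metric
        (\<lambda>\<theta>. f (t + \<theta>) (\<phi> \<theta>)) (\<lambda>\<theta>. f (t' + \<theta>) (\<psi> \<theta>)) < \<epsilon>"
proof -
  have loc: "(\<lambda>t. restrict (f t) K) \<in> Lp_loc q (C_metric K) (C_zero K)" if "compact K" for K
    using f[OF that] by (simp add: Stepanov_precompact_def)
  have "\<exists>K \<delta>. compact K \<and> \<delta> > 0 \<and> (\<forall>t t'. \<forall>\<phi>\<in>W. \<forall>\<psi>\<in>W.
      Lp_dist (lebesgue_on {0<..<1}) p euclidean_metric \<phi> \<psi> < \<delta> \<longrightarrow>
      Lp_dist (lebesgue_on {0<..<1}) q (C_metric K) (\<lambda>\<theta>. restrict (f (t + \<theta>)) K) (\<lambda>\<theta>. restrict (f (t' + \<theta>)) K) < \<delta> \<longrightarrow>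
      Lp_dist (lebesgue_on {0<..<1}) q euclidean_metric
        (\<lambda>\<theta>. f (t + \<theta>) (\<phi> \<theta>)) (\<lambda>\<theta>. f (t' + \<theta>) (\<psi> \<theta>)) < \<epsilon>)"
  proof (rule unit_interval.superposition_modulus[where \<beta> = "\<lambda>t \<theta>. b (t + \<theta>)", OF pq a W _ _ _ _ _ e])
    show "(\<lambda>\<theta>. b (t + \<theta>)) \<in> Lp_fun (lebesgue_on {0<..<1}) q euclidean_metric 0" for t
      using b by (intro Lp_loc_translation) (simp add: Stepanov_precompact_def)
    show "precompact_wrt (Lp_dist (lebesgue_on {0<..<1}) q euclidean_metric) (range (\<lambda>t \<theta>. b (t + \<theta>)))"
      by (rule precompact_wrt_translates[OF b])
    show "AE \<theta> in lebesgue_on {0<..<1}. \<forall>y. norm (f (t + \<theta>) y) \<le> a * norm y powr (p / q) + b (t + \<theta>)" for t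
      by (rule AE_lebesgue_translation_unit_interval[OF growth])
    show "(\<lambda>\<theta>. restrict (f (t + \<theta>)) K) \<in> Lp_fun (lebesgue_on {0<..<1}) q (C_metric K) (C_zero K)"
      if "compact K" for K t
      by (rule Lp_loc_translation[OF loc[OF that]])
    show "precompact_wrt (Lp_dist (lebesgue_on {0<..<1}) q (C_metric K)) (range (\<lambda>t \<theta>. restrict (f (t + \<theta>)) K))"
      if "compact K" for K
      by (rule precompact_wrt_translates[OF f[OF that]])
  qed
  then obtain K \<delta> where K: "compact K" "\<delta> > 0" and modulus: "\<forall>t t'. \<forall>\<phi>\<in>W. \<forall>\<psi>\<in>W.
      Lp_dist (lebesgue_on {0<..<1}) p euclidean_metric \<phi> \<psi> < \<delta> \<longrightarrow>
      Lp_dist (lebesgue_on {0<..<1}) q (C_metric K) (\<lambda>\<theta>. restrict (f (t + \<theta>)) K) (\<lambda>\<theta>. restrict (f (t' + \<theta>)) K) < \<delta> \<longrightarrow>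
      Lp_dist (lebesgue_on {0<..<1}) q euclidean_metric
        (\<lambda>\<theta>. f (t + \<theta>) (\<phi> \<theta>)) (\<lambda>\<theta>. f (t' + \<theta>) (\<psi> \<theta>)) < \<epsilon>"
    by (elim exE conjE) (rule that)
  show thesis
    by (rule that[OF K]) (use modulus in \<open>simp add: stepanov_dist_def\<close>)
qed

lemma nemytskii_modulus:
  assumes u: "u \<in> Stepanov_precompact p euclidean_metric 0"
  obtains K where "\<And>n. compact (K n)"
    "\<And>\<epsilon>. \<epsilon> > 0 \<Longrightarrow> \<exists>n :: nat. \<exists>\<delta>>0. \<forall>t t'. stepanov_dist p euclidean_metric u t t' < \<delta> \<longrightarrow>
      stepanov_dist q (C_metric (K n)) (\<lambda>t. restrict (f t) (K n)) t t' < \<delta> \<longrightarrow>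
      stepanov_dist q euclidean_metric (nemytskii f u) t t' < \<epsilon>"
proof -
  have W: "range (\<lambda>t \<theta>. u (t + \<theta>)) \<subseteq> Lp_fun (lebesgue_on {0<..<1}) p euclidean_metric 0"
    using u Lp_loc_translation by (auto simp: Stepanov_precompact_def)
  have "\<exists>K. compact K \<and> (\<exists>\<delta>>0. \<forall>t t'. stepanov_dist p euclidean_metric u t t' < \<delta> \<longrightarrow>
      stepanov_dist q (C_metric K) (\<lambda>t. restrict (f t) K) t t' < \<delta> \<longrightarrow>
      stepanov_dist q euclidean_metric (nemytskii f u) t t' < \<epsilon>)" if e: "\<epsilon> > 0" for \<epsilon>
  proof -
    obtain K \<delta> where K: "compact K" "\<delta> > 0"
      "\<And>t t' \<phi> \<psi>. \<phi> \<in> range (\<lambda>t \<theta>. u (t + \<theta>)) \<Longrightarrow> \<psi> \<in> range (\<lambda>t \<theta>. u (t + \<theta>)) \<Longrightarrow>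
        Lp_dist (lebesgue_on {0<..<1}) p euclidean_metric \<phi> \<psi> < \<delta> \<Longrightarrow>
        stepanov_dist q (C_metric K) (\<lambda>t. restrict (f t) K) t t' < \<delta> \<Longrightarrow>
        Lp_dist (lebesgue_on {0<..<1}) q euclidean_metric
          (\<lambda>\<theta>. f (t + \<theta>) (\<phi> \<theta>)) (\<lambda>\<theta>. f (t' + \<theta>) (\<psi> \<theta>)) < \<epsilon>"
      by (rule translates_modulus[OF W precompact_wrt_translates[OF u] e]) (rule that)
    have "stepanov_dist q euclidean_metric (nemytskii f u) t t' < \<epsilon>"
      if "stepanov_dist p euclidean_metric u t t' < \<delta>"
        "stepanov_dist q (C_metric K) (\<lambda>t. restrict (f t) K) t t' < \<delta>" for t t'
      using K(3)[OF rangeI rangeI, of t t' t t'] that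
      by (simp add: stepanov_dist_def nemytskii_def)
    with K(1,2) show ?thesis by blast
  qed
  then have "\<forall>n. \<exists>K. compact K \<and> (\<exists>\<delta>>0. \<forall>t t'. stepanov_dist p euclidean_metric u t t' < \<delta> \<longrightarrow>
      stepanov_dist q (C_metric K) (\<lambda>t. restrict (f t) K) t t' < \<delta> \<longrightarrow>
      stepanov_dist q euclidean_metric (nemytskii f u) t t' < 1 / real (Suc n))"
    by simp
  from choice[OF this] obtain K where K: "\<forall>n. compact (K n) \<and>
      (\<exists>\<delta>>0. \<forall>t t'. stepanov_dist p euclidean_metric u t t' < \<delta> \<longrightarrow>
        stepanov_dist q (C_metric (K n)) (\<lambda>t. restrict (f t) (K n)) t t' < \<delta> \<longrightarrow>
        stepanov_dist q euclidean_metric (nemytskii f u) t t' < 1 / real (Suc n))" ..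
  show thesis
  proof (rule that)
    show "compact (K n)" for n
      using K by blast
    fix \<epsilon> :: real assume "\<epsilon> > 0"
    then obtain n where n: "1 / Suc n < \<epsilon>"
      by (metis nat_approx_posE)
    obtain \<delta> where \<delta>: "\<delta> > 0" "\<forall>t t'. stepanov_dist p euclidean_metric u t t' < \<delta> \<longrightarrow>
        stepanov_dist q (C_metric (K n)) (\<lambda>t. restrict (f t) (K n)) t t' < \<delta> \<longrightarrow>
        stepanov_dist q euclidean_metric (nemytskii f u) t t' < 1 / real (Suc n)"
      using K[rule_format, of n] by blast
    show "\<exists>n. \<exists>\<delta>>0. \<forall>t t'. stepanov_dist p euclidean_metric u t t' < \<delta> \<longrightarrow>
        stepanov_dist q (C_metric (K n)) (\<lambda>t. restrict (f t) (K n)) t t' < \<delta> \<longrightarrow>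
        stepanov_dist q euclidean_metric (nemytskii f u) t t' < \<epsilon>"
    proof (intro exI[of _ n] exI[of _ \<delta>] conjI allI impI \<delta>(1))
      fix t t' assume "stepanov_dist p euclidean_metric u t t' < \<delta>"
        "stepanov_dist q (C_metric (K n)) (\<lambda>t. restrict (f t) (K n)) t t' < \<delta>"
      then have "stepanov_dist q euclidean_metric (nemytskii f u) t t' < 1 / real (Suc n)"
        using \<delta>(2) by simp
      with n show "stepanov_dist q euclidean_metric (nemytskii f u) t t' < \<epsilon>" by simp
    qed
  qed
qed

lemma Stepanov_continuous_on_nemytskii:
  assumes S: "S \<subseteq> Stepanov_precompact p euclidean_metric 0"
  shows "Stepanov_continuous_on p q S (nemytskii f)"
proof (rule Stepanov_continuous_onI[OF pq(1) S])
  let ?I = "lebesgue_on {0<..<1::real}"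
  fix u :: "real \<Rightarrow> 'a" and \<epsilon> :: real and w :: "nat \<Rightarrow> real \<Rightarrow> 'a" and t :: "nat \<Rightarrow> real"
  assume u: "u \<in> S" and e: "\<epsilon> > 0" and w: "\<And>n. w n \<in> S"
    and near: "\<And>n. Lp_dist ?I p euclidean_metric (\<lambda>\<theta>. w n (t n + \<theta>)) (\<lambda>\<theta>. u (t n + \<theta>)) < 1 / Suc n"
  define W where "W = range (\<lambda>t \<theta>. u (t + \<theta>)) \<union> range (\<lambda>n \<theta>. w n (t n + \<theta>))"
  have loc: "u \<in> Lp_loc p euclidean_metric 0" "w n \<in> Lp_loc p euclidean_metric 0" for n
    using u w S by (auto simp: Stepanov_precompact_def)
  have W: "W \<subseteq> Lp_fun ?I p euclidean_metric 0"
    using Lp_loc_translation[OF loc(1)] Lp_loc_translation[OF loc(2)] by (auto simp: W_def)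
  have pc: "precompact_wrt (Lp_dist ?I p euclidean_metric) W"
    unfolding W_def using u S by (intro precompact_wrt_convergent_sequence[OF pq(1) _ loc(2) near]) auto
  obtain K \<delta> where K: "compact K" "\<delta> > 0"
    "\<And>t t' \<phi> \<psi>. \<phi> \<in> W \<Longrightarrow> \<psi> \<in> W \<Longrightarrow> Lp_dist ?I p euclidean_metric \<phi> \<psi> < \<delta> \<Longrightarrow>
      stepanov_dist q (C_metric K) (\<lambda>t. restrict (f t) K) t t' < \<delta> \<Longrightarrow>
      Lp_dist ?I q euclidean_metric (\<lambda>\<theta>. f (t + \<theta>) (\<phi> \<theta>)) (\<lambda>\<theta>. f (t' + \<theta>) (\<psi> \<theta>)) < \<epsilon>"
    by (rule translates_modulus[OF W pc e]) (rule that)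
  obtain n where n: "1 / Suc n < \<delta>"
    using K(2) by (metis nat_approx_posE)
  have "(\<lambda>t. restrict (f t) K) \<in> Lp_loc q (C_metric K) (C_zero K)"
    using f[OF K(1)] by (simp add: Stepanov_precompact_def)
  \<comment> \<open>Both translates are taken at the same time, so the two parameters agree and only
    the distance of \<open>w n\<close> and \<open>u\<close> counts.\<close>
  from pseudometricD(1)[OF pseudometric_stepanov_dist[OF pq(2) C_zero_in_mspace[OF K(1)] this]]
  have "stepanov_dist q (C_metric K) (\<lambda>t. restrict (f t) K) (t n) (t n) = 0" .
  then have "Lp_dist ?I q euclidean_metric (\<lambda>\<theta>. f (t n + \<theta>) (w n (t n + \<theta>))) (\<lambda>\<theta>. f (t n + \<theta>) (u (t n + \<theta>))) < \<epsilon>"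
    using n near[of n] K(2) by (intro K(3)) (auto simp: W_def)
  then show "\<exists>n. Lp_dist ?I q euclidean_metric (\<lambda>\<theta>. nemytskii f (w n) (t n + \<theta>))
      (\<lambda>\<theta>. nemytskii f u (t n + \<theta>)) < \<epsilon>"
    unfolding nemytskii_def by blast
qed

lemma nemytskii_Stepanov_aa:
  assumes aa: "\<And>K. compact K \<Longrightarrow> (\<lambda>t. restrict (f t) K) \<in> Stepanov_aa q (C_metric K) (C_zero K)"
    and u: "u \<in> Stepanov_aa p euclidean_metric 0"
  shows "nemytskii f u \<in> Stepanov_aa q euclidean_metric 0"
proof (rule Stepanov_aaI[OF pq(2)])
  have z: "(0 :: 'a) \<in> mspace euclidean_metric" by simp
  note u' = Stepanov_aaD[OF pq(1) z u]
  have "u \<in> Stepanov_precompact p euclidean_metric 0"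
    using Stepanov_aa_precompact[OF pq(1) z] u by blast
  then obtain K where K: "\<And>n. compact (K n)"
    "\<And>\<epsilon>. \<epsilon> > 0 \<Longrightarrow> \<exists>n :: nat. \<exists>\<delta>>0. \<forall>t t'. stepanov_dist p euclidean_metric u t t' < \<delta> \<longrightarrow>
      stepanov_dist q (C_metric (K n)) (\<lambda>t. restrict (f t) (K n)) t t' < \<delta> \<longrightarrow>
      stepanov_dist q euclidean_metric (nemytskii f u) t t' < \<epsilon>"
    by (rule nemytskii_modulus) (rule that)
  show "nemytskii f u \<in> Lp_loc q euclidean_metric 0"
    by (rule nemytskii_Lp_loc[OF u'(1)])
  show "almost_automorphic_wrt (stepanov_dist q euclidean_metric (nemytskii f u))"
    by (rule almost_automorphic_wrt_modulus[OF
          Stepanov_aaD(2)[OF pq(2) C_zero_in_mspace[OF K(1)] aa[OF K(1)]] u'(2) K(2)])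
qed

lemma nemytskii_Stepanov_ap:
  assumes ap: "\<And>K. compact K \<Longrightarrow> (\<lambda>t. restrict (f t) K) \<in> Stepanov_ap q (C_metric K) (C_zero K)"
    and u: "u \<in> Stepanov_ap p euclidean_metric 0"
  shows "nemytskii f u \<in> Stepanov_ap q euclidean_metric 0"
proof (rule Stepanov_apI[OF pq(2)])
  have z: "(0 :: 'a) \<in> mspace euclidean_metric" by simp
  note u' = Stepanov_apD[OF pq(1) z u]
  have "u \<in> Stepanov_precompact p euclidean_metric 0"
    using Stepanov_ap_precompact[OF pq(1) z] u by blast
  then obtain K where K: "\<And>n. compact (K n)"
    "\<And>\<epsilon>. \<epsilon> > 0 \<Longrightarrow> \<exists>n :: nat. \<exists>\<delta>>0. \<forall>t t'. stepanov_dist p euclidean_metric u t t' < \<delta> \<longrightarrow>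
      stepanov_dist q (C_metric (K n)) (\<lambda>t. restrict (f t) (K n)) t t' < \<delta> \<longrightarrow>
      stepanov_dist q euclidean_metric (nemytskii f u) t t' < \<epsilon>"
    by (rule nemytskii_modulus) (rule that)
  note fK = Stepanov_apD[OF pq(2) C_zero_in_mspace[OF K(1)] ap[OF K(1)]]
  show "nemytskii f u \<in> Lp_loc q euclidean_metric 0"
    by (rule nemytskii_Lp_loc[OF u'(1)])
  show "almost_periodic_wrt (stepanov_dist q euclidean_metric (nemytskii f u))"
    by (rule almost_periodic_wrt_modulus[OF
          pseudometric_stepanov_dist[OF pq(2) C_zero_in_mspace[OF K(1)] fK(1)] fK(2)
          pseudometric_stepanov_dist[OF pq(1) z u'(1)] u'(2) K(2)])
qed simp

end

theorem theorem6p6: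
  fixes f :: "real \<Rightarrow> 'a::banach \<Rightarrow> 'b::banach"
    and p q a :: real and b :: "real \<Rightarrow> real"
  assumes "1 \<le> p" and "1 \<le> q" and "0 < a"
    and "b \<in> Stepanov_aa q euclidean_metric 0"
    and "AE t in lebesgue. \<forall>x. norm (f t x) \<le> a * norm x powr (p / q) + b t"
  shows
    "((\<forall>K. compact K \<longrightarrow> (\<lambda>t. restrict (f t) K) \<in> Stepanov_aa q (C_metric K) (C_zero K)) \<longrightarrow>
        nemytskii f \<in> Stepanov_aa p euclidean_metric 0 \<rightarrow> Stepanov_aa q euclidean_metric 0 \<and>
        Stepanov_continuous_on p q (Stepanov_aa p euclidean_metric 0) (nemytskii f)) \<and>
     ((\<forall>K. compact K \<longrightarrow> (\<lambda>t. restrict (f t) K) \<in> Stepanov_ap q (C_metric K) (C_zero K)) \<longrightarrow>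
        nemytskii f \<in> Stepanov_ap p euclidean_metric 0 \<rightarrow> Stepanov_ap q euclidean_metric 0 \<and>
        Stepanov_continuous_on p q (Stepanov_ap p euclidean_metric 0) (nemytskii f))"
proof (intro conjI impI)
  have b: "b \<in> Stepanov_precompact q euclidean_metric 0"
    using Stepanov_aa_precompact[OF \<open>1 \<le> q\<close>, of "0 :: real" euclidean_metric] assms(4) by auto
  have z: "(0 :: 'a) \<in> mspace euclidean_metric" by simp
  {
    assume aa: "\<forall>K. compact K \<longrightarrow> (\<lambda>t. restrict (f t) K) \<in> Stepanov_aa q (C_metric K) (C_zero K)"
    interpret superposition f p q a b
    proof
      show "(\<lambda>t. restrict (f t) K) \<in> Stepanov_precompact q (C_metric K) (C_zero K)" if "compact K" for K
        using Stepanov_aa_precompact[OF \<open>1 \<le> q\<close> C_zero_in_mspace[OF that]] aa that by blast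
    qed (use assms b in auto)
    show "nemytskii f \<in> Stepanov_aa p euclidean_metric 0 \<rightarrow> Stepanov_aa q euclidean_metric 0"
      using aa nemytskii_Stepanov_aa by blast
    show "Stepanov_continuous_on p q (Stepanov_aa p euclidean_metric 0) (nemytskii f)"
      by (rule Stepanov_continuous_on_nemytskii[OF Stepanov_aa_precompact[OF \<open>1 \<le> p\<close> z]])
  next
    assume ap: "\<forall>K. compact K \<longrightarrow> (\<lambda>t. restrict (f t) K) \<in> Stepanov_ap q (C_metric K) (C_zero K)"
    interpret superposition f p q a b
    proof
      show "(\<lambda>t. restrict (f t) K) \<in> Stepanov_precompact q (C_metric K) (C_zero K)" if "compact K" for K
        using Stepanov_ap_precompact[OF \<open>1 \<le> q\<close> C_zero_in_mspace[OF that]] ap that by blast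
    qed (use assms b in auto)
    show "nemytskii f \<in> Stepanov_ap p euclidean_metric 0 \<rightarrow> Stepanov_ap q euclidean_metric 0"
      using ap nemytskii_Stepanov_ap by blast
    show "Stepanov_continuous_on p q (Stepanov_ap p euclidean_metric 0) (nemytskii f)"
      by (rule Stepanov_continuous_on_nemytskii[OF Stepanov_ap_precompact[OF \<open>1 \<le> p\<close> z]])
  }
qed

end
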